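(* Let $b>0$. Let $X=\{X_t\}_{t\in[0,\infty)}$ be a spectrally negative Lévy process with $X_0=0$ and characteristics $(\sigma,m,\nu)$ as in the context, and assume that $m=0$, that $\nu((0,\infty))=0$ and $\int_{(-\infty,0)}\min\{z^2,|z|\}\,\nu(dz)<\infty$, that condition $\mathbf{B}_2$ holds (the function $x\mapsto\nu((-\infty,-x])$, $x>0$, is left-continuous and $\int_{(-\infty,-1)}z^2\,\nu(dz)<\infty$), and that $$\sigma>0\quad\text{or}\quad\liminf_{x\downarrow0}\Big\{x^{s-2}\int_{(-x,0)}z^2\,\nu(dz)\Big\}>0\ \text{ for some } s\in(0,2).$$ Then the distribution $P(\tau_b\in\cdot)$ is absolutely continuous on $(0,\infty)$ and its density function $p_b(t)$ satisfies $$p_b(t)\sim\frac{b}{\sqrt{2\pi c^2}}\,t^{-\frac32}\quad\text{as } t\to\infty,$$ where $c^2=\sigma^2+\int_{(-\infty,0)}z^2\,\nu(dz)$.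
   Context: $X=\{X_t\}_{t\in[0,\infty)}$ is a Lévy process on a probability space $(\Omega,\mathcal F,P)$ with $X_0=0$ and $E[e^{i\lambda X_1}]=e^{\Psi(i\lambda)}$, $\lambda\in\mathbf R$, where $$\Psi(\xi)=\frac{\sigma^2}{2}\xi^2+m\xi+\int_{(-\infty,0)}(e^{\xi z}-1-\xi z)\,\nu(dz),$$ $\sigma\ge0$, $m\in\mathbf R$, and $\nu$ is the Lévy measure on $\mathbf R$. The first passage time over $b>0$ is $\tau_b=\inf\{t>0: X_t>b\}$, with $\tau_b=\infty$ if the set is empty. Here $f\sim h$ means that the ratio tends to $1$. *)

theory Defs
  imports "HOL-Probability.Probability" "HOL-Library.Landau_Symbols"
begin

text \<open>Paths are indexed by \<^typ>\<open>real\<close>; only their values at times \<open>t \<ge> 0\<close> are ever used.\<close>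

definition cadlag_path :: "(real \<Rightarrow> real) \<Rightarrow> bool" where
  "cadlag_path f \<longleftrightarrow>
     (\<forall>t\<ge>0. continuous (at_right t) f) \<and> (\<forall>t>0. \<exists>l. (f \<longlongrightarrow> l) (at_left t))"

text \<open>
  Starting point and path regularity are only required almost surely. Stochastic continuity
  is not listed, since it follows from right-continuity and stationarity of the increments.
\<close>

definition levy_process :: "'a measure \<Rightarrow> (real \<Rightarrow> 'a \<Rightarrow> real) \<Rightarrow> bool" where
  "levy_process M X \<longleftrightarrow>
     prob_space M \<and>
     (\<forall>t\<ge>0. X t \<in> borel_measurable M) \<and>
     (AE \<omega> in M. X 0 \<omega> = 0) \<and>
     (\<forall>(n::nat) s. 0 \<le> s 0 \<and> (\<forall>i<n. s i < s (Suc i)) \<longrightarrow>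
        prob_space.indep_vars M (\<lambda>_. borel) (\<lambda>i \<omega>. X (s (Suc i)) \<omega> - X (s i) \<omega>) {..<n}) \<and>
     (\<forall>s\<ge>0. \<forall>t\<ge>0. distr M borel (\<lambda>\<omega>. X (s + t) \<omega> - X s \<omega>)
        = distr M borel (\<lambda>\<omega>. X t \<omega> - X 0 \<omega>)) \<and>
     (AE \<omega> in M. cadlag_path (\<lambda>t. X t \<omega>))"

definition levy_measure :: "real measure \<Rightarrow> bool" where
  "levy_measure \<nu> \<longleftrightarrow>
     sets \<nu> = sets borel \<and> emeasure \<nu> {0} = 0 \<and>
     (\<integral>\<^sup>+ z. ennreal (min 1 (z\<^sup>2)) \<partial>\<nu>) < \<infinity>"

definition levy_exponent :: "real \<Rightarrow> real \<Rightarrow> real measure \<Rightarrow> complex \<Rightarrow> complex" where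
  "levy_exponent \<sigma> m \<nu> \<xi> =
     of_real (\<sigma>\<^sup>2 / 2) * \<xi>\<^sup>2 + of_real m * \<xi> +
     (CLINT z:{..<0}|\<nu>. exp (\<xi> * of_real z) - 1 - \<xi> * of_real z)"

definition condition_B2 :: "real measure \<Rightarrow> bool" where
  "condition_B2 \<nu> \<longleftrightarrow>
     (\<forall>x>0. continuous (at_left x) (\<lambda>y. measure \<nu> {..-y})) \<and>
     (\<integral>\<^sup>+ z\<in>{..<-1}. ennreal (z\<^sup>2) \<partial>\<nu>) < \<infinity>"

text \<open>The infimum is taken in \<^typ>\<open>ereal\<close>, so that it equals \<open>\<infinity>\<close> for the empty set.\<close>

definition first_passage_time :: "(real \<Rightarrow> 'a \<Rightarrow> real) \<Rightarrow> real \<Rightarrow> 'a \<Rightarrow> ereal" where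
  "first_passage_time X b \<omega> = (INF t\<in>{t. 0 < t \<and> b < X t \<omega>}. ereal t)"

text \<open>
  With paths that are cadlag only almost surely, the first passage time need not be measurable
  with respect to \<open>M\<close> itself; its law is therefore taken under the completion of \<open>M\<close>. If it is
  \<open>M\<close>-measurable, this is the law under \<open>M\<close>.
\<close>

definition first_passage_law :: "'a measure \<Rightarrow> (real \<Rightarrow> 'a \<Rightarrow> real) \<Rightarrow> real \<Rightarrow> ereal measure" where
  "first_passage_law M X b = distr (completion M) borel (first_passage_time X b)"

text \<open>
  Absolute continuity on \<open>(0,\<infinity>)\<close> with density \<open>p\<close>. The law \<open>\<mu>\<close> may have mass at \<open>\<infinity>\<close> or
  outside \<open>(0,\<infinity>)\<close>, on which nothing is asserted.
\<close>

definition has_density_on_pos :: "ereal measure \<Rightarrow> (real \<Rightarrow> real) \<Rightarrow> bool" where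
  "has_density_on_pos \<mu> p \<longleftrightarrow>
     p \<in> borel_measurable borel \<and> (\<forall>t>0. 0 \<le> p t) \<and>
     (\<forall>A\<in>sets borel. A \<subseteq> {0<..} \<longrightarrow>
        emeasure \<mu> (ereal ` A) = (\<integral>\<^sup>+ t\<in>A. ennreal (p t) \<partial>lborel))"

end

theory Submission
  imports Defs
begin

text \<open>
  The density of the first passage time is given by Kendall's identity
  \<open>P(\<tau>\<^sub>b \<in> dt) = (b / t) f\<^sub>t(b) dt\<close>, where \<open>f\<^sub>t\<close> is the density of \<open>X\<^sub>t\<close>. The asymptotics are then the local
  limit theorem \<open>f\<^sub>t(b) \<sim> 1 / sqrt (2 \<pi> c\<^sup>2 t)\<close>.

  Kendall's identity rests on a combinatorial fact about a finite sequence of real numbers with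
  partial sums \<open>S\<^sub>k\<close> and running maxima \<open>R\<^sub>k\<close>: summed over the \<open>n\<close> cyclic shifts of the sequence, the
  last increments \<open>R\<^sub>n - R\<^sub>n\<^sub>-\<^sub>1\<close> add up to \<open>max 0 S\<^sub>n\<close> (\<open>cyclic_record_sum\<close>). Indeed, the periodic
  extension of a path with positive drift raises its running maximum by exactly \<open>S\<^sub>n\<close> per period. As
  the increments of \<open>X\<close> over a grid are independent and identically distributed, and as
  \<open>R\<^sub>n = S\<^sub>n\<close> whenever \<open>R\<^sub>n \<noteq> R\<^sub>n\<^sub>-\<^sub>1\<close>, it follows that
  \<open>E[(R\<^sub>n - R\<^sub>n\<^sub>-\<^sub>1); p < R\<^sub>n \<le> q] = E[S\<^sub>n; p < S\<^sub>n \<le> q] / n\<close> (\<open>record_increment_expectation\<close>).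
  Summing over the grid times in \<open>(s, t]\<close>, the right-hand side is a Riemann sum for the integral of
  \<open>E[X\<^sub>u; p < X\<^sub>u \<le> q] / u\<close>, while the left-hand side is close to the expected length of the part of
  \<open>(p, q]\<close> that the running maximum sweeps over between the times \<open>s\<close> and \<open>t\<close>, provided that it does
  not jump. Division by \<open>q - p\<close> and the limit \<open>q \<rightarrow> p = b\<close> give \<open>P(s < \<tau>\<^sub>b \<le> t)\<close>
  (\<open>kendall_sandwich\<close>, \<open>kendall_identity\<close>).

  That the running maximum does not jump is where spectral negativity enters, in the form
  \<open>n P(X\<^bsub>1/n\<^esub> > \<eta>) \<rightarrow> 0\<close> (\<open>positive_tail_tendsto_0\<close>). This is read off the characteristic function:
  the measures \<open>n (1 - exp (-x\<^sup>2/2)) P(X\<^bsub>1/n\<^esub> \<in> dx)\<close> converge weakly to a measure on \<open>(-\<infinity>, 0]\<close>.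

  The exponent is used in Kolmogorov's form, as the integral of \<open>(exp (\<i> u z) - 1 - \<i> u z) / z\<^sup>2\<close> against
  the finite measure \<open>K = \<sigma>\<^sup>2 \<delta>\<^sub>0 + z\<^sup>2 \<nu>(dz)\<close>, whose total mass is \<open>c\<^sup>2\<close>. The assumption on the
  small jumps says that \<open>K(-x, 0]\<close> is at least of the order of \<open>x\<^bsup>2-r\<^esup>\<close> for some \<open>0 < r < 2\<close>, where a
  Gaussian part allows \<open>r = 1\<close>. Hence \<open>|E exp (\<i> u X\<^sub>t)|\<close> decays at least like
  \<open>exp (- \<delta> t |u|\<^bsup>r\<^esup>)\<close> for large \<open>u\<close> (\<open>Re_psi_decay\<close>). Fourier inversion then gives
  \<open>P(p < X\<^sub>t \<le> q) = (q - p) f\<^sub>t(p) + O((q - p)\<^sup>2)\<close> uniformly in \<open>t \<ge> s > 0\<close> (\<open>time_density_approx\<close>), and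
  dominated convergence yields the asymptotics of \<open>f\<^sub>t\<close> (\<open>time_density_asymptotics\<close>).
\<close>

section \<open>The exponent in Kolmogorov form\<close>

text \<open>
  The value at \<open>z = 0\<close> is the limit for \<open>z \<rightarrow> 0\<close>; in this way an atom of the integrating measure
  at \<open>0\<close> accounts for the Gaussian part of the exponent.
\<close>

definition levy_kernel :: "real \<Rightarrow> real \<Rightarrow> complex" where
  "levy_kernel u z =
     (if z = 0 then of_real (- u\<^sup>2 / 2) else (iexp (u * z) - 1 - \<i> * of_real (u * z)) / of_real (z\<^sup>2))"

lemma levy_kernel_measurable [measurable]:
  assumes [measurable]: "f \<in> borel_measurable M" "g \<in> borel_measurable M"
  shows "(\<lambda>x. levy_kernel (f x) (g x)) \<in> borel_measurable M"
  unfolding levy_kernel_def by measurable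

lemma levy_kernel_bound: "cmod (levy_kernel u z) \<le> u\<^sup>2 / 2"
proof (cases "z = 0")
  case True
  then show ?thesis by (simp add: levy_kernel_def norm_divide norm_power)
next
  case False
  have "cmod (iexp (u * z) - 1 - \<i> * of_real (u * z)) \<le> \<bar>u * z\<bar>^2 / 2"
    using iexp_approx1[of "u * z" 1] by (simp add: numeral_2_eq_2 diff_diff_add)
  also have "\<dots> = (u\<^sup>2 / 2) * z\<^sup>2" by (simp add: power_mult_distrib)
  finally show ?thesis using False
    by (simp add: levy_kernel_def norm_divide norm_power divide_le_eq)
qed

lemma levy_kernel_near_0: "cmod (levy_kernel u z - of_real (- u\<^sup>2 / 2)) \<le> \<bar>u\<bar> ^ 3 * \<bar>z\<bar> / 6"
proof (cases "z = 0")
  case False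
  have "cmod (iexp (u * z) - (1 + \<i> * of_real (u * z) - of_real ((u * z)\<^sup>2 / 2))) \<le> \<bar>u * z\<bar>^3 / 6"
    using iexp_approx1[of "u * z" 2] by (simp add: fact_numeral numeral_eq_Suc algebra_simps)
  moreover have "levy_kernel u z - of_real (- u\<^sup>2 / 2)
      = (iexp (u * z) - (1 + \<i> * of_real (u * z) - of_real ((u * z)\<^sup>2 / 2))) / of_real (z\<^sup>2)"
    using False by (simp add: levy_kernel_def field_simps power2_eq_square)
  moreover have "\<bar>u * z\<bar>^3 / 6 = (\<bar>u\<bar> ^ 3 * \<bar>z\<bar> / 6) * z\<^sup>2"
    by (simp add: abs_mult power_mult_distrib power3_eq_cube power2_eq_square flip: abs_mult)
  ultimately show ?thesis using False
    by (simp add: norm_divide norm_power divide_le_eq)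
qed (simp add: levy_kernel_def)

lemma levy_kernel_scaling_bound:
  assumes "t > 0" shows "cmod (of_real t * levy_kernel (u / sqrt t) z) \<le> u\<^sup>2 / 2"
proof -
  have "cmod (of_real t * levy_kernel (u / sqrt t) z) = t * cmod (levy_kernel (u / sqrt t) z)"
    using assms by (simp add: norm_mult)
  also have "\<dots> \<le> t * ((u / sqrt t)\<^sup>2 / 2)"
    using assms by (intro mult_left_mono levy_kernel_bound) auto
  also have "\<dots> = u\<^sup>2 / 2" using assms by (simp add: power_divide)
  finally show ?thesis .
qed

lemma levy_kernel_scaling:
  "((\<lambda>t. of_real t * levy_kernel (u / sqrt t) z) \<longlongrightarrow> of_real (- u\<^sup>2 / 2)) at_top"
proof (rule Lim_null[THEN iffD2], rule Lim_null_comparison)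
  have "cmod (of_real t * levy_kernel (u / sqrt t) z - of_real (- u\<^sup>2 / 2))
      \<le> \<bar>u\<bar> ^ 3 * \<bar>z\<bar> / 6 * (1 / sqrt t)" if t: "t > 0" for t
  proof -
    define x where "x = - (u / sqrt t)\<^sup>2 / 2"
    have "- u\<^sup>2 / 2 = t * x" using t by (simp add: x_def power_divide)
    then have "of_real t * levy_kernel (u / sqrt t) z - of_real (- u\<^sup>2 / 2)
        = of_real t * (levy_kernel (u / sqrt t) z - of_real x)"
      by (simp add: right_diff_distrib)
    also have "cmod \<dots> = t * cmod (levy_kernel (u / sqrt t) z - of_real x)"
      using t by (simp add: norm_mult)
    also have "\<dots> \<le> t * (\<bar>u / sqrt t\<bar> ^ 3 * \<bar>z\<bar> / 6)"
      using t unfolding x_def by (intro mult_left_mono levy_kernel_near_0) auto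
    also have "\<dots> = \<bar>u\<bar> ^ 3 * \<bar>z\<bar> / 6 * (t / (sqrt t ^ 3))"
      using t by (simp add: power_divide mult_ac)
    also have "t / sqrt t ^ 3 = 1 / sqrt t"
      using t by (simp add: power3_eq_cube)
    finally show ?thesis .
  qed
  then show "\<forall>\<^sub>F t in at_top. cmod (of_real t * levy_kernel (u / sqrt t) z - of_real (- u\<^sup>2 / 2))
      \<le> \<bar>u\<bar> ^ 3 * \<bar>z\<bar> / 6 * (1 / sqrt t)"
    by (rule eventually_mono[OF eventually_gt_at_top[of 0]])
  have "((\<lambda>t::real. 1 / sqrt t) \<longlongrightarrow> 0) at_top"
    by (rule tendsto_divide_0[OF tendsto_const]) (rule filterlim_at_top_imp_at_infinity[OF sqrt_at_top])
  then show "((\<lambda>t. \<bar>u\<bar> ^ 3 * \<bar>z\<bar> / 6 * (1 / sqrt t)) \<longlongrightarrow> 0) at_top"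
    by (rule tendsto_mult_right_zero)
qed

lemma isCont_levy_kernel: "isCont (\<lambda>u. levy_kernel u z) u"
  unfolding levy_kernel_def by (cases "z = 0") (auto intro!: continuous_intros)

lemma Re_levy_kernel:
  "Re (levy_kernel u z) = (if z = 0 then - u\<^sup>2 / 2 else (cos (u * z) - 1) / z\<^sup>2)"
proof (cases "z = 0")
  case False
  have "levy_kernel u z = (cis (u * z) - 1 - \<i> * of_real (u * z)) / of_real (z\<^sup>2)"
    using False by (simp add: levy_kernel_def cis_conv_exp)
  then show ?thesis using False by (simp only: Re_divide_of_real) simp
qed (simp add: levy_kernel_def)

lemma cos_le_one_minus_quarter_square:
  fixes y :: real assumes "\<bar>y\<bar> \<le> 1" shows "cos y \<le> 1 - y\<^sup>2 / 4"
proof -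
  have "cmod (iexp y - (\<Sum>k\<le>3. (\<i> * y)^k / fact k)) \<le> y ^ 4 / 24"
    using iexp_approx1[of y 3] by (simp add: fact_numeral numeral_eq_Suc)
  then have "\<bar>Re (cis y - (\<Sum>k\<le>3. (\<i> * y)^k / fact k))\<bar> \<le> y ^ 4 / 24"
    unfolding cis_conv_exp by (rule order_trans[OF abs_Re_le_cmod])
  then have "cos y - 1 + y\<^sup>2 / 2 \<le> y ^ 4 / 24"
    unfolding abs_le_iff by (simp add: numeral_eq_Suc algebra_simps)
  moreover have "y ^ 4 = y\<^sup>2 * y\<^sup>2" by (simp flip: power_add)
  moreover have "y\<^sup>2 * y\<^sup>2 \<le> y\<^sup>2 * 1"
    using assms by (intro mult_left_mono) (auto simp: abs_square_le_1)
  moreover have "0 \<le> y\<^sup>2" by simp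
  ultimately show ?thesis by linarith
qed

lemma Re_levy_kernel_nonpos: "Re (levy_kernel u z) \<le> 0"
  by (auto simp: Re_levy_kernel divide_nonpos_nonneg)

lemma Re_levy_kernel_le:
  assumes "\<bar>u * z\<bar> \<le> 1" shows "Re (levy_kernel u z) \<le> - u\<^sup>2 / 4"
proof (cases "z = 0")
  case False
  have "cos (u * z) - 1 \<le> (- u\<^sup>2 / 4) * z\<^sup>2"
    using cos_le_one_minus_quarter_square[OF assms] by (simp add: power_mult_distrib)
  then show ?thesis using False by (simp add: Re_levy_kernel divide_le_eq)
qed (simp add: Re_levy_kernel)

text \<open>
  The multiplier that damping by a Gaussian produces on the kernel, again with its limit at \<open>0\<close>.
  Being bounded and strictly positive, it does not change which sets are null.
\<close>

definition levy_weight :: "real \<Rightarrow> real" where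
  "levy_weight z = (if z = 0 then 1 / 2 else (1 - exp (- z\<^sup>2 / 2)) / z\<^sup>2)"

lemma levy_weight_measurable [measurable]: "levy_weight \<in> borel_measurable borel"
  unfolding levy_weight_def by measurable

lemma levy_weight_pos: "0 < levy_weight z"
  by (auto simp: levy_weight_def)

lemma levy_weight_le: "levy_weight z \<le> 1 / 2"
proof (cases "z = 0")
  case False
  have "1 - exp (- z\<^sup>2 / 2) \<le> z\<^sup>2 / 2" using exp_ge_add_one_self[of "- z\<^sup>2 / 2"] by simp
  with False show ?thesis by (simp add: levy_weight_def divide_le_eq)
qed (simp add: levy_weight_def)

abbreviation gaussian :: "real measure" where
  "gaussian \<equiv> std_normal_distribution"

interpretation std_normal: real_distribution gaussian
  by (rule real_dist_normal_dist)

lemma std_normal_moments: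
  shows "integrable gaussian (\<lambda>v. v)" "(\<integral>v. v \<partial>gaussian) = 0"
    and "integrable gaussian (\<lambda>v. v\<^sup>2)" "(\<integral>v. v\<^sup>2 \<partial>gaussian) = 1"
  using integrable_std_normal_distribution_moment[of 1] integrable_std_normal_distribution_moment[of 2]
    integral_std_normal_distribution_moment_odd[of 1] std_normal_distribution_even_moments[of 1] by auto

lemma std_normal_iexp_shift:
  "(CLINT v|gaussian. iexp ((u + v) * z)) = iexp (u * z) * of_real (exp (- z\<^sup>2 / 2))"
proof -
  have "(CLINT v|gaussian. iexp ((u + v) * z))
      = (CLINT v|gaussian. iexp (u * z) * iexp (z * v))"
    by (intro Bochner_Integration.integral_cong) (auto simp: exp_add[symmetric] algebra_simps)
  also have "\<dots> = iexp (u * z) * char gaussian z"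
    by (simp add: char_def)
  finally show ?thesis by (simp add: char_std_normal_distribution)
qed

text \<open>
  Averaging \<open>exp (\<i> (u + v) z)\<close> over a standard normal \<open>v\<close> multiplies \<open>exp (\<i> u z)\<close> by
  \<open>exp (- z\<^sup>2 / 2)\<close>, and the linear term of the kernel has mean zero under this average. So the
  compensated kernel turns into a genuine Fourier kernel.
\<close>

lemma levy_kernel_gaussian_average:
  "levy_kernel u z - (CLINT v|gaussian. levy_kernel (u + v) z)
     = iexp (u * z) * of_real (levy_weight z)"
proof (cases "z = 0")
  case True
  have "(LINT v|gaussian. - ((u + v)\<^sup>2) / 2)
      = (LINT v|gaussian. - u\<^sup>2 / 2 - u * v - v\<^sup>2 / 2)"
    by (intro Bochner_Integration.integral_cong) (auto simp: power2_eq_square field_simps)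
  also have "\<dots> = - u\<^sup>2 / 2 - 1 / 2"
    using std_normal_moments std_normal.prob_space by simp
  finally have "(CLINT v|gaussian. of_real (- ((u + v)\<^sup>2) / 2)) = complex_of_real (- u\<^sup>2 / 2 - 1 / 2)"
    by (simp only: integral_complex_of_real)
  with True show ?thesis by (simp add: levy_kernel_def levy_weight_def)
next
  case False
  have i: "integrable gaussian (\<lambda>v. iexp ((u + v) * z))"
    by (intro std_normal.integrable_iexp) auto
  have "(CLINT v|gaussian. levy_kernel (u + v) z)
     = (CLINT v|gaussian. (iexp ((u + v) * z) - 1 - \<i> * of_real ((u + v) * z))) / of_real (z\<^sup>2)"
    using False by (simp add: levy_kernel_def)
  also have "(CLINT v|gaussian. (iexp ((u + v) * z) - 1 - \<i> * of_real ((u + v) * z)))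
     = (CLINT v|gaussian. iexp ((u + v) * z) - (1 + \<i> * of_real (u * z)) - (\<i> * of_real z) * of_real v)"
    by (intro Bochner_Integration.integral_cong) (auto simp: algebra_simps)
  also have "\<dots> = (CLINT v|gaussian. iexp ((u + v) * z)) - (1 + \<i> * of_real (u * z))"
    using i std_normal_moments std_normal.prob_space by simp
  finally have "(CLINT v|gaussian. levy_kernel (u + v) z)
     = (iexp (u * z) * of_real (exp (- z\<^sup>2 / 2)) - (1 + \<i> * of_real (u * z))) / of_real (z\<^sup>2)"
    unfolding std_normal_iexp_shift .
  with False show ?thesis
    by (simp add: levy_kernel_def levy_weight_def diff_divide_distrib algebra_simps)
qed

text \<open>
  The lower bound on the mass near \<open>0\<close> covers both a Gaussian part (an atom at \<open>0\<close>, with \<open>r = 1\<close>)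
  and small jumps of positive index \<open>r\<close>.
\<close>

locale kolmogorov_measure = finite_measure K for K :: "real measure" +
  assumes sets_K [measurable_cong]: "sets K = sets borel"
    and no_positive: "emeasure K {0<..} = 0"
    and small_mass: "\<exists>c>0. \<exists>x0>0. \<exists>r. 0 < r \<and> r < 2 \<and>
        (\<forall>x. 0 < x \<and> x \<le> x0 \<longrightarrow> c * x powr (2 - r) \<le> measure K {-x<..0})"
begin

definition psi :: "real \<Rightarrow> complex" where
  "psi u = (CLINT z|K. levy_kernel u z)"

definition variance :: real where "variance = measure K (space K)"

lemma space_K: "space K = UNIV"
  using sets_eq_imp_space_eq[OF sets_K] by simp

lemma integrable_levy_kernel: "integrable K (levy_kernel u)"
  by (rule integrable_const_bound[of _ "u\<^sup>2 / 2"]) (use levy_kernel_bound in auto)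

lemma psi_bound: "cmod (psi u) \<le> variance * u\<^sup>2 / 2"
proof -
  have "cmod (psi u) \<le> (LINT z|K. cmod (levy_kernel u z))"
    unfolding psi_def by (rule integral_norm_bound)
  also have "\<dots> \<le> (LINT z|K. u\<^sup>2 / 2)"
    by (intro integral_mono integrable_norm integrable_levy_kernel levy_kernel_bound) simp
  finally show ?thesis by (simp add: variance_def)
qed

lemma psi_0: "psi 0 = 0"
  using psi_bound[of 0] by simp

lemma isCont_psi: "isCont psi u"
  unfolding continuous_at_sequentially
proof safe
  fix X assume X: "X \<longlonglongrightarrow> u"
  then have "Bseq X" by (intro convergent_imp_Bseq convergentI)
  then obtain B where B: "\<And>n. \<bar>X n\<bar> \<le> B" by (auto simp: Bseq_def)
  show "(psi \<circ> X) \<longlonglongrightarrow> psi u"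
    unfolding comp_def psi_def
  proof (rule integral_dominated_convergence[where w="\<lambda>_. B\<^sup>2 / 2"])
    show "AE z in K. (\<lambda>n. levy_kernel (X n) z) \<longlonglongrightarrow> levy_kernel u z"
      by (auto intro: isCont_tendsto_compose[OF isCont_levy_kernel] X)
    have "cmod (levy_kernel (X n) z) \<le> B\<^sup>2 / 2" for n z
      using levy_kernel_bound[of "X n" z] power_mono[OF B[of n], of 2] by simp
    then show "AE z in K. cmod (levy_kernel (X n) z) \<le> B\<^sup>2 / 2" for n by simp
  qed auto
qed

lemma psi_measurable [measurable]: "psi \<in> borel_measurable borel"
  by (auto intro!: borel_measurable_continuous_onI continuous_at_imp_continuous_on isCont_psi)

lemma Re_psi: "Re (psi u) = (LINT z|K. Re (levy_kernel u z))"
  unfolding psi_def by (rule integral_Re[symmetric]) (rule integrable_levy_kernel)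

lemma Re_psi_nonpos: "Re (psi u) \<le> 0"
  unfolding Re_psi using integral_nonneg_AE[of "\<lambda>z. - Re (levy_kernel u z)" K]
  by (simp add: Re_levy_kernel_nonpos)

lemma Re_psi_le:
  assumes "x > 0" "\<bar>u\<bar> * x \<le> 1"
  shows "Re (psi u) \<le> - (u\<^sup>2 / 4) * measure K {-x<..0}"
proof -
  have "Re (levy_kernel u z) \<le> - (u\<^sup>2 / 4) * indicator {-x<..0} z" for z
  proof (cases "z \<in> {-x<..0}")
    case True
    then have "\<bar>z\<bar> \<le> x" by auto
    then have "\<bar>u\<bar> * \<bar>z\<bar> \<le> \<bar>u\<bar> * x" by (rule mult_left_mono) simp
    with assms have "\<bar>u * z\<bar> \<le> 1" by (simp add: abs_mult)
    with True show ?thesis using Re_levy_kernel_le by simp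
  qed (simp add: Re_levy_kernel_nonpos)
  moreover have i: "integrable K (indicator {-x<..0} :: real \<Rightarrow> real)"
    by (rule integrable_real_indicator) (simp_all add: sets_K emeasure_eq_measure)
  moreover have "integrable K (\<lambda>z. Re (levy_kernel u z))"
    by (rule integrable_Re) (rule integrable_levy_kernel)
  ultimately have "Re (psi u) \<le> (LINT z|K. - (u\<^sup>2 / 4) * indicator {-x<..0} z)"
    unfolding Re_psi by (intro integral_mono integrable_mult_right)
  also have "\<dots> = - (u\<^sup>2 / 4) * measure K {-x<..0}"
    using i by (simp add: space_K)
  finally show ?thesis .
qed

text \<open>
  Only the \<open>z\<close> with \<open>|u z| \<le> 1\<close> are used: there \<open>1 - cos (u z) \<ge> (u z)\<^sup>2 / 4\<close>, and their
  \<open>K\<close>-mass is bounded below by \<open>small_mass\<close>.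
\<close>

lemma Re_psi_decay:
  "\<exists>\<delta> r. 0 < \<delta> \<and> 0 < r \<and> r < 2 \<and> (\<forall>u. Re (psi u) \<le> - \<delta> * min (u\<^sup>2) (\<bar>u\<bar> powr r))"
proof -
  obtain c x0 r where c: "c > 0" and x0: "x0 > 0" and r: "0 < r" "r < 2"
    and m: "\<And>x. 0 < x \<Longrightarrow> x \<le> x0 \<Longrightarrow> c * x powr (2 - r) \<le> measure K {-x<..0}"
    using small_mass by blast
  define \<delta> where "\<delta> = min (c / 4) (c * x0 powr (2 - r) / 4)"
  have d: "\<delta> > 0" using c x0 by (simp add: \<delta>_def)
  have D: "Re (psi u) \<le> - \<delta> * min (u\<^sup>2) (\<bar>u\<bar> powr r)" for u
  proof (cases "\<bar>u\<bar> * x0 \<le> 1")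
    case True
    have "Re (psi u) \<le> - (u\<^sup>2 / 4) * measure K {-x0<..0}" using Re_psi_le[OF x0 True] .
    also have "\<dots> \<le> - (u\<^sup>2 / 4) * (c * x0 powr (2 - r))"
      using m[of x0] x0 by (intro mult_left_mono_neg) auto
    also have "\<dots> = - (c * x0 powr (2 - r) / 4) * u\<^sup>2" by simp
    also have "\<dots> \<le> - \<delta> * u\<^sup>2" by (intro mult_right_mono) (auto simp: \<delta>_def)
    also have "\<dots> \<le> - \<delta> * min (u\<^sup>2) (\<bar>u\<bar> powr r)" using d by (intro mult_left_mono_neg) auto
    finally show ?thesis .
  next
    case False
    then have u: "\<bar>u\<bar> > 0" by (cases "u = 0") auto
    \<comment> \<open>The largest window on which \<open>|u z| \<le> 1\<close> holds.\<close>
    define x where "x = 1 / \<bar>u\<bar>"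
    have x: "0 < x" "x \<le> x0" "\<bar>u\<bar> * x \<le> 1" using u False by (auto simp: x_def field_simps)
    have "x powr (2 - r) = \<bar>u\<bar> powr (r - 2)"
      using u powr_minus_divide[of "\<bar>u\<bar>" "2 - r"] by (simp add: x_def powr_divide)
    then have "u\<^sup>2 * x powr (2 - r) = \<bar>u\<bar> powr 2 * \<bar>u\<bar> powr (r - 2)"
      using u powr_numeral[of "\<bar>u\<bar>" "num.Bit0 num.One"] by simp
    also have "\<dots> = \<bar>u\<bar> powr r" unfolding powr_add[symmetric] by simp
    finally have e: "u\<^sup>2 * x powr (2 - r) = \<bar>u\<bar> powr r" .
    have "Re (psi u) \<le> - (u\<^sup>2 / 4) * measure K {-x<..0}" by (rule Re_psi_le[OF x(1) x(3)])
    also have "\<dots> \<le> - (u\<^sup>2 / 4) * (c * x powr (2 - r))"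
      using m[of x] x by (intro mult_left_mono_neg) auto
    also have "\<dots> = - (c / 4) * \<bar>u\<bar> powr r" using e by (simp add: algebra_simps)
    also have "\<dots> \<le> - \<delta> * \<bar>u\<bar> powr r" by (intro mult_right_mono) (auto simp: \<delta>_def)
    also have "\<dots> \<le> - \<delta> * min (u\<^sup>2) (\<bar>u\<bar> powr r)" using d by (intro mult_left_mono_neg) auto
    finally show ?thesis .
  qed
  show ?thesis by (rule exI[of _ \<delta>], rule exI[of _ r]) (intro conjI allI d r D)
qed

lemma Re_psi_neg: "u \<noteq> 0 \<Longrightarrow> Re (psi u) < 0"
proof -
  assume "u \<noteq> 0"
  obtain \<delta> r where d: "0 < \<delta>" "0 < r" "r < 2" "\<forall>u. Re (psi u) \<le> - \<delta> * min (u\<^sup>2) (\<bar>u\<bar> powr r)"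
    using Re_psi_decay by (elim exE conjE)
  have "0 < \<delta> * min (u\<^sup>2) (\<bar>u\<bar> powr r)" using d(1) \<open>u \<noteq> 0\<close> by simp
  with d(4)[rule_format, of u] show ?thesis by linarith
qed

lemma variance_pos: "variance > 0"
proof -
  have "Re (psi 1) < 0" by (rule Re_psi_neg) simp
  moreover have "cmod (psi 1) \<le> variance / 2" using psi_bound[of 1] by simp
  ultimately show ?thesis using abs_Re_le_cmod[of "psi 1"] by linarith
qed

lemma psi_scaling:
  "((\<lambda>t. of_real t * psi (u / sqrt t)) \<longlongrightarrow> of_real (- variance * u\<^sup>2 / 2)) at_top"
proof -
  have "((\<lambda>t. CLINT z|K. of_real t * levy_kernel (u / sqrt t) z)
      \<longlongrightarrow> (CLINT z|K. of_real (- u\<^sup>2 / 2))) at_top"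
  proof (rule integral_dominated_convergence_at_top[where w="\<lambda>_. u\<^sup>2 / 2"])
    have "cmod (of_real t * levy_kernel (u / sqrt t) z) \<le> u\<^sup>2 / 2" if "t > 0" for t z
      using levy_kernel_scaling_bound[OF that] .
    then show "\<forall>\<^sub>F t in at_top. AE z in K. cmod (of_real t * levy_kernel (u / sqrt t) z) \<le> u\<^sup>2 / 2"
      by (intro eventually_at_top_linorderI[of 1] AE_I2) simp_all
    show "AE z in K. ((\<lambda>t. of_real t * levy_kernel (u / sqrt t) z) \<longlongrightarrow> of_real (- u\<^sup>2 / 2)) at_top"
      using levy_kernel_scaling by (rule AE_I2)
    show "(\<lambda>z. of_real t * levy_kernel (u / sqrt t) z) \<in> borel_measurable K" for t
      by measurable
  qed simp_all
  moreover have "(\<lambda>t. CLINT z|K. of_real t * levy_kernel (u / sqrt t) z) = (\<lambda>t. of_real t * psi (u / sqrt t))"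
    by (simp add: psi_def)
  moreover have "(CLINT z|K. of_real (- u\<^sup>2 / 2)) = complex_of_real (- variance * u\<^sup>2 / 2)"
    by (simp add: variance_def scaleR_conv_of_real)
  ultimately show ?thesis by (simp only:)
qed

text \<open>
  This is what makes jump sizes visible: the left-hand side can be computed from the characteristic
  function, and the right-hand side is the Fourier transform of a finite measure equivalent to \<open>K\<close>.
\<close>

lemma psi_gaussian_average:
  "psi u - (CLINT v|gaussian. psi (u + v))
     = (CLINT z|K. iexp (u * z) * of_real (levy_weight z))"
proof -
  interpret pair_sigma_finite K gaussian by unfold_locales
  have I: "integrable (K \<Otimes>\<^sub>M gaussian) (\<lambda>(z, v). levy_kernel (u + v) z)"
  proof (rule Bochner_Integration.integrable_bound)
    have 1: "integrable gaussian (\<lambda>v. (u + v)\<^sup>2 / 2)"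
      using std_normal_moments by (simp add: power2_sum)
    show "integrable (K \<Otimes>\<^sub>M gaussian) (\<lambda>(z, v). (u + v)\<^sup>2 / 2)"
      by (rule Fubini_integrable) (use 1 in auto)
  next
    show "AE x in K \<Otimes>\<^sub>M gaussian. cmod (case x of (z, v) \<Rightarrow> levy_kernel (u + v) z)
        \<le> norm (case x of (z, v) \<Rightarrow> (u + v)\<^sup>2 / 2)"
      using levy_kernel_bound by (intro AE_I2) (auto split: prod.split)
  qed measurable
  have "(CLINT v|gaussian. psi (u + v))
      = (CLINT z|K. (CLINT v|gaussian. levy_kernel (u + v) z))"
    unfolding psi_def using Fubini_integral[OF I] by simp
  then have "psi u - (CLINT v|gaussian. psi (u + v))
      = (CLINT z|K. levy_kernel u z - (CLINT v|gaussian. levy_kernel (u + v) z))"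
    using integrable_fst'[OF I] integrable_levy_kernel by (simp add: psi_def)
  then show ?thesis by (simp only: levy_kernel_gaussian_average)
qed

end

section \<open>Absence of positive jumps\<close>

lemma norm_exp_minus_one_le:
  fixes w :: complex assumes "Re w \<le> 0" shows "cmod (exp w - 1) \<le> cmod w"
proof -
  have "cmod (exp w - exp 0) \<le> 1 * cmod (w - 0)"
  proof (rule field_differentiable_bound[where S="{z. Re z \<le> 0}" and f'=exp])
    show "convex {z. Re z \<le> 0}" by (rule convex_halfspace_Re_le)
    show "(exp has_field_derivative exp z) (at z within {z. Re z \<le> 0})" for z :: complex
      by (auto intro!: derivative_eq_intros)
  qed (use assms in \<open>auto simp: norm_exp_eq_Re\<close>)
  then show ?thesis by simp
qed

lemma tendsto_exp_root:
  fixes w :: complex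
  shows "(\<lambda>n. of_nat (Suc n) * (exp (w / of_nat (Suc n)) - 1)) \<longlonglongrightarrow> w"
proof (cases "w = 0")
  case False
  have "((\<lambda>h. (exp h - 1) / h) \<longlongrightarrow> 1) (at (0::complex))"
    using DERIV_exp[of "0::complex"] unfolding DERIV_def by simp
  moreover have "filterlim (\<lambda>n. w / of_nat (Suc n)) (at 0) sequentially"
  proof (intro filterlim_atI)
    show "(\<lambda>n. w / of_nat (Suc n)) \<longlonglongrightarrow> 0"
      using LIMSEQ_Suc[OF lim_const_over_n[of w]] by simp
    show "\<forall>\<^sub>F n in sequentially. w / of_nat (Suc n) \<noteq> 0" using False by (simp del: of_nat_Suc)
  qed
  ultimately have "(\<lambda>n. (exp (w / of_nat (Suc n)) - 1) / (w / of_nat (Suc n))) \<longlonglongrightarrow> 1"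
    by (rule filterlim_compose)
  from tendsto_mult_left[OF this, of w]
  have "(\<lambda>n. w * ((exp (w / of_nat (Suc n)) - 1) / (w / of_nat (Suc n)))) \<longlonglongrightarrow> w" by simp
  moreover have "w * ((exp (w / of_nat (Suc n)) - 1) / (w / of_nat (Suc n)))
      = of_nat (Suc n) * (exp (w / of_nat (Suc n)) - 1)" for n
    using False by (simp del: of_nat_Suc)
  ultimately show ?thesis by (simp only:)
qed simp

lemma (in real_distribution) char_gaussian_average:
  "(CLINT x|M. iexp (u * x) * of_real (1 - exp (- x\<^sup>2 / 2)))
     = char M u - (CLINT v|gaussian. char M (u + v))"
proof -
  interpret P: pair_sigma_finite M gaussian by unfold_locales
  interpret PP: pair_prob_space M gaussian by unfold_locales
  have I: "integrable (M \<Otimes>\<^sub>M gaussian) (\<lambda>(x, v). iexp ((u + v) * x))"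
    by (rule PP.P.integrable_const_bound[of _ 1]) (auto simp: split_beta)
  have i: "integrable M (\<lambda>x. iexp (u * x))" by (intro integrable_iexp) auto
  have j: "integrable M (\<lambda>x. iexp (u * x) * of_real (exp (- x\<^sup>2 / 2)))"
    by (rule integrable_const_bound[of _ 1]) (auto simp: norm_mult)
  have "(CLINT v|gaussian. char M (u + v))
      = (CLINT x|M. (CLINT v|gaussian. iexp ((u + v) * x)))"
    unfolding char_def using P.Fubini_integral[OF I] by simp
  also have "\<dots> = (CLINT x|M. iexp (u * x) * of_real (exp (- x\<^sup>2 / 2)))"
    by (simp only: std_normal_iexp_shift)
  finally have "char M u - (CLINT v|gaussian. char M (u + v))
      = (CLINT x|M. iexp (u * x) - iexp (u * x) * of_real (exp (- x\<^sup>2 / 2)))"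
    using i j by (simp add: char_def)
  then show ?thesis by (simp add: right_diff_distrib)
qed

context kolmogorov_measure
begin

lemma root_average_tendsto:
  "(\<lambda>n. of_nat (Suc n) * (exp (psi u / of_nat (Suc n))
        - (CLINT v|gaussian. exp (psi (u + v) / of_nat (Suc n)))))
     \<longlonglongrightarrow> (CLINT z|K. iexp (u * z) * of_real (levy_weight z))"
proof -
  define F where "F n u = of_nat (Suc n) * (exp (psi u / of_nat (Suc n)) - 1)" for n u
  have [measurable]: "F n \<in> borel_measurable borel" for n unfolding F_def by measurable
  have lim: "(\<lambda>n. F n u) \<longlonglongrightarrow> psi u" for u unfolding F_def by (rule tendsto_exp_root)
  have bound: "cmod (F n u) \<le> variance * u\<^sup>2 / 2" for n u
  proof -
    have "Re (psi u / of_nat (Suc n)) \<le> 0"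
      using Re_psi_nonpos[of u] by (metis Re_divide_of_nat divide_nonpos_nonneg of_nat_0_le_iff)
    then have "cmod (exp (psi u / of_nat (Suc n)) - 1) \<le> cmod (psi u / of_nat (Suc n))"
      by (rule norm_exp_minus_one_le)
    then have "cmod (F n u) \<le> of_nat (Suc n) * cmod (psi u / of_nat (Suc n))"
      unfolding F_def norm_mult norm_of_nat by (intro mult_left_mono) auto
    also have "\<dots> = cmod (psi u)" by (simp add: norm_divide del: of_nat_Suc)
    finally show ?thesis using psi_bound[of u] by simp
  qed
  have iw: "integrable gaussian (\<lambda>v. variance * (u + v)\<^sup>2 / 2)"
    using std_normal_moments by (simp add: power2_sum)
  have iF: "integrable gaussian (\<lambda>v. F n (u + v))" for n
  proof (rule Bochner_Integration.integrable_bound[OF iw])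
    show "AE v in gaussian. cmod (F n (u + v)) \<le> norm (variance * (u + v)\<^sup>2 / 2)"
      using bound by (intro AE_I2) (metis abs_ge_self order_trans real_norm_def)
  qed measurable
  have av: "(\<lambda>n. CLINT v|gaussian. F n (u + v)) \<longlonglongrightarrow> (CLINT v|gaussian. psi (u + v))"
    by (rule integral_dominated_convergence[OF _ _ iw]) (use lim bound in auto)
  from tendsto_diff[OF lim[of u] av]
  have "(\<lambda>n. F n u - (CLINT v|gaussian. F n (u + v)))
     \<longlonglongrightarrow> (CLINT z|K. iexp (u * z) * of_real (levy_weight z))"
    unfolding psi_gaussian_average .
  moreover have "F n u - (CLINT v|gaussian. F n (u + v))
     = of_nat (Suc n) * (exp (psi u / of_nat (Suc n))
        - (CLINT v|gaussian. exp (psi (u + v) / of_nat (Suc n))))" for n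
  proof -
    have e: "exp (psi (u + v) / of_nat (Suc n)) = F n (u + v) / of_nat (Suc n) + 1" for v
      unfolding F_def by (simp del: of_nat_Suc)
    have "(CLINT v|gaussian. exp (psi (u + v) / of_nat (Suc n)))
        = (CLINT v|gaussian. F n (u + v)) / of_nat (Suc n) + 1"
      unfolding e using iF[of n] std_normal.prob_space by (simp del: of_nat_Suc)
    then show ?thesis by (simp add: F_def field_simps del: of_nat_Suc)
  qed
  ultimately show ?thesis by (simp del: of_nat_Suc)
qed

text \<open>
  Weighting the law of \<open>X\<^bsub>1/n\<^esub>\<close> by \<open>n (1 - exp (-x\<^sup>2/2))\<close> keeps its total mass bounded. By
  \<open>root_average_tendsto\<close> and Levy's continuity theorem the normalised measures converge weakly to
  the normalisation of \<open>levy_weight\<close> times \<open>K\<close>, which does not charge \<open>(0, \<infinity>)\<close>; on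
  \<open>(\<eta>, \<infinity>)\<close> the weight is bounded below.
\<close>

lemma positive_tail_tendsto_0:
  fixes mu :: "nat \<Rightarrow> real measure"
  assumes rd: "\<And>n. real_distribution (mu n)"
    and char: "\<And>n u. char (mu n) u = exp (psi u / of_nat (Suc n))"
    and e: "0 < \<eta>"
  shows "(\<lambda>n. real (Suc n) * measure (mu n) {\<eta><..}) \<longlonglongrightarrow> 0"
proof -
  interpret mu: real_distribution "mu n" for n by (rule rd)
  define g :: "real \<Rightarrow> real" where "g x = 1 - exp (- x\<^sup>2 / 2)" for x
  have g: "0 \<le> g x" "g x \<le> 1" for x by (auto simp: g_def)
  have [measurable]: "g \<in> borel_measurable borel" unfolding g_def by measurable
  define m where "m n = (LINT x|mu n. g x)" for n
  define m' where "m' = (LINT z|K. levy_weight z)"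
  have ig: "integrable (mu n) g" for n
    by (rule mu.integrable_const_bound[of _ 1]) (use g in auto)
  have iw: "integrable K levy_weight"
    by (rule integrable_const_bound[of _ "1/2"]) (use levy_weight_le levy_weight_pos in \<open>auto simp: abs_of_pos\<close>)
  have lim: "(\<lambda>n. of_nat (Suc n) * (CLINT x|mu n. iexp (u * x) * of_real (g x)))
      \<longlonglongrightarrow> (CLINT z|K. iexp (u * z) * of_real (levy_weight z))" for u
    using root_average_tendsto[of u] unfolding g_def mu.char_gaussian_average char .
  \<comment> \<open>The limit measure is not zero, so that it can be normalised.\<close>
  have m'pos: "m' > 0"
  proof -
    have "m' \<noteq> 0"
    proof
      assume "m' = 0"
      then have "AE z in K. levy_weight z = 0"
        unfolding m'_def using iw levy_weight_pos by (subst (asm) integral_nonneg_eq_0_iff_AE) (auto intro: less_imp_le)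
      then have "AE z in K. False" by eventually_elim (metis levy_weight_pos less_irrefl)
      then have "variance = 0" unfolding variance_def
        by (simp add: AE_iff_null null_sets_def measure_def)
      with variance_pos show False by simp
    qed
    moreover have "m' \<ge> 0" unfolding m'_def by (intro integral_nonneg_AE AE_I2) (auto intro: less_imp_le levy_weight_pos)
    ultimately show ?thesis by simp
  qed
  have limm: "(\<lambda>n. real (Suc n) * m n) \<longlonglongrightarrow> m'"
  proof -
    have "(\<lambda>n. complex_of_real (real (Suc n) * m n)) \<longlonglongrightarrow> of_real m'"
      using lim[of 0] by (simp add: m_def m'_def del: of_nat_Suc)
    then show ?thesis by (simp only: tendsto_of_real_iff)
  qed
  have mpos: "m n > 0" for n
  proof -
    have "m n \<noteq> 0"
    proof
      assume "m n = 0"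
      then have "AE x in mu n. g x = 0"
        unfolding m_def using ig g by (subst (asm) integral_nonneg_eq_0_iff_AE) auto
      then have "AE x in mu n. x = 0" by eventually_elim (auto simp: g_def)
      then have "char (mu n) 1 = (CLINT x|mu n. 1)"
        unfolding char_def by (intro integral_cong_AE) auto
      then have "cmod (char (mu n) 1) = 1" using mu.prob_space[of n] by simp
      moreover have "cmod (char (mu n) 1) < 1"
        unfolding char using Re_psi_neg[of 1] by (simp add: Re_divide_of_nat divide_neg_pos del: of_nat_Suc)
      ultimately show False by simp
    qed
    moreover have "m n \<ge> 0" unfolding m_def using g by (intro integral_nonneg_AE) auto
    ultimately show ?thesis by simp
  qed
  define Q where "Q n = density (mu n) (\<lambda>x. ennreal (g x / m n))" for n
  define Q' where "Q' = density K (\<lambda>z. ennreal (levy_weight z / m'))"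
  have gm: "0 \<le> g x / m n" for x n using g mpos[of n] by simp
  have wm: "0 \<le> levy_weight z / m'" for z using levy_weight_pos[of z] m'pos by simp
  have Q: "real_distribution (Q n)" for n
  proof -
    have "emeasure (Q n) UNIV = (\<integral>\<^sup>+ x. ennreal (g x / m n) \<partial>mu n)"
      unfolding Q_def by (subst emeasure_density) (auto simp: mu.sets_M)
    also have "\<dots> = ennreal (LINT x|mu n. g x / m n)"
      using ig gm by (intro nn_integral_eq_integral) auto
    also have "(LINT x|mu n. g x / m n) = 1" using mpos[of n] by (simp add: m_def)
    finally have "prob_space (Q n)" by (intro prob_spaceI) (simp add: Q_def)
    then show ?thesis by (auto simp: real_distribution_def real_distribution_axioms_def Q_def)
  qed
  have Q': "real_distribution Q'"
  proof -
    have "emeasure Q' UNIV = (\<integral>\<^sup>+ x. ennreal (levy_weight x / m') \<partial>K)"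
      unfolding Q'_def by (subst emeasure_density) (auto simp: sets_K)
    also have "\<dots> = ennreal (LINT x|K. levy_weight x / m')"
      using iw wm by (intro nn_integral_eq_integral) auto
    also have "(LINT x|K. levy_weight x / m') = 1" using m'pos by (simp add: m'_def)
    finally have "prob_space Q'" by (intro prob_spaceI) (simp add: Q'_def space_K)
    then show ?thesis by (auto simp: real_distribution_def real_distribution_axioms_def Q'_def sets_K)
  qed
  interpret Q: real_distribution "Q n" for n by (rule Q)
  interpret Q': real_distribution Q' by (rule Q')
  have charQ: "char (Q n) u = (of_nat (Suc n) * (CLINT x|mu n. iexp (u * x) * of_real (g x))) / of_real (real (Suc n) * m n)" for n u
  proof -
    have "char (Q n) u = (CLINT x|mu n. (g x / m n) *\<^sub>R iexp (u * x))"
      unfolding char_def Q_def using gm by (intro integral_density) auto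
    also have "\<dots> = (CLINT x|mu n. iexp (u * x) * of_real (g x) / of_real (m n))"
      by (simp add: scaleR_conv_of_real mult.commute)
    finally show ?thesis by (simp del: of_nat_Suc)
  qed
  have charQ': "char Q' u = (CLINT x|K. iexp (u * x) * of_real (levy_weight x)) / of_real m'" for u
  proof -
    have "char Q' u = (CLINT x|K. (levy_weight x / m') *\<^sub>R iexp (u * x))"
      unfolding char_def Q'_def using wm by (intro integral_density) auto
    also have "\<dots> = (CLINT x|K. iexp (u * x) * of_real (levy_weight x) / of_real m')"
      by (simp add: scaleR_conv_of_real mult.commute)
    finally show ?thesis by simp
  qed
  have "weak_conv_m Q Q'"
  proof (rule levy_continuity[OF Q Q'])
    show "(\<lambda>n. char (Q n) t) \<longlonglongrightarrow> char Q' t" for t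
      unfolding charQ charQ' using m'pos by (intro tendsto_divide lim tendsto_of_real limm) auto
  qed
  have null: "emeasure Q' {0<..} = 0"
  proof -
    have "AE z in K. z \<notin> {0<..}"
      by (rule AE_not_in) (simp add: null_sets_def no_positive sets_K)
    then have "AE z in Q'. z \<notin> {0<..}"
      unfolding Q'_def by (subst AE_density) auto
    then show ?thesis by (subst (asm) AE_iff_null) (auto simp: null_sets_def greaterThan_def)
  qed
  have "measure Q' {\<eta>} = 0"
    using emeasure_mono[of "{\<eta>}" "{0<..}" Q'] null e by (simp add: measure_def)
  then have "isCont (cdf Q') \<eta>" by (simp add: Q'.isCont_cdf)
  with \<open>weak_conv_m Q Q'\<close> have "(\<lambda>n. cdf (Q n) \<eta>) \<longlonglongrightarrow> cdf Q' \<eta>"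
    by (simp add: weak_conv_m_def weak_conv_def)
  moreover have compl: "measure R {\<eta><..} = 1 - cdf R \<eta>" if "real_distribution R" for R
  proof -
    interpret R: real_distribution R by fact
    have "{\<eta><..} = space R - {..\<eta>}" by auto
    then show ?thesis using R.prob_compl[of "{..\<eta>}"] by (simp add: cdf_def)
  qed
  moreover have "measure Q' {\<eta><..} = 0"
    using emeasure_mono[of "{\<eta><..}" "{0<..}" Q'] null e by (simp add: measure_def)
  ultimately have tail: "(\<lambda>n. measure (Q n) {\<eta><..}) \<longlonglongrightarrow> 0"
    using compl[OF Q'] unfolding compl[OF Q] by (auto intro!: tendsto_eq_intros)
  have ge: "g \<eta> > 0" using e by (simp add: g_def)
  have le: "real (Suc n) * measure (mu n) {\<eta><..} \<le> (real (Suc n) * m n / g \<eta>) * measure (Q n) {\<eta><..}" for n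
  proof -
    have "measure (Q n) {\<eta><..} = (LINT x|Q n. indicator {\<eta><..} x)" by simp
    also have "\<dots> = (LINT x|mu n. (g x / m n) *\<^sub>R indicator {\<eta><..} x)"
      unfolding Q_def using gm by (intro integral_density) auto
    also have "\<dots> \<ge> (LINT x|mu n. (g \<eta> / m n) * indicator {\<eta><..} x)"
    proof (rule integral_mono)
      show "integrable (mu n) (\<lambda>x. (g x / m n) *\<^sub>R (indicator {\<eta><..} x :: real))"
      proof (rule Bochner_Integration.integrable_bound)
        show "integrable (mu n) (\<lambda>x. g x / m n)" using ig by simp
      qed (auto split: split_indicator)
      show "(g \<eta> / m n) * indicator {\<eta><..} x \<le> (g x / m n) *\<^sub>R (indicator {\<eta><..} x :: real)" for x
        using e mpos[of n] by (auto split: split_indicator simp: g_def intro!: divide_right_mono power_mono)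
    qed (auto intro!: integrable_real_indicator simp: mu.emeasure_eq_measure)
    also have "(LINT x|mu n. (g \<eta> / m n) * indicator {\<eta><..} x) = (g \<eta> / m n) * measure (mu n) {\<eta><..}"
      by simp
    finally have "measure (mu n) {\<eta><..} \<le> (m n / g \<eta>) * measure (Q n) {\<eta><..}"
      using ge mpos[of n] by (simp add: field_simps)
    then have "real (Suc n) * measure (mu n) {\<eta><..} \<le> real (Suc n) * ((m n / g \<eta>) * measure (Q n) {\<eta><..})"
      by (intro mult_left_mono) auto
    then show ?thesis by (simp add: mult_ac)
  qed
  have "(\<lambda>n. (real (Suc n) * m n / g \<eta>) * measure (Q n) {\<eta><..}) \<longlonglongrightarrow> (m' / g \<eta>) * 0"
    using ge by (intro tendsto_mult tendsto_divide limm tendsto_const tail) auto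
  then have up: "(\<lambda>n. (real (Suc n) * m n / g \<eta>) * measure (Q n) {\<eta><..}) \<longlonglongrightarrow> 0" by simp
  show ?thesis
    by (rule tendsto_sandwich[OF _ _ tendsto_const up]; rule always_eventually, rule allI, (rule le)?)
       (rule mult_nonneg_nonneg[OF of_nat_0_le_iff measure_nonneg])
qed

end

section \<open>Fourier inversion and the local limit theorem\<close>

definition inverse_char :: "(real \<Rightarrow> complex) \<Rightarrow> real \<Rightarrow> real" where
  "inverse_char \<phi> x = Re (CLBINT u. iexp (- (u * x)) * \<phi> u) / (2 * pi)"

lemma norm_iexp_minus_one_le: "cmod (iexp x - 1) \<le> \<bar>x\<bar>"
  using iexp_approx1[of x 0] by simp

text \<open>
  The kernel of the Levy inversion formula for \<open>(p, q]\<close>. It equals \<open>(q - p) exp (- \<i> u p)\<close> up to an error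
  of second order in \<open>q - p\<close>, which gives the local expansion \<open>measure_Ioc_approx\<close> without
  identifying the law with its density.
\<close>

definition increment_kernel :: "real \<Rightarrow> real \<Rightarrow> real \<Rightarrow> complex" where
  "increment_kernel p q u = (iexp (- (u * p)) - iexp (- (u * q))) / (\<i> * u)"

lemma increment_kernel_measurable [measurable]: "increment_kernel p q \<in> borel_measurable borel"
  unfolding increment_kernel_def by measurable

lemma increment_kernel_bound:
  assumes "p \<le> q" shows "cmod (increment_kernel p q u) \<le> q - p"
proof (cases "u = 0")
  case False
  have "iexp (- (u * q)) = iexp (- (u * p)) * iexp (- (u * (q - p)))"
    by (simp add: exp_add[symmetric] algebra_simps)
  then have "iexp (- (u * p)) - iexp (- (u * q)) = - iexp (- (u * p)) * (iexp (- (u * (q - p))) - 1)"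
    by (simp add: algebra_simps)
  then have "cmod (iexp (- (u * p)) - iexp (- (u * q))) = cmod (iexp (- (u * (q - p))) - 1)"
    by (simp add: norm_mult del: of_real_minus of_real_mult)
  also have "\<dots> \<le> \<bar>- (u * (q - p))\<bar>" by (rule norm_iexp_minus_one_le)
  also have "\<dots> = (q - p) * \<bar>u\<bar>" using assms by (simp add: abs_mult)
  finally show ?thesis using False
    by (simp add: increment_kernel_def norm_divide norm_mult divide_le_eq)
qed (use assms in \<open>simp add: increment_kernel_def\<close>)

lemma increment_kernel_approx:
  assumes "p \<le> q" "u \<noteq> 0"
  shows "cmod (increment_kernel p q u - of_real (q - p) * iexp (- (u * p))) \<le> (q - p)\<^sup>2 / 2 * \<bar>u\<bar>"
proof -
  define x where "x = - (u * (q - p))"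
  define E where "E = iexp (- (u * p))"
  have e: "iexp (- (u * q)) = E * iexp x"
    by (simp add: x_def E_def exp_add[symmetric] algebra_simps)
  have "\<i> * u * (of_real (q - p) * E) = - (\<i> * of_real x) * E" by (simp add: x_def)
  then have "E - iexp (- (u * q)) - \<i> * u * (of_real (q - p) * E) = - E * (iexp x - 1 - \<i> * of_real x)"
    unfolding e by (simp add: algebra_simps)
  then have "iexp (- (u * p)) - iexp (- (u * q)) - \<i> * u * (of_real (q - p) * iexp (- (u * p)))
       = - iexp (- (u * p)) * (iexp x - 1 - \<i> * of_real x)"
    unfolding E_def .
  moreover have "increment_kernel p q u - of_real (q - p) * iexp (- (u * p))
      = (iexp (- (u * p)) - iexp (- (u * q)) - \<i> * u * (of_real (q - p) * iexp (- (u * p)))) / (\<i> * u)"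
    using assms by (simp add: increment_kernel_def diff_divide_distrib)
  ultimately have "cmod (increment_kernel p q u - of_real (q - p) * iexp (- (u * p)))
      = cmod (iexp x - 1 - \<i> * of_real x) / \<bar>u\<bar>"
    by (simp add: norm_divide norm_mult del: of_real_minus of_real_mult)
  moreover have "cmod (iexp x - 1 - \<i> * of_real x) \<le> \<bar>x\<bar>^2 / 2"
    using iexp_approx1[of x 1] by (simp add: numeral_2_eq_2 diff_diff_add)
  moreover have "\<bar>x\<bar>^2 / 2 = ((q - p)\<^sup>2 / 2 * \<bar>u\<bar>) * \<bar>u\<bar>"
    by (simp add: x_def power_mult_distrib power2_eq_square)
  ultimately show ?thesis using assms by (simp add: divide_le_eq)
qed

context real_distribution
begin

lemma measure_Ioc_inversion:
  assumes int: "integrable lborel (char M)" and pq: "p \<le> q" and "measure M {p} = 0" "measure M {q} = 0"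
  shows "of_real (measure M {p<..q}) = (CLBINT u. increment_kernel p q u * char M u) / (2 * pi)"
    and "integrable lborel (\<lambda>u. increment_kernel p q u * char M u)"
proof -
  let ?G = "\<lambda>u. increment_kernel p q u * char M u"
  show I: "integrable lborel ?G"
  proof (rule Bochner_Integration.integrable_bound)
    show "integrable lborel (\<lambda>u. (q - p) * cmod (char M u))" using int by simp
    show "AE u in lborel. cmod (?G u) \<le> norm ((q - p) * cmod (char M u))"
      using pq increment_kernel_bound[OF pq] by (auto simp: norm_mult intro!: mult_right_mono AE_I2)
  qed measurable
  have "(\<lambda>T. CLBINT u. indicator {- real T<..<real T} u *\<^sub>R ?G u) \<longlonglongrightarrow> (CLBINT u. ?G u)"
  proof (rule integral_dominated_convergence[where w="\<lambda>u. cmod (?G u)"])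
    show "AE u in lborel. (\<lambda>T. indicator {- real T<..<real T} u *\<^sub>R ?G u) \<longlonglongrightarrow> ?G u"
    proof (rule AE_I2, rule tendsto_eventually)
      fix u :: real
      obtain N :: nat where "\<bar>u\<bar> < real N" using reals_Archimedean2 by blast
      then show "\<forall>\<^sub>F T in sequentially. indicator {- real T<..<real T} u *\<^sub>R ?G u = ?G u"
        by (intro eventually_sequentiallyI[of N]) (auto split: split_indicator)
    qed
  qed (use I in \<open>auto split: split_indicator\<close>)
  moreover have "(CLBINT t=- real T..real T. ?G t) = (CLBINT u. indicator {- real T<..<real T} u *\<^sub>R ?G u)" for T :: nat
    by (simp add: interval_lebesgue_integral_def set_lebesgue_integral_def)
  ultimately have "(\<lambda>T::nat. 1 / (2 * pi) * (CLBINT t=- real T..real T. ?G t)) \<longlonglongrightarrow> of_real (1 / (2 * pi)) * (CLBINT u. ?G u)"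
    by (intro tendsto_intros) simp_all
  moreover have "(\<lambda>T::nat. 1 / (2 * pi) * (CLBINT t=- real T..real T. ?G t)) \<longlonglongrightarrow> of_real (measure M {p<..q})"
    using Levy_Inversion[OF pq assms(3,4)] unfolding increment_kernel_def by simp
  ultimately show "of_real (measure M {p<..q}) = (CLBINT u. ?G u) / (2 * pi)"
    using LIMSEQ_unique by fastforce
qed

text \<open>
  The inversion formula requires endpoints that are not atoms. Such endpoints exist arbitrarily
  close to any point, and between them the mass is at most a constant times their distance.
\<close>

lemma measure_singleton_eq_0:
  assumes int: "integrable lborel (char M)"
  shows "measure M {a} = 0"
proof (rule ccontr)
  define C where "C = (LBINT u. cmod (char M u)) / (2 * pi)"
  have C: "C \<ge> 0" by (simp add: C_def)
  assume "measure M {a} \<noteq> 0"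
  then have pos: "measure M {a} > 0" by (simp add: less_le)
  define \<eta> where "\<eta> = measure M {a} / (4 * (C + 1))"
  have \<eta>: "\<eta> > 0" using pos C by (simp add: \<eta>_def)
  have ex: "\<exists>x\<in>{l<..<r}. measure M {x} = 0" if "l < r" for l r
  proof (rule ccontr)
    assume "\<not> ?thesis"
    then have "{l<..<r} \<subseteq> {x. measure M {x} > 0}" by (auto simp: less_le)
    then have "countable {l<..<r}" using countable_atoms countable_subset by blast
    with that show False using uncountable_open_interval by blast
  qed
  obtain p where p: "p \<in> {a - \<eta><..<a}" "measure M {p} = 0" using ex[of "a - \<eta>" a] \<eta> by auto
  obtain q where q: "q \<in> {a<..<a + \<eta>}" "measure M {q} = 0" using ex[of a "a + \<eta>"] \<eta> by auto
  have pq: "p \<le> q" using p q by auto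
  have "measure M {a} \<le> measure M {p<..q}"
    using p q by (intro finite_measure_mono) auto
  also have "\<dots> = cmod (of_real (measure M {p<..q}))" by simp
  also have "\<dots> = cmod (CLBINT u. increment_kernel p q u * char M u) / (2 * pi)"
    unfolding measure_Ioc_inversion(1)[OF int pq p(2) q(2)] by (simp add: norm_divide norm_mult)
  also have "cmod (CLBINT u. increment_kernel p q u * char M u) \<le> (LBINT u. cmod (increment_kernel p q u * char M u))"
    by (rule integral_norm_bound)
  also have "\<dots> \<le> (LBINT u. (q - p) * cmod (char M u))"
  proof (rule integral_mono)
    show "integrable lborel (\<lambda>u. cmod (increment_kernel p q u * char M u))"
      using measure_Ioc_inversion(2)[OF int pq p(2) q(2)] by simp
    show "cmod (increment_kernel p q u * char M u) \<le> (q - p) * cmod (char M u)" for u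
      using increment_kernel_bound[OF pq] by (auto simp: norm_mult intro!: mult_right_mono)
  qed (use int in simp)
  also have "(LBINT u. (q - p) * cmod (char M u)) / (2 * pi) = (q - p) * C" by (simp add: C_def)
  also have "(q - p) * C \<le> (2 * \<eta>) * (C + 1)" using p q C by (intro mult_mono) auto
  also have "\<dots> = measure M {a} / 2" using C by (simp add: \<eta>_def field_simps)
  finally show False using pos by (simp add: divide_right_mono)
qed

lemma measure_Ioc_approx:
  assumes int: "integrable lborel (char M)" and int1: "integrable lborel (\<lambda>u. \<bar>u\<bar> * cmod (char M u))" and pq: "p \<le> q"
  shows "\<bar>measure M {p<..q} - (q - p) * inverse_char (char M) p\<bar>
     \<le> (q - p)\<^sup>2 / (4 * pi) * (LBINT u. \<bar>u\<bar> * cmod (char M u))"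
proof -
  note 1 = measure_Ioc_inversion[OF int pq measure_singleton_eq_0[OF int] measure_singleton_eq_0[OF int]]
  let ?D = "\<lambda>u. (increment_kernel p q u - of_real (q - p) * iexp (- (u * p))) * char M u"
  have 2: "integrable lborel (\<lambda>u. iexp (- (u * p)) * char M u)"
    by (rule Bochner_Integration.integrable_bound[OF int]) (auto simp: norm_mult)
  have 3: "(CLBINT u. ?D u) = (CLBINT u. increment_kernel p q u * char M u)
       - of_real (q - p) * (CLBINT u. iexp (- (u * p)) * char M u)"
    using 1(2) 2 by (simp add: left_diff_distrib mult.assoc del: of_real_diff of_real_minus of_real_mult)
  have "measure M {p<..q} - (q - p) * inverse_char (char M) p = Re ((CLBINT u. ?D u) / (2 * pi))"
  proof -
    have "measure M {p<..q} = Re ((CLBINT u. increment_kernel p q u * char M u) / (2 * pi))"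
      using arg_cong[OF 1(1), of Re] by simp
    then show ?thesis unfolding 3 inverse_char_def by (simp add: diff_divide_distrib)
  qed
  also have "\<bar>\<dots>\<bar> \<le> cmod ((CLBINT u. ?D u) / (2 * pi))" by (rule abs_Re_le_cmod)
  also have "\<dots> = cmod (CLBINT u. ?D u) / (2 * pi)" by (simp add: norm_divide norm_mult)
  also have "cmod (CLBINT u. ?D u) \<le> (LBINT u. cmod (?D u))" by (rule integral_norm_bound)
  also have "\<dots> \<le> (LBINT u. (q - p)\<^sup>2 / 2 * (\<bar>u\<bar> * cmod (char M u)))"
  proof (rule integral_mono_AE)
    show "integrable lborel (\<lambda>u. cmod (?D u))"
      using 1(2) 2 by (intro integrable_norm)
        (simp add: left_diff_distrib mult.assoc del: of_real_diff of_real_minus of_real_mult)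
    have "AE u in lborel. u \<noteq> (0::real)" by (rule AE_lborel_singleton)
    then show "AE u in lborel. cmod (?D u) \<le> (q - p)\<^sup>2 / 2 * (\<bar>u\<bar> * cmod (char M u))"
    proof eventually_elim
      case (elim u)
      show ?case
        using mult_right_mono[OF increment_kernel_approx[OF pq elim], of "cmod (char M u)"]
        unfolding norm_mult by (simp add: mult.assoc)
    qed
  qed (use int1 in simp)
  also have "(LBINT u. (q - p)\<^sup>2 / 2 * (\<bar>u\<bar> * cmod (char M u))) / (2 * pi)
     = (q - p)\<^sup>2 / (4 * pi) * (LBINT u. \<bar>u\<bar> * cmod (char M u))" by simp
  finally show ?thesis by (simp add: divide_right_mono)
qed

end

lemma power_le_exp:
  fixes y :: real assumes "0 \<le> y" "0 < m" shows "(y / real m) ^ m \<le> exp y"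
proof -
  have "(y / real m) ^ m \<le> exp (y / real m) ^ m"
  proof (rule power_mono)
    show "y / real m \<le> exp (y / real m)" using exp_ge_add_one_self[of "y / real m"] by linarith
  qed (use assms in simp)
  also have "\<dots> = exp y" using assms by (simp flip: exp_of_nat_mult)
  finally show ?thesis .
qed

lemma integrable_inverse_one_plus_square: "integrable lborel (\<lambda>u::real. 1 / (1 + u\<^sup>2))"
  using integrable_inverse_1_plus_square
  by (simp add: set_integrable_def inverse_eq_divide einterval_def)

text \<open>
  The factor \<open>1 + |u|\<close> serves both the Fourier integrals and their derivatives in space.
\<close>

lemma integrable_stretched_exponential:
  fixes a r :: real assumes "0 < a" "0 < r" "r < 2"
  shows "integrable lborel (\<lambda>u::real. (1 + \<bar>u\<bar>) * exp (- a * min (u\<^sup>2) (\<bar>u\<bar> powr r)))"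
proof -
  \<comment> \<open>With this \<open>m\<close>, the bound \<open>exp y \<ge> (y / m) ^ m\<close> at \<open>y = a |u| powr r\<close> beats \<open>|u| ^ 3\<close>.\<close>
  obtain m :: nat where m: "real m > 3 / r" using reals_Archimedean2 by blast
  have m0: "m > 0" using m assms by (cases m) (auto simp: field_simps)
  define C where "C = 4 + 4 * (real m / a) ^ m"
  have C: "C \<ge> 4" using assms by (simp add: C_def)
  have main: "(1 + \<bar>u\<bar>) * exp (- a * min (u\<^sup>2) (\<bar>u\<bar> powr r)) \<le> C * (1 / (1 + u\<^sup>2))" for u :: real
  proof (cases "\<bar>u\<bar> \<le> 1")
    case True
    then have "u\<^sup>2 \<le> 1" by (simp add: abs_square_le_1)
    have "(1 + \<bar>u\<bar>) * exp (- a * min (u\<^sup>2) (\<bar>u\<bar> powr r)) \<le> 2 * 1"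
      using True assms by (intro mult_mono) auto
    also have "\<dots> \<le> 4 / (1 + u\<^sup>2)" using \<open>u\<^sup>2 \<le> 1\<close> by (simp add: field_simps add_pos_nonneg)
    also have "\<dots> \<le> C * (1 / (1 + u\<^sup>2))" using C by (simp add: divide_right_mono)
    finally show ?thesis .
  next
    case False
    define x where "x = \<bar>u\<bar>"
    have x: "x > 1" "u\<^sup>2 = x\<^sup>2" using False by (auto simp: x_def)
    have "x powr r \<le> x powr 2" using x(1) assms by (intro powr_mono) auto
    then have mn: "min (u\<^sup>2) (\<bar>u\<bar> powr r) = x powr r"
      using x(1) unfolding x(2) x_def[symmetric] by (simp add: min_absorb2)
    have "x ^ 3 = x powr 3" using x(1) by simp
    also have "\<dots> \<le> x powr (r * real m)" using x(1) m assms by (intro powr_mono) (auto simp: field_simps)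
    also have "\<dots> = (x powr r) ^ m" using x(1) by (simp add: powr_powr[symmetric] powr_realpow)
    also have "\<dots> = (real m / a) ^ m * (a * x powr r / real m) ^ m"
      using assms m0 by (simp flip: power_mult_distrib)
    also have "\<dots> \<le> (real m / a) ^ m * exp (a * x powr r)"
      using assms m0 by (intro mult_left_mono power_le_exp) auto
    finally have e: "x ^ 3 * exp (- (a * x powr r)) \<le> (real m / a) ^ m"
      by (simp add: exp_minus field_simps)
    have "1 * 1 \<le> x * x" using x(1) by (intro mult_mono) auto
    then have "(1 + x) * (1 + x\<^sup>2) \<le> (2 * x) * (2 * x\<^sup>2)"
      using x(1) by (intro mult_mono) (auto simp: power2_eq_square)
    also have "\<dots> = 4 * x ^ 3" by (simp add: power2_eq_square power3_eq_cube)
    finally have "(1 + x) * (1 + x\<^sup>2) * exp (- (a * x powr r)) \<le> 4 * x ^ 3 * exp (- (a * x powr r))"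
      by (rule mult_right_mono) simp
    also have "\<dots> \<le> C" using e by (simp add: C_def)
    finally have "(1 + x) * exp (- (a * x powr r)) * (1 + x\<^sup>2) \<le> C" by (simp add: mult_ac)
    then have "(1 + x) * exp (- (a * x powr r)) \<le> C / (1 + x\<^sup>2)"
      by (subst pos_le_divide_eq) (auto simp: add_pos_nonneg)
    then show ?thesis unfolding mn unfolding x(2) x_def[symmetric] by simp
  qed
  show ?thesis
  proof (rule Bochner_Integration.integrable_bound)
    show "integrable lborel (\<lambda>u::real. C * (1 / (1 + u\<^sup>2)))"
      using integrable_inverse_one_plus_square by (intro integrable_mult_right)
    show "AE u in lborel. norm ((1 + \<bar>u\<bar>) * exp (- a * min (u\<^sup>2) (\<bar>u\<bar> powr r))) \<le> norm (C * (1 / (1 + u\<^sup>2)))"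
    proof (rule AE_I2)
      fix u :: real
      have "norm ((1 + \<bar>u\<bar>) * exp (- a * min (u\<^sup>2) (\<bar>u\<bar> powr r))) = (1 + \<bar>u\<bar>) * exp (- a * min (u\<^sup>2) (\<bar>u\<bar> powr r))"
        by (subst real_norm_def, rule abs_of_nonneg) (intro mult_nonneg_nonneg exp_ge_zero, simp)
      also have "\<dots> \<le> C * (1 / (1 + u\<^sup>2))" by (rule main)
      also have "\<dots> \<le> norm (C * (1 / (1 + u\<^sup>2)))" unfolding real_norm_def by (rule abs_ge_self)
      finally show "norm ((1 + \<bar>u\<bar>) * exp (- a * min (u\<^sup>2) (\<bar>u\<bar> powr r))) \<le> norm (C * (1 / (1 + u\<^sup>2)))" .
    qed
  qed measurable
qed

lemma gaussian_integral:
  fixes v :: real assumes "v > 0"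
  shows "(LBINT u. exp (- v * u\<^sup>2 / 2)) = sqrt (2 * pi / v)"
proof -
  have one: "(LBINT u. normal_density 0 (1 / sqrt v) u) = 1"
    by (rule integral_normal_density) (use assms in simp)
  have "normal_density 0 (1 / sqrt v) u = (1 / sqrt (2 * pi / v)) * exp (- v * u\<^sup>2 / 2)" for u
    using assms by (simp add: normal_density_def power_divide)
  then have "(1 / sqrt (2 * pi / v)) * (LBINT u. exp (- v * u\<^sup>2 / 2)) = 1"
    using one by (simp only: integral_mult_right_zero)
  moreover have "sqrt (2 * pi / v) \<noteq> 0" using assms by simp
  moreover have "I = c" if "(1 / c) * I = 1" "c \<noteq> 0" for c I :: real
    using that by simp
  ultimately show ?thesis by blast
qed

context kolmogorov_measure
begin

text \<open>
  The Fourier inversion formula for the density at time \<open>t\<close>, defined for every real \<open>t\<close>; it is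
  compared with the process only at rational times, where the characteristic function is known.
\<close>

definition time_density :: "real \<Rightarrow> real \<Rightarrow> real" where
  "time_density t x = inverse_char (\<lambda>u. exp (of_real t * psi u)) x"

lemma norm_exp_psi: "cmod (exp (of_real t * psi u)) = exp (t * Re (psi u))"
  by (simp add: norm_exp_eq_Re)

lemma norm_exp_psi_antimono: "s \<le> t \<Longrightarrow> cmod (exp (of_real t * psi u)) \<le> exp (s * Re (psi u))"
  unfolding norm_exp_psi using Re_psi_nonpos[of u] by (simp add: mult_right_mono_neg)

lemma integrable_envelope:
  assumes "0 < s"
  shows "integrable lborel (\<lambda>u. (1 + \<bar>u\<bar>) * exp (s * Re (psi u)))"
proof -
  obtain \<delta> r where d: "0 < \<delta>" "0 < r" "r < 2" and D: "\<forall>u. Re (psi u) \<le> - \<delta> * min (u\<^sup>2) (\<bar>u\<bar> powr r)"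
    using Re_psi_decay by (elim exE conjE)
  have le: "exp (s * Re (psi u)) \<le> exp (- (s * \<delta>) * min (u\<^sup>2) (\<bar>u\<bar> powr r))" for u
    using mult_left_mono[OF D[rule_format, of u], of s] assms by (simp only: exp_le_cancel_iff) (simp only: mult_ac mult_minus_left mult_minus_right less_imp_le)
  show ?thesis
  proof (rule Bochner_Integration.integrable_bound)
    show "integrable lborel (\<lambda>u. (1 + \<bar>u\<bar>) * exp (- (s * \<delta>) * min (u\<^sup>2) (\<bar>u\<bar> powr r)))"
      by (rule integrable_stretched_exponential) (use assms d in auto)
    show "AE u in lborel. norm ((1 + \<bar>u\<bar>) * exp (s * Re (psi u)))
        \<le> norm ((1 + \<bar>u\<bar>) * exp (- (s * \<delta>) * min (u\<^sup>2) (\<bar>u\<bar> powr r)))"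
    proof (rule AE_I2)
      fix u :: real
      show "norm ((1 + \<bar>u\<bar>) * exp (s * Re (psi u)))
        \<le> norm ((1 + \<bar>u\<bar>) * exp (- (s * \<delta>) * min (u\<^sup>2) (\<bar>u\<bar> powr r)))"
        unfolding norm_mult by (rule mult_left_mono) (simp_all only: real_norm_def abs_exp_cancel le abs_ge_zero)
    qed
  qed measurable
qed

lemma integrable_exp_psi_real:
  assumes "0 < s"
  shows "integrable lborel (\<lambda>u. exp (s * Re (psi u)))"
    and "integrable lborel (\<lambda>u. \<bar>u\<bar> * exp (s * Re (psi u)))"
proof -
  show "integrable lborel (\<lambda>u. exp (s * Re (psi u)))"
    by (rule Bochner_Integration.integrable_bound[OF integrable_envelope[OF assms]])
       (auto simp: abs_mult intro!: AE_I2)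
  show "integrable lborel (\<lambda>u. \<bar>u\<bar> * exp (s * Re (psi u)))"
    by (rule Bochner_Integration.integrable_bound[OF integrable_envelope[OF assms]])
       (auto simp: abs_mult intro!: AE_I2)
qed

lemma isCont_time_density:
  assumes "0 < t" shows "isCont (\<lambda>t. time_density t x) t"
  unfolding continuous_at_sequentially
proof safe
  fix T assume T: "T \<longlonglongrightarrow> t"
  define s where "s = t / 2"
  have s: "0 < s" "s < t" using assms by (auto simp: s_def)
  from order_tendstoD(1)[OF T s(2)] obtain N where N: "\<And>n. N \<le> n \<Longrightarrow> s < T n"
    by (auto simp: eventually_sequentially)
  have "(\<lambda>n. CLBINT u. iexp (- (u * x)) * exp (of_real (T (n + N)) * psi u))
      \<longlonglongrightarrow> (CLBINT u. iexp (- (u * x)) * exp (of_real t * psi u))"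
  proof (rule integral_dominated_convergence[where w="\<lambda>u. exp (s * Re (psi u))"])
    show "integrable lborel (\<lambda>u. exp (s * Re (psi u)))" using integrable_exp_psi_real s by blast
    show "AE u in lborel. (\<lambda>n. iexp (- (u * x)) * exp (of_real (T (n + N)) * psi u))
        \<longlonglongrightarrow> iexp (- (u * x)) * exp (of_real t * psi u)"
      by (intro AE_I2 tendsto_intros LIMSEQ_ignore_initial_segment T)
    show "AE u in lborel. cmod (iexp (- (u * x)) * exp (of_real (T (n + N)) * psi u)) \<le> exp (s * Re (psi u))" for n
    proof (rule AE_I2)
      fix u
      show "cmod (iexp (- (u * x)) * exp (of_real (T (n + N)) * psi u)) \<le> exp (s * Re (psi u))"
        using norm_exp_psi_antimono[of s "T (n + N)" u] N[of "n + N"]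
        unfolding norm_mult norm_exp_i_times by simp
    qed
  qed measurable
  then have "(\<lambda>n. time_density (T (n + N)) x) \<longlonglongrightarrow> time_density t x"
    unfolding time_density_def inverse_char_def by (intro tendsto_intros) simp_all
  then show "((\<lambda>t. time_density t x) \<circ> T) \<longlonglongrightarrow> time_density t x"
    unfolding comp_def by (rule LIMSEQ_offset)
qed

text \<open>
  The constant in \<open>time_density_approx\<close>; it is uniform over all times \<open>t \<ge> s\<close>.
\<close>

definition density_lipschitz :: "real \<Rightarrow> real" where
  "density_lipschitz s = (LBINT u. \<bar>u\<bar> * exp (s * Re (psi u))) / (4 * pi)"

lemma density_lipschitz_nonneg: "0 \<le> density_lipschitz s"
  unfolding density_lipschitz_def by (intro divide_nonneg_nonneg integral_nonneg_AE) auto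

lemma time_density_approx:
  assumes M: "real_distribution M" and char: "\<And>u. char M u = exp (of_real t * psi u)"
    and s: "0 < s" "s \<le> t" and pq: "p \<le> q"
  shows "\<bar>measure M {p<..q} - (q - p) * time_density t p\<bar> \<le> density_lipschitz s * (q - p)\<^sup>2"
proof -
  interpret M: real_distribution M by fact
  have eq: "char M = (\<lambda>u. exp (of_real t * psi u))" using char by auto
  have t: "0 < t" using s by simp
  have n: "cmod (char M u) = exp (t * Re (psi u))" for u unfolding char by (rule norm_exp_psi)
  have i: "integrable lborel (char M)"
    by (rule Bochner_Integration.integrable_bound[OF integrable_exp_psi_real(1)[OF t]]) (auto simp: n)
  have i1: "integrable lborel (\<lambda>u. \<bar>u\<bar> * cmod (char M u))"
    unfolding n by (rule integrable_exp_psi_real(2)[OF t])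
  have "\<bar>measure M {p<..q} - (q - p) * time_density t p\<bar>
      \<le> (q - p)\<^sup>2 / (4 * pi) * (LBINT u. \<bar>u\<bar> * cmod (char M u))"
    using M.measure_Ioc_approx[OF i i1 pq] unfolding time_density_def eq .
  also have "\<dots> \<le> (q - p)\<^sup>2 / (4 * pi) * (LBINT u. \<bar>u\<bar> * exp (s * Re (psi u)))"
  proof (rule mult_left_mono, rule integral_mono)
    show "integrable lborel (\<lambda>u. \<bar>u\<bar> * cmod (char M u))" by fact
    show "integrable lborel (\<lambda>u. \<bar>u\<bar> * exp (s * Re (psi u)))" by (rule integrable_exp_psi_real(2)[OF s(1)])
    show "\<bar>u\<bar> * cmod (char M u) \<le> \<bar>u\<bar> * exp (s * Re (psi u))" for u
      unfolding char by (intro mult_left_mono norm_exp_psi_antimono s) simp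
  qed simp
  finally show ?thesis by (simp add: density_lipschitz_def mult.commute)
qed

lemma time_density_nonneg:
  assumes M: "real_distribution M" and char: "\<And>u. char M u = exp (of_real t * psi u)" and t: "0 < t"
  shows "0 \<le> time_density t x"
proof (rule ccontr)
  assume n: "\<not> 0 \<le> time_density t x"
  define d where "d = - time_density t x / (2 * (density_lipschitz t + 1))"
  have L: "0 \<le> density_lipschitz t" by (rule density_lipschitz_nonneg)
  have d: "d > 0" unfolding d_def by (rule divide_pos_pos) (use n L in auto)
  have "\<bar>measure M {x<..x + d} - d * time_density t x\<bar> \<le> density_lipschitz t * d\<^sup>2"
    using time_density_approx[OF M char t order_refl, of x "x + d"] d by simp
  then have "d * (- time_density t x) \<le> density_lipschitz t * d\<^sup>2" using measure_nonneg[of M "{x<..x+d}"] by linarith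
  then have "d * (- time_density t x) \<le> d * (density_lipschitz t * d)" by (simp add: power2_eq_square mult_ac)
  then have "- time_density t x \<le> density_lipschitz t * d" using d by (subst (asm) mult_le_cancel_left_pos) auto
  also have "\<dots> \<le> (density_lipschitz t + 1) * d" using d by (intro mult_right_mono) auto
  also have "\<dots> = - time_density t x / 2" using L by (simp add: d_def field_simps)
  finally show False using n by simp
qed

text \<open>
  After the substitution \<open>u \<rightarrow> u / sqrt t\<close> the integrand converges to a Gaussian by
  \<open>psi_scaling\<close>. It is dominated uniformly in \<open>t \<ge> 1\<close>, since \<open>r < 2\<close> implies
  \<open>t |u / sqrt t|\<^bsup>r\<^esup> \<ge> |u|\<^bsup>r\<^esup>\<close>.
\<close>

lemma time_density_asymptotics:
  "((\<lambda>t. sqrt t * time_density t x) \<longlongrightarrow> 1 / sqrt (2 * pi * variance)) at_top"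
proof -
  let ?I = "\<lambda>t u. iexp (- (u / sqrt t * x)) * exp (of_real t * psi (u / sqrt t))"
  obtain \<delta> r where d: "0 < \<delta>" "0 < r" "r < 2" and D: "\<forall>u. Re (psi u) \<le> - \<delta> * min (u\<^sup>2) (\<bar>u\<bar> powr r)"
    using Re_psi_decay by (elim exE conjE)
  define w where "w u = exp (- \<delta> * min (u\<^sup>2) (\<bar>u\<bar> powr r))" for u :: real
  have [measurable]: "w \<in> borel_measurable borel" unfolding w_def by measurable
  have w_nonneg: "0 \<le> w u" for u by (simp add: w_def)
  have iw: "integrable lborel w"
  proof (rule Bochner_Integration.integrable_bound[OF integrable_stretched_exponential[OF d]])
    show "AE u in lborel. norm (w u) \<le> norm ((1 + \<bar>u\<bar>) * exp (- \<delta> * min (u\<^sup>2) (\<bar>u\<bar> powr r)))"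
      unfolding w_def[symmetric] by (intro AE_I2) (simp add: w_nonneg abs_mult mult_le_cancel_right1 leD[OF w_nonneg])
  qed measurable
  have scale: "exp (t * Re (psi (u / sqrt t))) \<le> w u" if t: "t \<ge> 1" for t u
  proof -
    have "t * (\<bar>u / sqrt t\<bar> powr r) \<ge> \<bar>u\<bar> powr r"
    proof -
      have "t * (\<bar>u / sqrt t\<bar> powr r) = \<bar>u\<bar> powr r * (t / sqrt t powr r)"
        using t by (simp add: powr_divide abs_divide)
      also have "sqrt t powr r = t powr (r / 2)"
        using t by (simp add: powr_half_sqrt[symmetric] powr_powr)
      also have "t / t powr (r / 2) = t powr (1 - r / 2)" using t by (simp add: powr_diff)
      also have "\<bar>u\<bar> powr r * 1 \<le> \<bar>u\<bar> powr r * t powr (1 - r / 2)"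
        using t d by (intro mult_left_mono ge_one_powr_ge_zero) auto
      finally show ?thesis by simp
    qed
    moreover have "t * (u / sqrt t)\<^sup>2 = u\<^sup>2" using t by (simp add: power_divide)
    ultimately have m: "min (u\<^sup>2) (\<bar>u\<bar> powr r) \<le> t * min ((u / sqrt t)\<^sup>2) (\<bar>u / sqrt t\<bar> powr r)"
      using t by (auto simp only: min_def split: if_splits)
    have "t * Re (psi (u / sqrt t)) \<le> t * (- \<delta> * min ((u / sqrt t)\<^sup>2) (\<bar>u / sqrt t\<bar> powr r))"
      using t by (intro mult_left_mono D[rule_format]) simp
    also have "\<dots> = - \<delta> * (t * min ((u / sqrt t)\<^sup>2) (\<bar>u / sqrt t\<bar> powr r))" by (simp only: mult_ac)
    also have "\<dots> \<le> - \<delta> * min (u\<^sup>2) (\<bar>u\<bar> powr r)" using d(1) by (intro mult_left_mono_neg m) simp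
    finally show ?thesis unfolding w_def by (simp only: exp_le_cancel_iff)
  qed
  have lim: "((\<lambda>t. CLBINT u. ?I t u)
     \<longlongrightarrow> (CLBINT u. of_real (exp (- variance * u\<^sup>2 / 2)))) at_top"
  proof (rule integral_dominated_convergence_at_top[where w=w])
    have b: "cmod (?I t u) \<le> w u" if "t \<ge> 1" for t u
      using scale[OF that, of u] unfolding norm_mult norm_exp_i_times norm_exp_psi by simp
    show "\<forall>\<^sub>F t in at_top. AE u in lborel. cmod (?I t u) \<le> w u"
      by (rule eventually_at_top_linorderI[of 1]) (intro AE_I2 b)
    have s0: "((\<lambda>t. u / sqrt t) \<longlongrightarrow> 0) at_top" for u
      by (rule tendsto_divide_0[OF tendsto_const]) (rule filterlim_at_top_imp_at_infinity[OF sqrt_at_top])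
    have e: "iexp (- (0 * x)) * exp (of_real a) = of_real (exp a)" for a by (simp add: exp_of_real)
    have "((\<lambda>t. ?I t u)
         \<longlongrightarrow> iexp (- (0 * x)) * exp (of_real (- variance * u\<^sup>2 / 2))) at_top" for u
      by (intro tendsto_intros s0 psi_scaling)
    then show "AE u in lborel. ((\<lambda>t. ?I t u)
         \<longlongrightarrow> of_real (exp (- variance * u\<^sup>2 / 2))) at_top"
      unfolding e by (rule AE_I2)
  qed (simp_all add: iw)
  have "(CLBINT u. of_real (exp (- variance * u\<^sup>2 / 2))) = of_real (sqrt (2 * pi / variance))"
    using gaussian_integral[OF variance_pos] by (simp only: integral_complex_of_real)
  with lim have lim: "((\<lambda>t. Re (CLBINT u. ?I t u) / (2 * pi))
     \<longlongrightarrow> Re (of_real (sqrt (2 * pi / variance))) / (2 * pi)) at_top"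
    by (intro tendsto_intros) simp_all
  have "sqrt t * time_density t x = Re (CLBINT u. ?I t u) / (2 * pi)"
    if t: "t \<ge> 1" for t
  proof -
    have "(CLBINT u. iexp (- (u * x)) * exp (of_real t * psi u))
       = \<bar>1 / sqrt t\<bar> *\<^sub>R (CLBINT u. iexp (- ((0 + (1 / sqrt t) * u) * x)) * exp (of_real t * psi (0 + (1 / sqrt t) * u)))"
      by (rule lborel_integral_real_affine) (use t in simp)
    then have "(CLBINT u. iexp (- (u * x)) * exp (of_real t * psi u))
       = (1 / sqrt t) *\<^sub>R (CLBINT u. ?I t u)"
      using t by simp
    then show ?thesis using t by (simp add: time_density_def inverse_char_def)
  qed
  then have ev: "\<forall>\<^sub>F t in at_top. Re (CLBINT u. ?I t u) / (2 * pi) = sqrt t * time_density t x"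
    by (intro eventually_at_top_linorderI[of 1]) simp
  have "Re (of_real (sqrt (2 * pi / variance))) / (2 * pi) = 1 / sqrt (2 * pi * variance)"
    using variance_pos by (simp add: real_sqrt_divide real_sqrt_mult field_simps)
  with tendsto_cong[THEN iffD1, OF ev lim] show ?thesis by simp
qed

end

section \<open>Records of random walks and the cyclic lemma\<close>

definition partial_sum :: "(nat \<Rightarrow> real) \<Rightarrow> nat \<Rightarrow> real" where
  "partial_sum y k = (\<Sum>i<k. y i)"

primrec run_max :: "(nat \<Rightarrow> real) \<Rightarrow> nat \<Rightarrow> real" where
  "run_max y 0 = 0"
| "run_max y (Suc k) = max (run_max y k) (partial_sum y (Suc k))"

lemma partial_sum_le_run_max: "k \<le> m \<Longrightarrow> partial_sum y k \<le> run_max y m"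
proof (induction m)
  case 0 then show ?case by (simp add: partial_sum_def)
next
  case (Suc m) then show ?case by (cases "k = Suc m") auto
qed

lemma run_max_attained: "\<exists>k\<le>m. run_max y m = partial_sum y k"
proof (induction m)
  case 0 then show ?case by (simp add: partial_sum_def)
next
  case (Suc m)
  then obtain k where "k \<le> m" "run_max y m = partial_sum y k" by blast
  then show ?case by (cases "run_max y m \<le> partial_sum y (Suc m)") (auto simp: max_def intro: exI[of _ "Suc m"] exI[of _ k])
qed

lemma run_max_nonneg: "0 \<le> run_max y m"
  using partial_sum_le_run_max[of 0 m y] by (simp add: partial_sum_def)

lemma run_max_mono: "k \<le> m \<Longrightarrow> run_max y k \<le> run_max y m"
  by (rule lift_Suc_mono_le[of "run_max y"]) auto

lemma less_run_max_iff: "x < run_max y m \<longleftrightarrow> (\<exists>k\<le>m. x < partial_sum y k)"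
  using run_max_attained[of m y] partial_sum_le_run_max[of _ m y] by (metis less_le_trans)

lemma partial_sum_cong: "(\<And>i. i < k \<Longrightarrow> y i = z i) \<Longrightarrow> partial_sum y k = partial_sum z k"
  by (simp add: partial_sum_def)

lemma run_max_cong: "(\<And>i. i < k \<Longrightarrow> y i = z i) \<Longrightarrow> run_max y k = run_max z k"
  by (induction k) (auto intro: arg_cong2[where f=max] partial_sum_cong)

definition rotate_fun :: "nat \<Rightarrow> nat \<Rightarrow> (nat \<Rightarrow> real) \<Rightarrow> nat \<Rightarrow> real" where
  "rotate_fun n j y i = y ((i + j) mod n)"

lemma partial_sum_rotate_fun:
  "partial_sum (rotate_fun n j y) k = partial_sum (rotate_fun n 0 y) (j + k) - partial_sum (rotate_fun n 0 y) j"
proof -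
  have "partial_sum (rotate_fun n 0 y) (j + k) = (\<Sum>i<j. y (i mod n)) + (\<Sum>i<k. y ((i + j) mod n))"
    by (induction k) (auto simp: partial_sum_def rotate_fun_def add_ac)
  then show ?thesis by (simp add: partial_sum_def rotate_fun_def)
qed

lemma partial_sum_rotate_fun_full: "partial_sum (rotate_fun (Suc n) j y) (Suc n) = partial_sum y (Suc n)"
proof (induction j)
  case 0 show ?case by (rule partial_sum_cong) (simp add: rotate_fun_def)
next
  case (Suc j)
  let ?z = "rotate_fun (Suc n) 0 y"
  have "partial_sum (rotate_fun (Suc n) (Suc j) y) (Suc n) - partial_sum (rotate_fun (Suc n) j y) (Suc n)
      = ?z (j + Suc n) - ?z j"
    unfolding partial_sum_rotate_fun[of "Suc n" "Suc j"] partial_sum_rotate_fun[of "Suc n" j] by (simp add: partial_sum_def)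
  also have "\<dots> = 0" by (simp add: rotate_fun_def del: add_Suc_right)
  finally show ?case using Suc by simp
qed

text \<open>
  Let \<open>s\<close> be the sum over one period. If \<open>s \<le> 0\<close>, no shift ends with a new maximum. If \<open>s > 0\<close>, the
  periodic extension gains \<open>s\<close> in each period, so that its maximum over a window of one period is
  its maximum over the whole past. The increments in question are thus successive increments of one
  running maximum, and they telescope to its growth over one period, which is \<open>s\<close>.
\<close>

lemma cyclic_record_sum:
  "(\<Sum>j\<le>n. run_max (rotate_fun (Suc n) j y) (Suc n) - run_max (rotate_fun (Suc n) j y) n) = max 0 (partial_sum y (Suc n))"
proof -
  define z where "z = rotate_fun (Suc n) 0 y"
  define s where "s = partial_sum y (Suc n)"
  let ?r = "\<lambda>j. rotate_fun (Suc n) j y"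
  have r: "partial_sum (?r j) k = partial_sum z (j + k) - partial_sum z j" for j k
    unfolding z_def by (rule partial_sum_rotate_fun)
  have full: "partial_sum (?r j) (Suc n) = s" for j unfolding s_def by (rule partial_sum_rotate_fun_full)
  have per: "partial_sum z (j + Suc n) = partial_sum z j + s" for j using full[of j] unfolding r by simp
  have D: "run_max (?r j) (Suc n) - run_max (?r j) n = max 0 (s - run_max (?r j) n)" for j
    using full[of j] by (simp add: max_def)
  show ?thesis
  proof (cases "s \<le> 0")
    case True
    have "run_max (?r j) (Suc n) - run_max (?r j) n = 0" for j
      unfolding D using True run_max_nonneg[of "?r j" n] by simp
    then show ?thesis using True by (simp add: s_def)
  next
    case False
    \<comment> \<open>Values before the window \<open>{j..j + n}\<close> are dominated by their translates by one period.\<close>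
    have win: "partial_sum z k \<le> partial_sum z j + run_max (?r j) n" if "k \<le> j + n" for k j
      using that
    proof (induction "j - k" arbitrary: k rule: less_induct)
      case less
      show ?case
      proof (cases "j \<le> k")
        case True
        then show ?thesis using partial_sum_le_run_max[of "k - j" n "?r j"] less.prems by (simp add: r algebra_simps)
      next
        case F: False
        have "partial_sum z k \<le> partial_sum z (k + Suc n)" using per[of k] False by simp
        also have "\<dots> \<le> partial_sum z j + run_max (?r j) n"
          using F by (intro less.hyps) auto
        finally show ?thesis .
      qed
    qed
    have W: "run_max z (j + n) = partial_sum z j + run_max (?r j) n" for j
    proof (rule antisym)
      obtain k where "k \<le> j + n" "run_max z (j + n) = partial_sum z k" using run_max_attained by blast
      then show "run_max z (j + n) \<le> partial_sum z j + run_max (?r j) n" using win by simp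
      obtain k where "k \<le> n" "run_max (?r j) n = partial_sum (?r j) k" using run_max_attained by blast
      then show "partial_sum z j + run_max (?r j) n \<le> run_max z (j + n)"
        using partial_sum_le_run_max[of "j + k" "j + n" z] by (simp add: r)
    qed
    have "run_max (?r j) (Suc n) - run_max (?r j) n = run_max z (Suc (j + n)) - run_max z (j + n)" for j
    proof -
      have "partial_sum z (Suc (j + n)) = partial_sum z j + s" using per[of j] by simp
      then show ?thesis unfolding D by (simp only: run_max.simps W)
    qed
    then have "(\<Sum>j\<le>n. run_max (?r j) (Suc n) - run_max (?r j) n) = (\<Sum>j<Suc n. run_max z (Suc j + n) - run_max z (j + n))"
      by (simp add: lessThan_Suc_atMost)
    also have "\<dots> = run_max z (Suc n + n) - run_max z (0 + n)"
      by (rule sum_lessThan_telescope[of "\<lambda>j. run_max z (j + n)"])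
    also have "\<dots> = s"
    proof -
      have "run_max (?r (Suc n)) n = run_max (?r 0) n"
        by (rule run_max_cong) (simp add: rotate_fun_def del: add_Suc_right)
      moreover have "partial_sum z (Suc n) = s" using per[of 0] by (simp add: partial_sum_def)
      ultimately show ?thesis unfolding W by (simp add: partial_sum_def)
    qed
    finally show ?thesis using False by (simp add: s_def)
  qed
qed

lemma partial_sum_measurable [measurable]:
  assumes "\<And>i. i < k \<Longrightarrow> (\<lambda>x. f x i) \<in> borel_measurable M"
  shows "(\<lambda>x. partial_sum (f x) k) \<in> borel_measurable M"
  unfolding partial_sum_def using assms by (intro borel_measurable_sum) auto

lemma run_max_measurable [measurable]:
  assumes "\<And>i. i < k \<Longrightarrow> (\<lambda>x. f x i) \<in> borel_measurable M"
  shows "(\<lambda>x. run_max (f x) k) \<in> borel_measurable M"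
  using assms by (induction k) (auto intro!: borel_measurable_max partial_sum_measurable)

lemma run_max_increment_bounds:
  "0 \<le> run_max y (Suc n) - run_max y n" "run_max y (Suc n) - run_max y n \<le> max 0 (partial_sum y (Suc n))"
  using run_max_nonneg[of y n] by (auto simp: max_def)

text \<open>
  Cyclic shifts preserve both the product measure and the sum of the coordinates. So each shift has
  the same integral, and \<open>cyclic_record_sum\<close> evaluates their sum.
\<close>

lemma record_increment_PiM:
  fixes \<mu> :: "real measure" and n :: nat
  assumes "real_distribution \<mu>" and "A \<in> sets borel" "A \<subseteq> {..q}" "0 \<le> q"
  defines "P \<equiv> PiM {..<Suc n} (\<lambda>_. \<mu>)"
  shows "real (Suc n) * (LINT y|P. (run_max y (Suc n) - run_max y n) * indicator A (partial_sum y (Suc n)))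
     = (LINT y|P. max 0 (partial_sum y (Suc n)) * indicator A (partial_sum y (Suc n)))"
proof -
  interpret \<mu>: real_distribution \<mu> by fact
  interpret P: prob_space P unfolding P_def by (rule prob_space_PiM) (rule \<mu>.prob_space_axioms)
  let ?N = "Suc n"
  let ?D = "\<lambda>y. run_max y ?N - run_max y n"
  let ?F = "\<lambda>y. ?D y * indicator A (partial_sum y ?N) :: real"
  have [measurable_cong]: "sets \<mu> = sets borel" by simp
  have comp [measurable]: "(\<lambda>y. y i) \<in> borel_measurable P" if "i < ?N" for i
  proof -
    have "(\<lambda>y. y i) \<in> measurable P \<mu>"
      unfolding P_def by (rule measurable_component_singleton) (use that in simp)
    also have "measurable P \<mu> = borel_measurable P" by (rule measurable_cong_sets) auto
    finally show ?thesis .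
  qed
  have ms [measurable]: "(\<lambda>y. run_max y ?N) \<in> borel_measurable P" "(\<lambda>y. run_max y n) \<in> borel_measurable P"
    "(\<lambda>y. partial_sum y ?N) \<in> borel_measurable P"
    by (auto intro!: run_max_measurable partial_sum_measurable comp simp del: run_max.simps)
  have [measurable]: "A \<in> sets borel" by fact
  have F [measurable]: "?F \<in> borel_measurable P" by (measurable; simp only: )
  have rot: "(LINT y|P. ?F (rotate_fun ?N j y)) = (LINT y|P. ?F y)"
    and rot_meas: "(\<lambda>y. ?F (rotate_fun ?N j y)) \<in> borel_measurable P" for j
  proof -
    let ?f = "\<lambda>i. (i + j) mod ?N"
    let ?T = "\<lambda>y. \<lambda>i\<in>{..<?N}. y (?f i)"
    have inj: "inj_on ?f {..<?N}"
    proof (rule inj_onI)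
      fix i k assume ik: "i \<in> {..<?N}" "k \<in> {..<?N}" "?f i = ?f k"
      then obtain q1 q2 where "i + j + ?N * q1 = k + j + ?N * q2" unfolding nat_mod_eq_iff by blast
      then have "i + ?N * q1 = k + ?N * q2" by simp
      then have "(i + ?N * q1) mod ?N = (k + ?N * q2) mod ?N" by (simp only:)
      with ik show "i = k" by (simp only: mod_mult_self2 lessThan_iff mod_less)
    qed
    have d: "distr P P ?T = P"
      using distr_PiM_reindex[of "{..<?N}" "\<lambda>_. \<mu>" ?f "{..<?N}"] inj \<mu>.prob_space_axioms
      unfolding P_def by auto
    have T [measurable]: "?T \<in> measurable P P"
      unfolding P_def by (rule measurable_restrict) (auto intro!: measurable_component_singleton)
    have e: "?F (?T y) = ?F (rotate_fun ?N j y)" for y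
    proof -
      have "partial_sum (?T y) ?N = partial_sum (rotate_fun ?N j y) ?N" "run_max (?T y) ?N = run_max (rotate_fun ?N j y) ?N"
        "run_max (?T y) n = run_max (rotate_fun ?N j y) n"
        by (auto intro!: partial_sum_cong run_max_cong simp: rotate_fun_def simp del: run_max.simps)
      then show ?thesis by (simp only:)
    qed
    have "(LINT y|P. ?F y) = (LINT y|distr P P ?T. ?F y)" by (simp only: d)
    also have "\<dots> = (LINT y|P. ?F (?T y))" by (rule integral_distr[OF T F])
    finally show "(LINT y|P. ?F (rotate_fun ?N j y)) = (LINT y|P. ?F y)" by (simp only: e)
    have "(\<lambda>y. ?F (?T y)) \<in> borel_measurable P" by (rule measurable_compose[OF T F])
    then show "(\<lambda>y. ?F (rotate_fun ?N j y)) \<in> borel_measurable P" by (simp only: e)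
  qed
  have bound: "norm (?F y) \<le> q" for y
    using run_max_increment_bounds[of y n] assms(3,4)
    by (auto split: split_indicator simp del: run_max.simps)
  have "real ?N * (LINT y|P. ?F y) = (\<Sum>j\<le>n. (LINT y|P. ?F (rotate_fun ?N j y)))"
    by (simp only: rot) simp
  also have "\<dots> = (LINT y|P. (\<Sum>j\<le>n. ?F (rotate_fun ?N j y)))"
    by (rule Bochner_Integration.integral_sum[symmetric], rule P.integrable_const_bound[of _ q])
       (use bound rot_meas in auto)
  also have "(\<lambda>y. \<Sum>j\<le>n. ?F (rotate_fun ?N j y)) = (\<lambda>y. max 0 (partial_sum y ?N) * indicator A (partial_sum y ?N))"
    unfolding partial_sum_rotate_fun_full by (simp only: sum_distrib_right[symmetric] cyclic_record_sum)
  finally show ?thesis .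
qed

text \<open>
  The increment is nonzero only if the last step is a record, and then the running maximum equals
  the last partial sum.
\<close>

lemma (in prob_space) record_increment_expectation:
  fixes Y :: "nat \<Rightarrow> 'a \<Rightarrow> real"
  assumes ind: "indep_vars (\<lambda>_. borel) Y {..<Suc n}"
    and id: "\<And>i. i \<le> n \<Longrightarrow> distr M borel (Y i) = \<mu>"
    and pq: "0 \<le> p" "p \<le> q"
  shows "expectation (\<lambda>w. (run_max (\<lambda>i. Y i w) (Suc n) - run_max (\<lambda>i. Y i w) n)
            * indicator {p<..q} (run_max (\<lambda>i. Y i w) (Suc n)))
     = expectation (\<lambda>w. partial_sum (\<lambda>i. Y i w) (Suc n) * indicator {p<..q} (partial_sum (\<lambda>i. Y i w) (Suc n))) / real (Suc n)"
proof -
  let ?I = "{..<Suc n}"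
  have rv: "random_variable borel (Y i)" if "i \<in> ?I" for i
    using ind that unfolding indep_vars_def by auto
  have rd: "real_distribution \<mu>"
    using id[of 0] rv[of 0] real_distribution_distr[of "Y 0"] by auto
  define P where "P = PiM ?I (\<lambda>_. \<mu>)"
  let ?T = "\<lambda>w. \<lambda>i\<in>?I. Y i w"
  have "distr M (PiM ?I (\<lambda>_. borel)) ?T = PiM ?I (\<lambda>i. distr M borel (Y i))"
    using indep_vars_iff_distr_eq_PiM'[of ?I Y "\<lambda>_. borel"] ind rv by auto
  also have "\<dots> = P" unfolding P_def by (rule PiM_cong) (auto simp: id)
  finally have d: "distr M (PiM ?I (\<lambda>_. borel)) ?T = P" .
  have T: "?T \<in> measurable M (PiM ?I (\<lambda>_. borel))"
    by (rule measurable_restrict) (use rv in auto)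
  have restr: "partial_sum (?T w) (Suc n) = partial_sum (\<lambda>i. Y i w) (Suc n)" "run_max (?T w) (Suc n) = run_max (\<lambda>i. Y i w) (Suc n)"
      "run_max (?T w) n = run_max (\<lambda>i. Y i w) n" for w
    by (auto intro!: partial_sum_cong run_max_cong simp del: run_max.simps)
  have comp: "(\<lambda>y. y i) \<in> borel_measurable (PiM ?I (\<lambda>_. borel))" if "i < Suc n" for i
    by (rule measurable_component_singleton) (use that in simp)
  have ms [measurable]: "(\<lambda>y. run_max y (Suc n)) \<in> borel_measurable (PiM ?I (\<lambda>_. borel))"
    "(\<lambda>y. run_max y n) \<in> borel_measurable (PiM ?I (\<lambda>_. borel))"
    "(\<lambda>y. partial_sum y (Suc n)) \<in> borel_measurable (PiM ?I (\<lambda>_. borel))"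
    by (auto intro!: run_max_measurable partial_sum_measurable comp simp del: run_max.simps)
  let ?D = "\<lambda>y. run_max y (Suc n) - run_max y n"
  have rec: "?D y * indicator {p<..q} (run_max y (Suc n)) = ?D y * indicator {p<..q} (partial_sum y (Suc n))" for y :: "nat \<Rightarrow> real"
    by (simp add: max_def)
  have pos: "max 0 x * indicator {p<..q} x = x * indicator {p<..q} x" for x :: real
    using pq by (auto split: split_indicator)
  have "real (Suc n) * (LINT y|P. ?D y * indicator {p<..q} (partial_sum y (Suc n)))
      = (LINT y|P. max 0 (partial_sum y (Suc n)) * indicator {p<..q} (partial_sum y (Suc n)))"
    unfolding P_def by (rule record_increment_PiM[OF rd, of _ q]) (use pq in auto)
  also have "(LINT y|P. ?D y * indicator {p<..q} (partial_sum y (Suc n)))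
      = expectation (\<lambda>w. ?D (?T w) * indicator {p<..q} (partial_sum (?T w) (Suc n)))"
    unfolding d[symmetric] by (rule integral_distr[OF T]) (measurable; simp only:)
  also have "(LINT y|P. max 0 (partial_sum y (Suc n)) * indicator {p<..q} (partial_sum y (Suc n)))
      = expectation (\<lambda>w. max 0 (partial_sum (?T w) (Suc n)) * indicator {p<..q} (partial_sum (?T w) (Suc n)))"
    unfolding d[symmetric] by (rule integral_distr[OF T]) (measurable; simp only:)
  finally show ?thesis
    unfolding rec pos restr by (simp add: field_simps del: run_max.simps)
qed

section \<open>Kendall's identity\<close>

text \<open>
  For \<open>p \<le> q\<close>, its increment over \<open>[a, b]\<close> is the length of \<open>[a, b] \<inter> [p, q]\<close>.
\<close>

definition clamp :: "real \<Rightarrow> real \<Rightarrow> real \<Rightarrow> real" where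
  "clamp p q x = min (max x p) q"

lemma clamp_mono: "a \<le> b \<Longrightarrow> clamp p q a \<le> clamp p q b"
  by (auto simp: clamp_def)

text \<open>
  A step of size at most \<open>\<eta>\<close> contributes an error only if it crosses \<open>p\<close> or \<open>q\<close>. The bound on the
  right-hand side is stated as an increment so that it telescopes: a monotone path crosses each level
  once, and the total error is at most \<open>2 \<eta>\<close>, whatever the number of steps.
\<close>

lemma clamp_increment_error:
  assumes "a \<le> b" "b \<le> a + \<eta>" "p \<le> q"
  shows "\<bar>(b - a) * indicator {p<..q} b - (clamp p q b - clamp p q a)\<bar>
    \<le> (clamp (p - \<eta>) p b + clamp (q - \<eta>) q b) - (clamp (p - \<eta>) p a + clamp (q - \<eta>) q a)"
proof -
  consider "b \<le> p" | "p < b" "b \<le> q" | "q < b" by linarith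
  then show ?thesis
  proof cases
    case 1
    then have "clamp p q b = p" "clamp p q a = p" using assms by (auto simp: clamp_def)
    moreover have "0 \<le> clamp (p - \<eta>) p b - clamp (p - \<eta>) p a" "0 \<le> clamp (q - \<eta>) q b - clamp (q - \<eta>) q a"
      using clamp_mono[OF assms(1)] by simp_all
    ultimately show ?thesis using 1 by simp
  next
    case 2
    then have c: "clamp p q b = b" "clamp p q a = max a p" using assms by (auto simp: clamp_def)
    have "clamp (p - \<eta>) p b = p" "clamp (p - \<eta>) p a = min a p" using assms 2 by (auto simp: clamp_def)
    moreover have "0 \<le> clamp (q - \<eta>) q b - clamp (q - \<eta>) q a"
      using clamp_mono[OF assms(1)] by simp
    moreover have "(b - a) * indicator {p<..q} b - (clamp p q b - clamp p q a) = max a p - a"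
      using 2 unfolding c by simp
    moreover have "\<bar>max a p - a\<bar> = p - min a p" by (simp add: max_def min_def)
    ultimately show ?thesis by linarith
  next
    case 3
    then have "clamp p q b = q" "clamp p q a \<ge> min a q" "clamp p q a \<le> q" using assms by (auto simp: clamp_def)
    moreover have "clamp (q - \<eta>) q b = q" "clamp (q - \<eta>) q a = min a q" using assms 3 by (auto simp: clamp_def)
    moreover have "0 \<le> clamp (p - \<eta>) p b - clamp (p - \<eta>) p a"
      using clamp_mono[OF assms(1)] by simp
    moreover have "(b - a) * indicator {p<..q} b = 0" using 3 by simp
    ultimately show ?thesis by linarith
  qed
qed

lemma clamp_telescope_error:
  fixes R :: "nat \<Rightarrow> real"
  assumes "\<And>k. R k \<le> R (Suc k)" "\<And>k. k < b \<Longrightarrow> R (Suc k) \<le> R k + \<eta>" "p \<le> q" "a \<le> b" "0 \<le> \<eta>"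
  shows "\<bar>(\<Sum>k=a..<b. (R (Suc k) - R k) * indicator {p<..q} (R (Suc k))) - (clamp p q (R b) - clamp p q (R a))\<bar> \<le> 2 * \<eta>"
proof -
  let ?d = "\<lambda>k. (R (Suc k) - R k) * indicator {p<..q} (R (Suc k)) :: real"
  let ?c = "\<lambda>k. clamp p q (R k)"
  let ?G = "\<lambda>x. clamp (p - \<eta>) p x + clamp (q - \<eta>) q x"
  have "?c b - ?c a = (\<Sum>k=a..<b. ?c (Suc k) - ?c k)"
    using sum_Suc_diff'[OF assms(4), of "\<lambda>k. clamp p q (R k)"] by simp
  then have "\<bar>(\<Sum>k=a..<b. ?d k) - (?c b - ?c a)\<bar>
    = \<bar>\<Sum>k=a..<b. ?d k - (?c (Suc k) - ?c k)\<bar>"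
    by (simp add: sum_subtractf)
  also have "\<dots> \<le> (\<Sum>k=a..<b. \<bar>?d k - (?c (Suc k) - ?c k)\<bar>)"
    by (rule sum_abs)
  also have "\<dots> \<le> (\<Sum>k=a..<b. ?G (R (Suc k)) - ?G (R k))"
    by (rule sum_mono, rule clamp_increment_error) (use assms in auto)
  also have "\<dots> = ?G (R b) - ?G (R a)"
    by (rule sum_Suc_diff'[OF assms(4)])
  also have "\<dots> \<le> 2 * \<eta>" using assms(5) by (auto simp: clamp_def)
  finally show ?thesis .
qed

text \<open>
  The bound used on the unlikely event that some step is large.
\<close>

lemma clamp_telescope_crude:
  fixes R :: "nat \<Rightarrow> real"
  assumes mono: "\<And>k. R k \<le> R (Suc k)" and "0 \<le> R a" "0 \<le> p" "p \<le> q" "a \<le> b"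
  shows "\<bar>(\<Sum>k=a..<b. (R (Suc k) - R k) * indicator {p<..q} (R (Suc k))) - (clamp p q (R b) - clamp p q (R a))\<bar> \<le> q"
proof -
  let ?d = "\<lambda>k. (R (Suc k) - R k) * indicator {p<..q} (R (Suc k)) :: real"
  let ?c = "\<lambda>k. clamp p q (R k)"
  have "R a \<le> R b" using lift_Suc_mono_le[of R] mono assms(5) by blast
  then have 1: "0 \<le> ?c b - ?c a" "?c b - ?c a \<le> q"
    using assms by (auto simp: clamp_def)
  have "(\<Sum>k=a..<b. ?d k) \<le> (\<Sum>k=a..<b. min (R (Suc k)) q - min (R k) q)"
    by (rule sum_mono) (use mono in \<open>auto simp: min_def split: split_indicator intro: order_trans\<close>)
  also have "\<dots> = min (R b) q - min (R a) q" by (rule sum_Suc_diff'[OF assms(5)])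
  also have "\<dots> \<le> q" using assms by auto
  finally have 2: "(\<Sum>k=a..<b. ?d k) \<le> q" .
  have 3: "0 \<le> (\<Sum>k=a..<b. ?d k)"
    by (rule sum_nonneg) (use mono in auto)
  show ?thesis using 1 2 3 by linarith
qed

lemma clamp_bounds:
  assumes "p \<le> q"
  shows "p + (q - p) * indicator {q<..} x \<le> clamp p q x" "clamp p q x \<le> p + (q - p) * indicator {p<..} x"
  using assms by (auto simp: clamp_def split: split_indicator)

lemma dyadic_riemann_sums:
  fixes f :: "real \<Rightarrow> real" and i j m :: nat
  assumes cont: "continuous_on {real i / 2 ^ m..real j / 2 ^ m} f" and ij: "i \<le> j"
  shows "(\<lambda>n. \<Sum>k=i*2^n..<j*2^n. f (real (Suc k) / 2 ^ (m + n)) / 2 ^ (m + n))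
     \<longlonglongrightarrow> integral {real i / 2 ^ m..real j / 2 ^ m} f"
proof (rule LIMSEQ_I)
  fix e :: real assume e: "0 < e"
  define s t where "s = real i / 2 ^ m" and "t = real j / 2 ^ m"
  have st: "s \<le> t" using ij by (simp add: s_def t_def divide_right_mono)
  define \<eta> where "\<eta> = e / (t - s + 1)"
  have \<eta>: "\<eta> > 0" using e st by (simp add: \<eta>_def)
  have "uniformly_continuous_on {s..t} f"
    using cont unfolding s_def t_def by (rule compact_uniformly_continuous) simp
  then obtain d where d: "d > 0" and D: "\<And>x y. x \<in> {s..t} \<Longrightarrow> y \<in> {s..t} \<Longrightarrow> dist x y < d \<Longrightarrow> dist (f x) (f y) < \<eta>"
    unfolding uniformly_continuous_on_def using \<eta> by metis
  obtain n0 where n0: "(1 / 2) ^ n0 < d" using real_arch_pow_inv[of d "1/2"] d by auto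
  have "norm ((\<Sum>k=i*2^n..<j*2^n. f (real (Suc k) / 2 ^ (m + n)) / 2 ^ (m + n)) - integral {s..t} f) < e" if n: "n0 \<le> n" for n
  proof -
    define N :: real where "N = 2 ^ (m + n)"
    have N: "N > 0" by (simp add: N_def)
    have "1 / N \<le> (1 / 2) ^ n" by (simp add: N_def power_add power_one_over field_simps)
    also have "\<dots> \<le> (1 / 2) ^ n0" using n by (intro power_decreasing) auto
    finally have Nd: "1 / N < d" using n0 by simp
    have si: "s = real (i * 2 ^ n) / N" and tj: "t = real (j * 2 ^ n) / N"
      by (simp_all add: s_def t_def N_def power_add)
    have pt: "real k / N \<in> {s..t}" if "i * 2 ^ n \<le> k" "k \<le> j * 2 ^ n" for k
    proof -
      have "real (i * 2 ^ n) \<le> real k" "real k \<le> real (j * 2 ^ n)"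
        using that by (simp_all only: of_nat_le_iff)
      then show ?thesis
        unfolding si tj atLeastAtMost_iff using less_imp_le[OF N] by (intro conjI divide_right_mono)
    qed
    have int: "f integrable_on {x..y}" if "s \<le> x" "y \<le> t" for x y
      using that cont unfolding s_def[symmetric] t_def[symmetric]
      by (intro integrable_continuous_interval) (auto intro: continuous_on_subset)
    have split: "integral {s..real b / N} f = (\<Sum>k=i*2^n..<b. integral {real k / N..real (Suc k) / N} f)"
      if "i * 2 ^ n \<le> b" "b \<le> j * 2 ^ n" for b
      using that
    proof (induction b rule: dec_induct)
      case base
      show ?case by (simp add: si del: of_nat_mult of_nat_power)
    next
      case (step b)
      have "integral {s..real (Suc b) / N} f = integral {s..real b / N} f + integral {real b / N..real (Suc b) / N} f"
      proof (rule Henstock_Kurzweil_Integration.integral_combine[symmetric])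
        show "s \<le> real b / N" using pt[of b] step by auto
        show "real b / N \<le> real (Suc b) / N" using N by (simp add: divide_right_mono)
        show "f integrable_on {s..real (Suc b) / N}" using pt[of "Suc b"] step by (intro int) auto
      qed
      then show ?case using step by simp
    qed
    have piece: "\<bar>f (real (Suc k) / N) / N - integral {real k / N..real (Suc k) / N} f\<bar> \<le> \<eta> / N"
      if k: "k \<in> {i*2^n..<j*2^n}" for k
    proof -
      have lk: "real k / N \<le> real (Suc k) / N" using N by (simp add: divide_right_mono)
      have inc: "real k / N \<in> {s..t}" "real (Suc k) / N \<in> {s..t}" using k by (intro pt; simp)+
      have c: "((\<lambda>x. f (real (Suc k) / N)) has_integral (f (real (Suc k) / N) / N)) {real k / N..real (Suc k) / N}"
        using has_integral_const_real[of "f (real (Suc k) / N)" "real k / N" "real (Suc k) / N"] lk N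
        by (simp add: field_simps)
      have "(f has_integral integral {real k / N..real (Suc k) / N} f) {real k / N..real (Suc k) / N}"
        using inc by (intro integrable_integral int) auto
      from has_integral_diff[OF c this]
      have h: "((\<lambda>x. f (real (Suc k) / N) - f x) has_integral (f (real (Suc k) / N) / N - integral {real k / N..real (Suc k) / N} f))
         (cbox (real k / N) (real (Suc k) / N))" by simp
      have "norm (f (real (Suc k) / N) / N - integral {real k / N..real (Suc k) / N} f) \<le> \<eta> * measure lborel (cbox (real k / N) (real (Suc k) / N))"
      proof (rule has_integral_bound[OF _ h])
        fix x assume x: "x \<in> cbox (real k / N) (real (Suc k) / N)"
        then have "x \<in> {s..t}" using inc by auto
        moreover have "dist (real (Suc k) / N) x < d"
          using x Nd by (auto simp: dist_real_def add_divide_distrib)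
        ultimately show "norm (f (real (Suc k) / N) - f x) \<le> \<eta>"
          using D[OF inc(2)] by (auto simp: dist_real_def intro: less_imp_le)
      qed (use \<eta> in simp)
      also have "measure lborel (cbox (real k / N) (real (Suc k) / N)) = 1 / N"
        using lk by (simp add: add_divide_distrib)
      finally show ?thesis by simp
    qed
    have "integral {s..t} f = (\<Sum>k=i*2^n..<j*2^n. integral {real k / N..real (Suc k) / N} f)"
      using split[of "j * 2 ^ n"] ij unfolding tj by simp
    then have "\<bar>(\<Sum>k=i*2^n..<j*2^n. f (real (Suc k) / N) / N) - integral {s..t} f\<bar>
       = \<bar>\<Sum>k=i*2^n..<j*2^n. f (real (Suc k) / N) / N - integral {real k / N..real (Suc k) / N} f\<bar>"
      by (simp only: sum_subtractf)
    also have "\<dots> \<le> (\<Sum>k=i*2^n..<j*2^n. \<bar>f (real (Suc k) / N) / N - integral {real k / N..real (Suc k) / N} f\<bar>)"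
      by (rule sum_abs)
    also have "\<dots> \<le> (\<Sum>k=i*2^n..<j*2^n. \<eta> / N)" by (rule sum_mono) (rule piece)
    also have "\<dots> = \<eta> * (t - s)"
    proof -
      have "real (j * 2 ^ n - i * 2 ^ n) = real (j * 2 ^ n) - real (i * 2 ^ n)"
        using ij by (intro of_nat_diff) simp
      then show ?thesis unfolding si tj by (simp add: diff_divide_distrib right_diff_distrib left_diff_distrib mult.commute)
    qed
    also have "\<dots> < \<eta> * (t - s + 1)" using \<eta> by simp
    also have "\<dots> = e" using st by (simp add: \<eta>_def)
    finally show ?thesis by (simp add: N_def)
  qed
  then show "\<exists>no. \<forall>n\<ge>no. norm ((\<Sum>k=i*2^n..<j*2^n. f (real (Suc k) / 2 ^ (m + n)) / 2 ^ (m + n))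
      - integral {real i / 2 ^ m..real j / 2 ^ m} f) < e"
    unfolding s_def t_def by blast
qed

text \<open>
  The conditions on the increments are those of a random walk on each grid \<open>{i / N | i}\<close>. Suprema are taken
  over dyadic times in what follows, and the times \<open>k / N\<close> are those at which \<open>char_X_1\<close> determines the
  characteristic function by taking roots and powers.
\<close>

locale spectrally_negative_process = prob_space M + K: kolmogorov_measure K
  for M :: "'a measure" and K :: "real measure" +
  fixes X :: "real \<Rightarrow> 'a \<Rightarrow> real"
  assumes X_0: "\<And>w. X 0 w = 0"
    and rv_X: "\<And>t. 0 \<le> t \<Longrightarrow> random_variable borel (X t)"
    and incr_indep: "\<And>N n. 0 < N \<Longrightarrow> indep_vars (\<lambda>_. borel) (\<lambda>i w. X (real (Suc i) / real N) w - X (real i / real N) w) {..<n}"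
    and incr_distr: "\<And>N i. 0 < N \<Longrightarrow> distr M borel (\<lambda>w. X (real (Suc i) / real N) w - X (real i / real N) w) = distr M borel (X (1 / real N))"
    and char_X_1: "\<And>u. char (distr M borel (X 1)) u = exp (K.psi u)"
begin

definition incr :: "nat \<Rightarrow> 'a \<Rightarrow> nat \<Rightarrow> real" where
  "incr N w i = X (real (Suc i) / real N) w - X (real i / real N) w"

lemma partial_sum_incr: "partial_sum (incr N w) k = X (real k / real N) w"
proof (induction k)
  case 0 show ?case by (simp add: partial_sum_def X_0)
next
  case (Suc k)
  have "partial_sum (incr N w) (Suc k) = partial_sum (incr N w) k + incr N w k" by (simp add: partial_sum_def)
  moreover have "incr N w k = X (real (Suc k) / real N) w - X (real k / real N) w" by (rule incr_def)
  ultimately show ?case using Suc by linarith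
qed

lemma rv_incr [measurable]: "(\<lambda>w. incr N w i) \<in> borel_measurable M"
  unfolding incr_def by (intro borel_measurable_diff rv_X) auto

lemma rv_grid [measurable]: "(\<lambda>w. X (real k / real N) w) \<in> borel_measurable M"
  by (rule rv_X) simp

lemma rv_run_max [measurable]: "(\<lambda>w. run_max (incr N w) k) \<in> borel_measurable M"
  by (intro run_max_measurable rv_incr)

lemma real_distribution_X: "0 \<le> t \<Longrightarrow> real_distribution (distr M borel (X t))"
  by (rule real_distribution_distr) (rule rv_X)

lemma char_grid_power:
  assumes "0 < N"
  shows "char (distr M borel (X (real k / real N))) u = char (distr M borel (X (1 / real N))) u ^ k"
proof -
  have "char (distr M borel (\<lambda>w. \<Sum>i<k. incr N w i)) u = (\<Prod>i<k. char (distr M borel (\<lambda>w. incr N w i)) u)"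
    unfolding incr_def by (rule char_distr_sum) (rule incr_indep[OF assms])
  also have "(\<lambda>w. \<Sum>i<k. incr N w i) = X (real k / real N)"
    using partial_sum_incr by (auto simp: partial_sum_def)
  also have "(\<Prod>i<k. char (distr M borel (\<lambda>w. incr N w i)) u) = char (distr M borel (X (1 / real N))) u ^ k"
    unfolding incr_def incr_distr[OF assms] by simp
  finally show ?thesis .
qed

text \<open>
  The characteristic function at time \<open>1 / N\<close> is an \<open>N\<close>-th root of \<open>exp \<circ> psi\<close>. By continuity
  it is the one that equals \<open>1\<close> at \<open>0\<close>.
\<close>

lemma char_root:
  assumes N: "0 < N"
  shows "char (distr M borel (X (1 / real N))) u = exp (K.psi u / of_nat N)"
proof -
  interpret D: real_distribution "distr M borel (X (1 / real N))" by (rule real_distribution_X) simp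
  define \<phi> where "\<phi> = char (distr M borel (X (1 / real N)))"
  \<comment> \<open>The quotient of two continuous \<open>N\<close>-th roots takes its values in the finite set of roots of
    unity, hence is constant.\<close>
  define g where "g u = \<phi> u * exp (- K.psi u / of_nat N)" for u
  have pow: "g u ^ N = 1" for u
  proof -
    have "\<phi> u ^ N = exp (K.psi u)"
      using char_grid_power[OF N, of N u] N char_X_1[of u] by (simp add: \<phi>_def)
    moreover have "exp (- K.psi u / of_nat N) ^ N = exp (- K.psi u)"
      using N by (simp flip: exp_of_nat_mult)
    ultimately show ?thesis by (simp add: g_def power_mult_distrib exp_minus)
  qed
  have "isCont g u" for u
    unfolding g_def \<phi>_def using N
    by (intro continuous_intros D.isCont_char K.isCont_psi) auto
  then have "continuous_on UNIV g" by (simp add: continuous_at_imp_continuous_on)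
  moreover have "finite (range g)"
    by (rule finite_subset[OF _ finite_roots_unity[of N]]) (use pow N in auto)
  ultimately have "g constant_on UNIV"
    by (intro continuous_finite_range_constant) auto
  then have "g u = g 0" unfolding constant_on_def by auto
  also have "g 0 = 1" using D.char_zero by (simp add: g_def \<phi>_def K.psi_0)
  finally show ?thesis by (simp add: g_def \<phi>_def exp_minus field_simps)
qed

lemma char_grid:
  assumes "0 < N"
  shows "char (distr M borel (X (real k / real N))) u = exp (of_real (real k / real N) * K.psi u)"
  unfolding char_grid_power[OF assms] char_root[OF assms] using assms by (simp flip: exp_of_nat_mult)

lemma jump_rate_tendsto_0:
  assumes e: "0 < \<eta>"
  shows "(\<lambda>n. real (2 ^ (m + n)) * prob {w \<in> space M. \<eta> < X (1 / real (2 ^ (m + n))) w}) \<longlonglongrightarrow> 0"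
proof -
  let ?h = "\<lambda>n. real (Suc n) * measure (distr M borel (X (1 / real (Suc n)))) {\<eta><..}"
  have "?h \<longlonglongrightarrow> 0"
    by (rule K.positive_tail_tendsto_0[OF _ _ e]) (auto intro!: real_distribution_X char_root simp del: of_nat_Suc)
  moreover have "filterlim (\<lambda>n. 2 ^ (m + n) - Suc 0 :: nat) at_top sequentially"
  proof (rule filterlim_at_top_mono[OF filterlim_ident])
    have "n \<le> 2 ^ (m + n) - Suc 0" for n
      using less_exp[of "m + n"] by linarith
    then show "\<forall>\<^sub>F n in sequentially. n \<le> 2 ^ (m + n) - Suc 0" by simp
  qed
  ultimately have "(\<lambda>n. ?h (2 ^ (m + n) - Suc 0)) \<longlonglongrightarrow> 0"
    by (rule filterlim_compose)
  moreover have "?h (2 ^ (m + n) - Suc 0) = real (2 ^ (m + n)) * prob {w \<in> space M. \<eta> < X (1 / real (2 ^ (m + n))) w}" for n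
  proof -
    have "Suc (2 ^ (m + n) - Suc 0) = 2 ^ (m + n)" by simp
    moreover have "measure (distr M borel (X (1 / real N))) {\<eta><..} = prob {w \<in> space M. \<eta> < X (1 / real N) w}" for N
      by (subst measure_distr) (auto intro!: rv_X arg_cong[where f=prob])
    ultimately show ?thesis by (simp only:)
  qed
  ultimately show ?thesis by (simp only:)
qed

text \<open>
  The sum on the left is the expectation of the record increments that end in \<open>(p, q]\<close>; the
  difference of expectations is the expected length swept over in \<open>(p, q]\<close>. They differ by at most
  \<open>2 \<eta>\<close> if all steps are at most \<open>\<eta>\<close>, and by at most \<open>q\<close> otherwise.
\<close>

lemma clamp_record_estimate:
  assumes N: "0 < N" and pq: "0 \<le> p" "p \<le> q" and e: "0 \<le> \<eta>" and ab: "a \<le> b"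
  shows "\<bar>(\<Sum>k=a..<b. expectation (\<lambda>w. X (real (Suc k) / real N) w * indicator {p<..q} (X (real (Suc k) / real N) w)) / real (Suc k))
      - (expectation (\<lambda>w. clamp p q (run_max (incr N w) b)) - expectation (\<lambda>w. clamp p q (run_max (incr N w) a)))\<bar>
    \<le> 2 * \<eta> + q * (real b * prob {w \<in> space M. \<eta> < X (1 / real N) w})"
proof -
  let ?p = "prob {w \<in> space M. \<eta> < X (1 / real N) w}"
  let ?R = "\<lambda>w k. run_max (incr N w) k"
  let ?d = "\<lambda>k w. (?R w (Suc k) - ?R w k) * indicator {p<..q} (?R w (Suc k)) :: real"
  let ?c = "\<lambda>k w. clamp p q (?R w k)"
  let ?W = "\<lambda>w. (\<Sum>k=a..<b. ?d k w) - (?c b w - ?c a w)"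
  let ?J = "\<lambda>w. \<Sum>i<b. indicator {w \<in> space M. \<eta> < incr N w i} w :: real"
  have [measurable]: "(\<lambda>w. ?R w (Suc k)) \<in> borel_measurable M" for k by (rule rv_run_max)
  have dm: "?d k \<in> borel_measurable M" for k
    by (measurable; simp only:)
  have di: "integrable M (?d k)" for k
  proof (rule integrable_const_bound[OF _ dm])
    show "AE w in M. norm (?d k w) \<le> q"
    proof (rule AE_I2)
      fix w
      have "0 \<le> ?R w k" "?R w k \<le> ?R w (Suc k)" by (rule run_max_nonneg, rule run_max_mono) simp
      then show "norm (?d k w) \<le> q" using pq by (auto split: split_indicator simp del: run_max.simps)
    qed
  qed
  have ci: "integrable M (?c k)" for k
  proof (rule integrable_const_bound)
    show "AE w in M. norm (?c k w) \<le> q" using pq by (auto simp: clamp_def)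
    show "?c k \<in> borel_measurable M" unfolding clamp_def by measurable
  qed
  have step: "?R w (Suc k) \<le> ?R w k + max 0 (incr N w k)" for k w
    using partial_sum_le_run_max[of k k "incr N w"] by (simp add: partial_sum_def)
  have pw: "\<bar>?W w\<bar> \<le> 2 * \<eta> + q * ?J w" if w: "w \<in> space M" for w
  proof (cases "\<exists>i<b. \<eta> < incr N w i")
    case True
    then obtain i where i: "i < b" "\<eta> < incr N w i" by blast
    have "(1::real) = indicator {w \<in> space M. \<eta> < incr N w i} w" using i w by simp
    also have "\<dots> \<le> ?J w" using i by (intro member_le_sum) auto
    finally have "q * 1 \<le> q * ?J w" using pq by (intro mult_left_mono) auto
    moreover have "\<bar>?W w\<bar> \<le> q"
      by (rule clamp_telescope_crude) (use pq ab run_max_nonneg run_max_mono[of _ "Suc _"] in \<open>auto simp del: run_max.simps\<close>)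
    ultimately show ?thesis using e by linarith
  next
    case False
    then have "\<bar>?W w\<bar> \<le> 2 * \<eta>"
    proof (intro clamp_telescope_error)
      show "?R w (Suc k) \<le> ?R w k + \<eta>" if "k < b" for k
      proof -
        have "incr N w k \<le> \<eta>" using False that by (meson not_le)
        then show ?thesis using step[of w k] e by linarith
      qed
    qed (use pq ab e run_max_mono[of _ "Suc _"] in \<open>auto simp del: run_max.simps\<close>)
    moreover have "0 \<le> q * ?J w" using pq by (intro mult_nonneg_nonneg sum_nonneg) auto
    ultimately show ?thesis by linarith
  qed
  have dE: "expectation (?d k) = expectation (\<lambda>w. X (real (Suc k) / real N) w * indicator {p<..q} (X (real (Suc k) / real N) w)) / real (Suc k)" for k
  proof -
    have "expectation (\<lambda>w. (run_max (\<lambda>i. incr N w i) (Suc k) - run_max (\<lambda>i. incr N w i) k)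
            * indicator {p<..q} (run_max (\<lambda>i. incr N w i) (Suc k)))
     = expectation (\<lambda>w. partial_sum (\<lambda>i. incr N w i) (Suc k) * indicator {p<..q} (partial_sum (\<lambda>i. incr N w i) (Suc k))) / real (Suc k)"
      by (rule record_increment_expectation[where Y="\<lambda>i w. incr N w i" and \<mu>="distr M borel (X (1 / real N))"])
         (use incr_indep[OF N] incr_distr[OF N] pq in \<open>auto simp: incr_def simp del: of_nat_Suc\<close>)
    then show ?thesis by (simp only: partial_sum_incr)
  qed
  have Ji: "integrable M (\<lambda>w. 2 * \<eta> + q * ?J w)"
    by (intro Bochner_Integration.integrable_add integrable_const integrable_mult_right Bochner_Integration.integrable_sum
        integrable_real_indicator) (auto simp: emeasure_eq_measure)
  have EJ: "expectation (\<lambda>w. 2 * \<eta> + q * ?J w) = 2 * \<eta> + q * (real b * ?p)"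
  proof -
    have p: "prob {w \<in> space M. \<eta> < incr N w i} = ?p" for i
    proof -
      have "prob {w \<in> space M. \<eta> < incr N w i} = measure (distr M borel (\<lambda>w. incr N w i)) {\<eta><..}"
        by (subst measure_distr) (auto intro!: arg_cong[where f=prob])
      also have "distr M borel (\<lambda>w. incr N w i) = distr M borel (X (1 / real N))"
        unfolding incr_def by (rule incr_distr[OF N])
      also have "measure (distr M borel (X (1 / real N))) {\<eta><..} = ?p"
        by (subst measure_distr) (auto intro!: rv_X arg_cong[where f=prob])
      finally show ?thesis .
    qed
    have "expectation ?J = (\<Sum>i<b. expectation (indicator {w \<in> space M. \<eta> < incr N w i}))"
      by (rule Bochner_Integration.integral_sum) (auto intro!: integrable_real_indicator simp: emeasure_eq_measure)
    also have "\<dots> = (\<Sum>i<b. prob {w \<in> space M. \<eta> < incr N w i})"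
      by (intro sum.cong refl) simp
    also have "\<dots> = real b * ?p" unfolding p by simp
    finally have E: "expectation ?J = real b * ?p" .
    have "integrable M ?J"
      by (intro Bochner_Integration.integrable_sum integrable_real_indicator) (auto simp: emeasure_eq_measure)
    then show ?thesis using E prob_space by simp
  qed
  have Wi: "integrable M ?W"
    by (intro Bochner_Integration.integrable_diff Bochner_Integration.integrable_sum di ci)
  have "expectation ?W = (\<Sum>k=a..<b. expectation (?d k)) - (expectation (?c b) - expectation (?c a))"
  proof -
    have "expectation (\<lambda>w. \<Sum>k=a..<b. ?d k w) = (\<Sum>k=a..<b. expectation (?d k))"
      by (rule Bochner_Integration.integral_sum) (rule di)
    moreover have "integrable M (\<lambda>w. \<Sum>k=a..<b. ?d k w)"
      by (intro Bochner_Integration.integrable_sum di)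
    ultimately show ?thesis
      using ci[of a] ci[of b] by (simp only: Bochner_Integration.integral_diff Bochner_Integration.integrable_diff)
  qed
  then have "\<bar>(\<Sum>k=a..<b. expectation (?d k)) - (expectation (?c b) - expectation (?c a))\<bar> = \<bar>expectation ?W\<bar>"
    by simp
  also have "\<dots> \<le> expectation (\<lambda>w. \<bar>?W w\<bar>)" by (rule integral_abs_bound)
  also have "\<dots> \<le> expectation (\<lambda>w. 2 * \<eta> + q * ?J w)"
    by (rule integral_mono[OF integrable_abs[OF Wi] Ji pw])
  finally show ?thesis unfolding EJ dE .
qed

end

context kolmogorov_measure
begin

definition density_bound :: "real \<Rightarrow> real" where
  "density_bound s = (LBINT u. exp (s * Re (psi u))) / (2 * pi)"

lemma time_density_bound:
  assumes "0 < s" "s \<le> t" shows "\<bar>time_density t x\<bar> \<le> density_bound s"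
proof -
  have "\<bar>time_density t x\<bar> \<le> cmod (CLBINT u. iexp (- (u * x)) * exp (of_real t * psi u)) / (2 * pi)"
    unfolding time_density_def inverse_char_def abs_divide using abs_Re_le_cmod by (simp add: divide_right_mono)
  also have "\<dots> \<le> (LBINT u. cmod (iexp (- (u * x)) * exp (of_real t * psi u))) / (2 * pi)"
    by (intro divide_right_mono integral_norm_bound) simp
  also have "\<dots> \<le> (LBINT u. exp (s * Re (psi u))) / (2 * pi)"
  proof (intro divide_right_mono integral_mono)
    have n: "cmod (iexp (- (u * x)) * exp (of_real t * psi u)) = exp (t * Re (psi u))" for u
      unfolding norm_mult norm_exp_i_times norm_exp_psi by simp
    show "integrable lborel (\<lambda>u. cmod (iexp (- (u * x)) * exp (of_real t * psi u)))"
      unfolding n by (rule integrable_exp_psi_real(1)) (use assms in simp)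
    show "integrable lborel (\<lambda>u. exp (s * Re (psi u)))" by (rule integrable_exp_psi_real(1)) (rule assms)
    show "cmod (iexp (- (u * x)) * exp (of_real t * psi u)) \<le> exp (s * Re (psi u))" for u
      using norm_exp_psi_antimono[OF assms(2), of u] unfolding norm_mult norm_exp_i_times by simp
  qed simp
  finally show ?thesis by (simp add: density_bound_def)
qed

lemma density_bound_nonneg: "0 < s \<Longrightarrow> 0 \<le> density_bound s"
  using time_density_bound[of s s 0] by linarith

end

context spectrally_negative_process
begin

lemma time_density_grid_nonneg:
  assumes "0 < N" "0 < k" shows "0 \<le> K.time_density (real k / real N) x"
  by (rule K.time_density_nonneg[OF real_distribution_X char_grid]) (use assms in auto)

lemma local_expectation_approx:
  assumes N: "0 < N" and s: "0 < s" "s \<le> real k / real N" and pq: "0 \<le> p" "p \<le> q" "q \<le> p + 1"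
  shows "\<bar>expectation (\<lambda>w. X (real k / real N) w * indicator {p<..q} (X (real k / real N) w))
     - (q - p) * (p * K.time_density (real k / real N) p)\<bar> \<le> (K.density_bound s + (1 + p) * K.density_lipschitz s) * (q - p)\<^sup>2"
proof -
  let ?X = "X (real k / real N)"
  define d where "d = q - p"
  have d: "0 \<le> d" "d \<le> 1" using pq by (auto simp: d_def)
  define \<mu> where "\<mu> = measure (distr M borel ?X) {p<..q}"
  define f where "f = K.time_density (real k / real N) p"
  define L where "L = K.density_lipschitz s"
  define B where "B = K.density_bound s"
  have L: "0 \<le> L" unfolding L_def by (rule K.density_lipschitz_nonneg)
  have B: "\<bar>f\<bar> \<le> B" unfolding f_def B_def by (rule K.time_density_bound[OF s])
  have a: "\<bar>\<mu> - d * f\<bar> \<le> L * d\<^sup>2"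
    unfolding \<mu>_def f_def d_def L_def
    by (rule K.time_density_approx[OF real_distribution_X char_grid s pq(2)]) (use N in auto)
  have ii: "integrable M (\<lambda>w. indicator {p<..q} (?X w) :: real)"
    by (rule integrable_const_bound[of _ 1]) auto
  have iX: "integrable M (\<lambda>w. ?X w * indicator {p<..q} (?X w))"
    by (rule integrable_const_bound[of _ q]) (use pq in \<open>auto split: split_indicator\<close>)
  have m: "expectation (\<lambda>w. indicator {p<..q} (?X w)) = \<mu>"
  proof -
    have "\<mu> = (LINT x|distr M borel ?X. indicator {p<..q} x)" by (simp add: \<mu>_def)
    also have "\<dots> = expectation (\<lambda>w. indicator {p<..q} (?X w))" by (rule integral_distr) auto
    finally show ?thesis by simp
  qed
  have "p * \<mu> = expectation (\<lambda>w. p * indicator {p<..q} (?X w))" using ii by (simp add: m)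
  also have "\<dots> \<le> expectation (\<lambda>w. ?X w * indicator {p<..q} (?X w))"
    by (rule integral_mono[OF integrable_mult_right[OF ii] iX]) (auto split: split_indicator)
  finally have lo: "p * \<mu> \<le> expectation (\<lambda>w. ?X w * indicator {p<..q} (?X w))" .
  have "expectation (\<lambda>w. ?X w * indicator {p<..q} (?X w)) \<le> expectation (\<lambda>w. q * indicator {p<..q} (?X w))"
    by (rule integral_mono[OF iX integrable_mult_right[OF ii]]) (auto split: split_indicator)
  also have "\<dots> = p * \<mu> + d * \<mu>" using ii by (simp add: m d_def algebra_simps)
  finally have hi: "expectation (\<lambda>w. ?X w * indicator {p<..q} (?X w)) \<le> p * \<mu> + d * \<mu>" .
  have "d * \<mu> \<le> d * (d * f + L * d\<^sup>2)" using a d by (intro mult_left_mono) auto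
  also have "\<dots> = (f + L * d) * d\<^sup>2" by (simp add: power2_eq_square algebra_simps)
  also have "\<dots> \<le> (B + L * 1) * d\<^sup>2"
    using B d L by (intro mult_right_mono add_mono mult_left_mono) auto
  finally have 1: "d * \<mu> \<le> (B + L) * d\<^sup>2" by simp
  have "\<bar>p * \<mu> - d * (p * f)\<bar> = p * \<bar>\<mu> - d * f\<bar>"
  proof -
    have "p * \<mu> - d * (p * f) = p * (\<mu> - d * f)" by (simp add: algebra_simps)
    then show ?thesis using pq(1) by (simp only: abs_mult abs_of_nonneg)
  qed
  also have "\<dots> \<le> p * (L * d\<^sup>2)" using a pq by (intro mult_left_mono)
  finally have 2: "\<bar>p * \<mu> - d * (p * f)\<bar> \<le> p * L * d\<^sup>2" by simp
  have "0 \<le> d * \<mu>" using d by (simp add: \<mu>_def)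
  have "\<bar>expectation (\<lambda>w. ?X w * indicator {p<..q} (?X w)) - d * (p * f)\<bar> \<le> (B + L) * d\<^sup>2 + p * L * d\<^sup>2"
    using lo hi 1 2 by linarith
  also have "\<dots> = (B + (1 + p) * L) * d\<^sup>2" by (simp add: algebra_simps)
  finally show ?thesis by (simp only: d_def f_def B_def L_def)
qed

definition passed :: "real \<Rightarrow> real \<Rightarrow> 'a set" where
  "passed t x = {w \<in> space M. \<exists>k n. real k / 2 ^ n \<le> t \<and> x < X (real k / 2 ^ n) w}"

lemma passed_measurable [measurable]: "passed t x \<in> events"
proof -
  have [measurable]: "(\<lambda>w. X (real k / 2 ^ n) w) \<in> borel_measurable M" for k n :: nat
    by (rule rv_X) simp
  show ?thesis unfolding passed_def by measurable
qed

lemma passed_grid_tendsto: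
  "(\<lambda>n. prob {w \<in> space M. x < run_max (incr (2 ^ (m + n)) w) (j * 2 ^ n)}) \<longlonglongrightarrow> prob (passed (real j / 2 ^ m) x)"
proof -
  let ?E = "\<lambda>n. {w \<in> space M. x < run_max (incr (2 ^ (m + n)) w) (j * 2 ^ n)}"
  have E: "w \<in> ?E n \<longleftrightarrow> w \<in> space M \<and> (\<exists>k\<le>j * 2 ^ n. x < X (real k / 2 ^ (m + n)) w)" for n w
    by (simp add: less_run_max_iff partial_sum_incr)
  have "incseq ?E"
  proof (rule incseq_SucI, rule subsetI)
    fix n w assume "w \<in> ?E n"
    then obtain k where k: "w \<in> space M" "k \<le> j * 2 ^ n" "x < X (real k / 2 ^ (m + n)) w"
      unfolding E by blast
    have "real k / 2 ^ (m + n) = real (2 * k) / 2 ^ (m + Suc n)" by simp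
    then show "w \<in> ?E (Suc n)" unfolding E using k by (intro conjI exI[of _ "2 * k"]) (auto simp only: power_Suc mult_le_mono2)
  qed
  moreover have "range ?E \<subseteq> events" by auto
  ultimately have "(\<lambda>n. prob (?E n)) \<longlonglongrightarrow> prob (\<Union>n. ?E n)"
    by (intro finite_Lim_measure_incseq)
  moreover have "(\<Union>n. ?E n) = passed (real j / 2 ^ m) x"
  proof (intro set_eqI iffI)
    fix w assume "w \<in> (\<Union>n. ?E n)"
    then obtain n where "w \<in> ?E n" by blast
    then obtain k where k: "w \<in> space M" "k \<le> j * 2 ^ n" "x < X (real k / 2 ^ (m + n)) w"
      unfolding E by blast
    have "real k \<le> real (j * 2 ^ n)" using k(2) by (simp only: of_nat_le_iff)
    then have "real k / 2 ^ (m + n) \<le> real j / 2 ^ m" by (simp add: power_add field_simps)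
    then show "w \<in> passed (real j / 2 ^ m) x" unfolding passed_def using k by blast
  next
    fix w assume "w \<in> passed (real j / 2 ^ m) x"
    then obtain k n where k: "w \<in> space M" "real k / 2 ^ n \<le> real j / 2 ^ m" "x < X (real k / 2 ^ n) w"
      unfolding passed_def by blast
    have "real (k * 2 ^ m) \<le> real (j * 2 ^ n)" using k(2) by (simp add: field_simps)
    then have "k * 2 ^ m \<le> j * 2 ^ n" by (simp only: of_nat_le_iff)
    moreover have "real k / 2 ^ n = real (k * 2 ^ m) / 2 ^ (m + n)" by (simp add: power_add)
    ultimately have "w \<in> ?E n" unfolding E using k by (intro conjI exI[of _ "k * 2 ^ m"]) (auto simp only:)
    then show "w \<in> (\<Union>n. ?E n)" by blast
  qed
  ultimately show ?thesis by simp
qed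

lemma passed_antimono: "x \<le> y \<Longrightarrow> passed t y \<subseteq> passed t x"
  unfolding passed_def by (blast intro: order_le_less_trans)

lemma passed_right_continuous:
  "(\<lambda>n. prob (passed t (x + 1 / real (Suc n)))) \<longlonglongrightarrow> prob (passed t x)"
proof -
  let ?E = "\<lambda>n. passed t (x + 1 / real (Suc n))"
  have "incseq ?E"
  proof (rule incseq_SucI)
    fix n
    have "1 / real (Suc (Suc n)) \<le> 1 / real (Suc n)" by (simp add: frac_le)
    then show "?E n \<subseteq> ?E (Suc n)" by (intro passed_antimono add_left_mono)
  qed
  moreover have "range ?E \<subseteq> events" by auto
  ultimately have "(\<lambda>n. prob (?E n)) \<longlonglongrightarrow> prob (\<Union>n. ?E n)"
    by (intro finite_Lim_measure_incseq)
  moreover have "(\<Union>n. ?E n) = passed t x"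
  proof (intro set_eqI iffI)
    fix w assume "w \<in> (\<Union>n. ?E n)"
    then obtain n k l where w: "w \<in> space M" "real k / 2 ^ l \<le> t" "x + 1 / real (Suc n) < X (real k / 2 ^ l) w"
      unfolding passed_def by blast
    have "x < x + 1 / real (Suc n)" by simp
    with w(3) have "x < X (real k / 2 ^ l) w" by linarith
    with w show "w \<in> passed t x" unfolding passed_def by blast
  next
    fix w assume "w \<in> passed t x"
    then obtain k l where w: "w \<in> space M" "real k / 2 ^ l \<le> t" "x < X (real k / 2 ^ l) w"
      unfolding passed_def by blast
    obtain n where "inverse (real (Suc n)) < X (real k / 2 ^ l) w - x" using reals_Archimedean[of "X (real k / 2 ^ l) w - x"] w by auto
    then have "x + 1 / real (Suc n) < X (real k / 2 ^ l) w" by (simp add: inverse_eq_divide)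
    then have "w \<in> ?E n" unfolding passed_def using w by blast
    then show "w \<in> (\<Union>n. ?E n)" by blast
  qed
  ultimately show ?thesis by simp
qed

lemma continuous_on_kendall_density:
  assumes "0 < s" shows "continuous_on {s..t} (\<lambda>u. b / u * K.time_density u b)"
  using assms by (auto intro!: continuous_at_imp_continuous_on continuous_intros K.isCont_time_density)

text \<open>
  Since \<open>E[clamp p q R]\<close> lies between \<open>p + (q - p) P(R > q)\<close> and \<open>p + (q - p) P(R > p)\<close>, passage
  probabilities can be compared directly with the Riemann sums, after division by \<open>q - p\<close>. The
  constant \<open>C\<close> collects the local expansion of the law of \<open>X\<^sub>u\<close> for \<open>u \<ge> s\<close>, times a bound for the
  sum of \<open>1 / k\<close> over the grid indices between \<open>s\<close> and \<open>t\<close>.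
\<close>

lemma kendall_sandwich:
  fixes i j m :: nat
  assumes ij: "0 < i" "i \<le> j" and pq: "0 \<le> p" "p < q" "q \<le> p + 1"
  defines "s \<equiv> real i / 2 ^ m" and "t \<equiv> real j / 2 ^ m"
  defines "C \<equiv> (K.density_bound s + (1 + p) * K.density_lipschitz s) * (real (j - i) / real i)"
  defines "I \<equiv> integral {s..t} (\<lambda>u. p / u * K.time_density u p)"
  shows "prob (passed t q) - prob (passed s p) \<le> I + C * (q - p)"
    and "I - C * (q - p) \<le> prob (passed t p) - prob (passed s q)"
proof -
  define N :: "nat \<Rightarrow> nat" where "N n = 2 ^ (m + n)" for n
  have N: "0 < N n" "real (N n) = 2 ^ (m + n)" for n by (auto simp: N_def)
  define u where "u n l x = prob {w \<in> space M. x < run_max (incr (N n) w) (l * 2 ^ n)}" for n l x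
  have s0: "0 < s" using ij by (simp add: s_def)
  have ulim: "(\<lambda>n. u n l x) \<longlonglongrightarrow> prob (passed (real l / 2 ^ m) x)" for l x
    unfolding u_def N_def by (rule passed_grid_tendsto)
  define E where "E n k = expectation (\<lambda>w. X (real (Suc k) / real (N n)) w * indicator {p<..q} (X (real (Suc k) / real (N n)) w))" for n k
  define D where "D n = expectation (\<lambda>w. clamp p q (run_max (incr (N n) w) (j * 2 ^ n))) - expectation (\<lambda>w. clamp p q (run_max (incr (N n) w) (i * 2 ^ n)))" for n
  define f where "f u = p / u * K.time_density u p" for u
  define \<rho> where "\<rho> n = (\<Sum>k=i*2^n..<j*2^n. f (real (Suc k) / 2 ^ (m + n)) / 2 ^ (m + n))" for n
  define J where "J \<eta> n = real (N n) * prob {w \<in> space M. \<eta> < X (1 / real (N n)) w}" for \<eta> n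
  define c where "c = K.density_bound s + (1 + p) * K.density_lipschitz s"
  have c: "0 \<le> c" unfolding c_def using K.density_bound_nonneg[OF s0] K.density_lipschitz_nonneg pq by simp
  have iij: "i * 2 ^ n \<le> j * 2 ^ n" for n using ij by simp
  have rlim: "\<rho> \<longlonglongrightarrow> I"
    unfolding \<rho>_def I_def s_def t_def f_def
    by (rule dyadic_riemann_sums[OF _ ij(2)], rule continuous_on_kendall_density) (use ij in simp)
  have Jlim: "J \<eta> \<longlonglongrightarrow> 0" if "0 < \<eta>" for \<eta>
    unfolding J_def N_def by (rule jump_rate_tendsto_0[OF that])
  let ?E = "\<lambda>n. \<Sum>k=i*2^n..<j*2^n. E n k / real (Suc k)"
  let ?f = "\<lambda>n k. f (real (Suc k) / 2 ^ (m + n)) / 2 ^ (m + n)"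
  let ?err = "\<lambda>n k. \<bar>E n k / real (Suc k) - (q - p) * ?f n k\<bar>"
  have est1: "\<bar>?E n - D n\<bar> \<le> 2 * \<eta> + q * (real j * J \<eta> n)" if "0 < \<eta>" for \<eta> n
  proof -
    have "\<bar>?E n - D n\<bar>
       \<le> 2 * \<eta> + q * (real (j * 2 ^ n) * prob {w \<in> space M. \<eta> < X (1 / real (N n)) w})"
      unfolding E_def D_def by (rule clamp_record_estimate[OF N(1) pq(1) _ _ iij]) (use pq that in auto)
    also have "\<dots> \<le> 2 * \<eta> + q * (real (j * N n) * prob {w \<in> space M. \<eta> < X (1 / real (N n)) w})"
    proof (intro add_left_mono mult_left_mono mult_right_mono)
      have "(2::nat) ^ n \<le> N n" unfolding N_def by (intro power_increasing) auto
      then show "real (j * 2 ^ n) \<le> real (j * N n)" by (simp only: of_nat_le_iff mult_le_mono2)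
    qed (use pq in auto)
    finally show ?thesis by (simp add: J_def mult.assoc)
  qed
  \<comment> \<open>The local expansion of each law costs \<open>(q - p)\<^sup>2\<close>, one order more than the main term.\<close>
  have est2: "\<bar>?E n - (q - p) * \<rho> n\<bar> \<le> C * (q - p)\<^sup>2" for n
  proof -
    have trm: "?err n k \<le> c * (q - p)\<^sup>2 / real (i * 2 ^ n)"
      if k: "k \<in> {i*2^n..<j*2^n}" for k
    proof -
      define v where "v = real (Suc k) / real (N n)"
      have fe: "f (real (Suc k) / 2 ^ (m + n)) / 2 ^ (m + n) = p * K.time_density v p / real (Suc k)"
      proof -
        have "p / (a / c) * y / c = p * y / a" if "0 < c" for a c y :: real using that by simp
        then show ?thesis unfolding f_def v_def N(2) by (simp del: of_nat_Suc)
      qed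
      have "real (i * 2 ^ n) \<le> real (Suc k)" using k by (simp only: of_nat_le_iff) simp
      then have sv: "s \<le> v" unfolding v_def s_def N(2) by (simp add: power_add field_simps)
      have "?err n k
          = \<bar>E n k - (q - p) * (p * K.time_density v p)\<bar> / real (Suc k)"
        unfolding fe by (simp add: diff_divide_distrib[symmetric] del: of_nat_Suc)
      also have "\<dots> \<le> (c * (q - p)\<^sup>2) / real (Suc k)"
        using local_expectation_approx[OF N(1) s0 sv[unfolded v_def] pq(1) less_imp_le[OF pq(2)] pq(3)]
        unfolding E_def v_def c_def by (intro divide_right_mono) auto
      also have "\<dots> \<le> (c * (q - p)\<^sup>2) / real (i * 2 ^ n)"
        using \<open>real (i * 2 ^ n) \<le> real (Suc k)\<close> c ij by (intro divide_left_mono) auto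
      finally show ?thesis .
    qed
    have "\<bar>?E n - (q - p) * \<rho> n\<bar>
       = \<bar>\<Sum>k=i*2^n..<j*2^n. E n k / real (Suc k) - (q - p) * ?f n k\<bar>"
      unfolding \<rho>_def sum_distrib_left by (simp only: sum_subtractf)
    also have "\<dots> \<le> (\<Sum>k=i*2^n..<j*2^n. ?err n k)"
      by (rule sum_abs)
    also have "\<dots> \<le> (\<Sum>k=i*2^n..<j*2^n. c * (q - p)\<^sup>2 / real (i * 2 ^ n))"
      by (rule sum_mono) (rule trm)
    also have "\<dots> = C * (q - p)\<^sup>2"
    proof -
      have "j * 2 ^ n - i * 2 ^ n = (j - i) * 2 ^ n" by (simp add: diff_mult_distrib)
      then show ?thesis using ij by (simp add: C_def c_def)
    qed
    finally show ?thesis .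
  qed
  have ce: "integrable M (\<lambda>w. clamp p q (run_max (incr (N n) w) l))" for n l
  proof (rule integrable_const_bound)
    show "AE w in M. norm (clamp p q (run_max (incr (N n) w) l)) \<le> q" using pq by (auto simp: clamp_def)
    show "(\<lambda>w. clamp p q (run_max (incr (N n) w) l)) \<in> borel_measurable M" unfolding clamp_def by measurable
  qed
  have ind: "expectation (\<lambda>w. p + (q - p) * indicator {x<..} (run_max (incr (N n) w) (l * 2 ^ n))) = p + (q - p) * u n l x"
    and indi: "integrable M (\<lambda>w. p + (q - p) * indicator {x<..} (run_max (incr (N n) w) (l * 2 ^ n)))" for n l x
  proof -
    have i: "integrable M (\<lambda>w. indicator {x<..} (run_max (incr (N n) w) (l * 2 ^ n)) :: real)"
      by (rule integrable_const_bound[of _ 1]) auto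
    then show "integrable M (\<lambda>w. p + (q - p) * indicator {x<..} (run_max (incr (N n) w) (l * 2 ^ n)))" by simp
    have "expectation (\<lambda>w. indicator {x<..} (run_max (incr (N n) w) (l * 2 ^ n)))
        = expectation (indicator {w \<in> space M. x < run_max (incr (N n) w) (l * 2 ^ n)})"
      by (intro Bochner_Integration.integral_cong) (auto split: split_indicator)
    also have "\<dots> = u n l x" unfolding u_def by simp
    finally show "expectation (\<lambda>w. p + (q - p) * indicator {x<..} (run_max (incr (N n) w) (l * 2 ^ n))) = p + (q - p) * u n l x"
      using i prob_space by simp
  qed
  have lo: "p + (q - p) * u n l q \<le> expectation (\<lambda>w. clamp p q (run_max (incr (N n) w) (l * 2 ^ n)))" for n l
    unfolding ind[symmetric] by (rule integral_mono[OF indi ce]) (use clamp_bounds(1) pq in auto)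
  have hi: "expectation (\<lambda>w. clamp p q (run_max (incr (N n) w) (l * 2 ^ n))) \<le> p + (q - p) * u n l p" for n l
    unfolding ind[symmetric] by (rule integral_mono[OF ce indi]) (use clamp_bounds(2) pq in auto)
  define d where "d = q - p"
  have d: "0 < d" using pq by (simp add: d_def)
  have ub: "d * (u n j q - u n i p) \<le> d * \<rho> n + C * d\<^sup>2 + (2 * \<eta> + q * (real j * J \<eta> n))" if "0 < \<eta>" for \<eta> n
  proof -
    have "d * (u n j q - u n i p) \<le> D n"
      unfolding right_diff_distrib D_def d_def using lo[of n j] hi[of n i] by linarith
    then show ?thesis using est1[OF that, of n] est2[of n] unfolding d_def by linarith
  qed
  have lb: "d * \<rho> n - C * d\<^sup>2 - (2 * \<eta> + q * (real j * J \<eta> n)) \<le> d * (u n j p - u n i q)" if "0 < \<eta>" for \<eta> n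
  proof -
    have "D n \<le> d * (u n j p - u n i q)"
      unfolding right_diff_distrib D_def d_def using lo[of n i] hi[of n j] by linarith
    then show ?thesis using est1[OF that, of n] est2[of n] unfolding d_def by linarith
  qed
  have up: "d * (prob (passed t q) - prob (passed s p)) \<le> d * I + C * d\<^sup>2 + 2 * \<eta>" if e: "0 < \<eta>" for \<eta>
  proof (rule LIMSEQ_le)
    let ?U = "\<lambda>n. d * \<rho> n + C * d\<^sup>2 + (2 * \<eta> + q * (real j * J \<eta> n))"
    show "(\<lambda>n. d * (u n j q - u n i p)) \<longlonglongrightarrow> d * (prob (passed t q) - prob (passed s p))"
      unfolding s_def t_def by (intro tendsto_intros ulim)
    have "(\<lambda>n. ?U n) \<longlonglongrightarrow> d * I + C * d\<^sup>2 + (2 * \<eta> + q * (real j * 0))"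
      by (intro tendsto_intros rlim Jlim[OF e])
    then show "(\<lambda>n. ?U n) \<longlonglongrightarrow> d * I + C * d\<^sup>2 + 2 * \<eta>" by simp
    show "\<exists>n0. \<forall>n\<ge>n0. d * (u n j q - u n i p) \<le> ?U n"
      using ub[OF e] by blast
  qed
  have low: "d * I - C * d\<^sup>2 - 2 * \<eta> \<le> d * (prob (passed t p) - prob (passed s q))" if e: "0 < \<eta>" for \<eta>
  proof (rule LIMSEQ_le)
    let ?L = "\<lambda>n. d * \<rho> n - C * d\<^sup>2 - (2 * \<eta> + q * (real j * J \<eta> n))"
    show "(\<lambda>n. d * (u n j p - u n i q)) \<longlonglongrightarrow> d * (prob (passed t p) - prob (passed s q))"
      unfolding s_def t_def by (intro tendsto_intros ulim)
    have "(\<lambda>n. ?L n) \<longlonglongrightarrow> d * I - C * d\<^sup>2 - (2 * \<eta> + q * (real j * 0))"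
      by (intro tendsto_intros rlim Jlim[OF e])
    then show "(\<lambda>n. ?L n) \<longlonglongrightarrow> d * I - C * d\<^sup>2 - 2 * \<eta>" by simp
    show "\<exists>n0. \<forall>n\<ge>n0. ?L n \<le> d * (u n j p - u n i q)"
      using lb[OF e] by blast
  qed
  have "d * (prob (passed t q) - prob (passed s p)) \<le> d * I + C * d\<^sup>2"
  proof (rule field_le_epsilon)
    fix e :: real assume "0 < e"
    then show "d * (prob (passed t q) - prob (passed s p)) \<le> d * I + C * d\<^sup>2 + e" using up[of "e / 2"] by simp
  qed
  also have "\<dots> = d * (I + C * d)" by (simp add: power2_eq_square algebra_simps)
  finally show "prob (passed t q) - prob (passed s p) \<le> I + C * (q - p)"
    using d unfolding d_def by (subst (asm) mult_le_cancel_left_pos) auto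
  have "d * (I - C * d) = d * I - C * d\<^sup>2" by (simp add: power2_eq_square algebra_simps)
  also have "\<dots> \<le> d * (prob (passed t p) - prob (passed s q))"
  proof (rule field_le_epsilon)
    fix e :: real assume "0 < e"
    then show "d * I - C * d\<^sup>2 \<le> d * (prob (passed t p) - prob (passed s q)) + e" using low[of "e / 2"] by simp
  qed
  finally show "I - C * (q - p) \<le> prob (passed t p) - prob (passed s q)"
    using d unfolding d_def by (subst (asm) mult_le_cancel_left_pos) auto
qed

text \<open>
  Both sides of \<open>kendall_sandwich\<close> are evaluated at \<open>p = b\<close> in the limit \<open>q \<rightarrow> b\<close> from above. The
  probability of passing above \<open>q\<close> is right-continuous in \<open>q\<close>, so \<open>b\<close> itself is reached.
\<close>

theorem kendall_identity:
  fixes i j m :: nat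
  assumes ij: "0 < i" "i \<le> j" and b: "0 \<le> b"
  shows "prob (passed (real j / 2 ^ m) b) - prob (passed (real i / 2 ^ m) b)
    = integral {real i / 2 ^ m..real j / 2 ^ m} (\<lambda>u. b / u * K.time_density u b)"
proof -
  define s where "s = real i / 2 ^ m"
  define t where "t = real j / 2 ^ m"
  define C where "C = (K.density_bound s + (1 + b) * K.density_lipschitz s) * (real (j - i) / real i)"
  define I where "I = integral {s..t} (\<lambda>u. b / u * K.time_density u b)"
  let ?q = "\<lambda>n. b + 1 / real (Suc n)"
  have q: "b < ?q n" "?q n \<le> b + 1" for n by auto
  note S = kendall_sandwich[OF ij b q, where m=m, folded s_def t_def, folded C_def I_def]
  have z: "(\<lambda>n. 1 / real (Suc n)) \<longlonglongrightarrow> 0" using LIMSEQ_Suc[OF lim_1_over_n] .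
  have "prob (passed t b) - prob (passed s b) \<le> I + C * 0"
  proof (rule LIMSEQ_le)
    show "(\<lambda>n. prob (passed t (?q n)) - prob (passed s b)) \<longlonglongrightarrow> prob (passed t b) - prob (passed s b)"
      by (intro tendsto_intros passed_right_continuous)
    show "(\<lambda>n. I + C * (1 / real (Suc n))) \<longlonglongrightarrow> I + C * 0" by (intro tendsto_intros z)
    show "\<exists>n0. \<forall>n\<ge>n0. prob (passed t (?q n)) - prob (passed s b) \<le> I + C * (1 / real (Suc n))"
      using S(1) by (simp del: of_nat_Suc)
  qed
  moreover have "I - C * 0 \<le> prob (passed t b) - prob (passed s b)"
  proof (rule LIMSEQ_le)
    show "(\<lambda>n. prob (passed t b) - prob (passed s (?q n))) \<longlonglongrightarrow> prob (passed t b) - prob (passed s b)"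
      by (intro tendsto_intros passed_right_continuous)
    show "(\<lambda>n. I - C * (1 / real (Suc n))) \<longlonglongrightarrow> I - C * 0" by (intro tendsto_intros z)
    show "\<exists>n0. \<forall>n\<ge>n0. I - C * (1 / real (Suc n)) \<le> prob (passed t b) - prob (passed s (?q n))"
      using S(2) by (simp del: of_nat_Suc)
  qed
  ultimately show ?thesis unfolding s_def t_def I_def by simp
qed

end

section \<open>The law of the first passage time\<close>

context spectrally_negative_process
begin

definition hitting :: "real \<Rightarrow> 'a \<Rightarrow> ereal" where
  "hitting b w = (INF (k, n). if b < X (real k / 2 ^ n) w then ereal (real k / 2 ^ n) else \<infinity>)"

definition kendall_density :: "real \<Rightarrow> real \<Rightarrow> real" where
  "kendall_density b t = (if 0 < t then b / t * K.time_density t b else 0)"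

lemma hitting_measurable [measurable]: "hitting b \<in> borel_measurable M"
proof -
  have [measurable]: "(\<lambda>w. X (real k / 2 ^ n) w) \<in> borel_measurable M" for k n :: nat
    by (rule rv_X) simp
  show ?thesis unfolding hitting_def by (rule borel_measurable_INF) (auto split: prod.split)
qed

lemma hitting_less_iff: "hitting b w < ereal t \<longleftrightarrow> (\<exists>k n. real k / 2 ^ n < t \<and> b < X (real k / 2 ^ n) w)"
  unfolding hitting_def INF_less_iff by (auto split: if_splits)

lemma hitting_less_imp_passed: "w \<in> space M \<Longrightarrow> hitting b w < ereal t \<Longrightarrow> w \<in> passed t b"
  unfolding hitting_less_iff passed_def by (auto intro: less_imp_le)

lemma passed_imp_hitting_le: "w \<in> passed t b \<Longrightarrow> hitting b w \<le> ereal t"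
proof -
  assume "w \<in> passed t b"
  then obtain k n where kn: "real k / 2 ^ n \<le> t" "b < X (real k / 2 ^ n) w"
    unfolding passed_def by blast
  have "hitting b w \<le> (case (k, n) of (k, n) \<Rightarrow> if b < X (real k / 2 ^ n) w then ereal (real k / 2 ^ n) else \<infinity>)"
    unfolding hitting_def by (rule INF_lower) simp
  then show ?thesis using kn by (simp add: order_trans)
qed

lemma kendall_density_nonneg_grid: "0 \<le> b \<Longrightarrow> 0 < N \<Longrightarrow> 0 < k \<Longrightarrow> 0 \<le> kendall_density b (real k / real N)"
  unfolding kendall_density_def using time_density_grid_nonneg[of N k b] by simp

text \<open>
  Adding \<open>1\<close> to the floor keeps the dyadic approximation strictly above \<open>t\<close>. Strictness is needed to sandwich
  \<open>passed\<close> between the events that the hitting time is \<open>< t\<close> and \<open>\<le> t\<close>.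
\<close>

definition dyadic_above :: "real \<Rightarrow> nat \<Rightarrow> nat" where
  "dyadic_above t n = Suc (nat \<lfloor>t * 2 ^ n\<rfloor>)"

lemma dyadic_above_bounds:
  assumes "0 \<le> t"
  shows "t < real (dyadic_above t n) / 2 ^ n" "real (dyadic_above t n) / 2 ^ n \<le> t + (1 / 2) ^ n"
proof -
  have "0 \<le> t * 2 ^ n" using assms by simp
  then have e: "real (dyadic_above t n) = of_int \<lfloor>t * 2 ^ n\<rfloor> + 1" by (simp add: dyadic_above_def)
  have "t * 2 ^ n < real (dyadic_above t n)" unfolding e by linarith
  then show "t < real (dyadic_above t n) / 2 ^ n" by (simp add: field_simps)
  have "real (dyadic_above t n) \<le> t * 2 ^ n + 1" unfolding e by linarith
  then have "real (dyadic_above t n) / 2 ^ n \<le> (t * 2 ^ n + 1) / 2 ^ n" by (rule divide_right_mono) simp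
  then show "real (dyadic_above t n) / 2 ^ n \<le> t + (1 / 2) ^ n" by (simp add: add_divide_distrib power_one_over)
qed

lemma dyadic_above_tendsto:
  assumes "0 \<le> t" shows "(\<lambda>n. real (dyadic_above t n) / 2 ^ n) \<longlonglongrightarrow> t"
proof (rule tendsto_sandwich[OF _ _ tendsto_const])
  have "(\<lambda>n. (1 / 2 :: real) ^ n) \<longlonglongrightarrow> 0" by (rule LIMSEQ_power_zero) simp
  from tendsto_add[OF tendsto_const[of t] this] show "(\<lambda>n. t + (1 / 2) ^ n) \<longlonglongrightarrow> t" by simp
  show "\<forall>\<^sub>F n in sequentially. t \<le> real (dyadic_above t n) / 2 ^ n"
    by (intro always_eventually allI less_imp_le dyadic_above_bounds(1)[OF assms])
  show "\<forall>\<^sub>F n in sequentially. real (dyadic_above t n) / 2 ^ n \<le> t + (1 / 2) ^ n"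
    by (intro always_eventually allI dyadic_above_bounds(2)[OF assms])
qed

lemma isCont_kendall_density:
  assumes "0 < t" shows "isCont (kendall_density b) t"
proof -
  have "isCont (\<lambda>t. b / t * K.time_density t b) t"
    using assms by (intro continuous_intros K.isCont_time_density) auto
  moreover have "eventually (\<lambda>u. u \<in> {0<..}) (nhds t)"
    by (rule eventually_nhds_in_open) (use assms in auto)
  then have "eventually (\<lambda>u. kendall_density b u = b / u * K.time_density u b) (nhds t)"
    by eventually_elim (simp add: kendall_density_def)
  ultimately show ?thesis by (simp add: isCont_cong)
qed

lemma kendall_density_nonneg:
  assumes "0 \<le> b" shows "0 \<le> kendall_density b t"
proof (cases "0 < t")
  case True
  have "(\<lambda>n. kendall_density b (real (dyadic_above t n) / 2 ^ n)) \<longlonglongrightarrow> kendall_density b t"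
    by (rule isCont_tendsto_compose[OF isCont_kendall_density[OF True]]) (rule dyadic_above_tendsto, use True in simp)
  moreover have "0 \<le> kendall_density b (real (dyadic_above t n) / 2 ^ n)" for n
    using kendall_density_nonneg_grid[OF assms, of "2 ^ n" "dyadic_above t n"] by (simp add: dyadic_above_def)
  ultimately show ?thesis by (intro LIMSEQ_le_const) auto
qed (simp add: kendall_density_def)

lemma continuous_on_kendall_density': "0 < s \<Longrightarrow> continuous_on {s..t} (kendall_density b)"
  by (intro continuous_at_imp_continuous_on) (auto intro!: isCont_kendall_density)

lemma kendall_density_measurable [measurable]: "kendall_density b \<in> borel_measurable borel"
proof -
  have "continuous_on {0<..} (kendall_density b)"
    by (intro continuous_at_imp_continuous_on) (auto intro!: isCont_kendall_density)
  then have "(\<lambda>t. if t \<in> {0<..} then kendall_density b t else 0) \<in> borel_measurable borel"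
    by (intro borel_measurable_continuous_on_if) auto
  then show ?thesis by (rule subst[where P="\<lambda>f. f \<in> borel_measurable borel", rotated]) (auto simp: kendall_density_def)
qed

text \<open>
  Along times above \<open>t\<close> that converge to \<open>t\<close>, the events \<open>passed\<close> contain the event that the
  hitting time is at most \<open>t\<close>, and each other outcome leaves them eventually.
\<close>

lemma passed_above_tendsto:
  assumes "0 \<le> t"
  shows "(\<lambda>n. prob (passed (real (dyadic_above t n) / 2 ^ n) b)) \<longlonglongrightarrow> prob {w \<in> space M. hitting b w \<le> ereal t}"
proof -
  let ?d = "\<lambda>n. real (dyadic_above t n) / 2 ^ n"
  let ?P = "\<lambda>n. passed (?d n) b"
  let ?A = "{w \<in> space M. hitting b w \<le> ereal t}"
  have "(\<lambda>n. expectation (indicat_real (?P n))) \<longlonglongrightarrow> expectation (indicat_real ?A)"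
  proof (rule integral_dominated_convergence[where w="\<lambda>_. 1"])
    show "AE w in M. (\<lambda>n. indicat_real (?P n) w) \<longlonglongrightarrow> indicat_real ?A w"
    proof (rule AE_I2, rule tendsto_eventually)
      fix w assume w: "w \<in> space M"
      show "\<forall>\<^sub>F n in sequentially. indicat_real (?P n) w = indicat_real ?A w"
      proof (cases "hitting b w \<le> ereal t")
        case True
        have "w \<in> ?P n" for n
          using True dyadic_above_bounds(1)[OF assms, of n]
          by (intro hitting_less_imp_passed[OF w]) (auto intro: le_less_trans)
        then show ?thesis using True w by simp
      next
        case False
        then have "ereal t < hitting b w" by simp
        then obtain r where r: "t < r" "ereal r < hitting b w" using ereal_dense2 by (metis ereal_less_eq(3) less_ereal.simps(1) not_le)
        have "\<forall>\<^sub>F n in sequentially. ?d n < r"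
          by (rule order_tendstoD(2)[OF dyadic_above_tendsto[OF assms] r(1)])
        then show ?thesis
        proof eventually_elim
          case (elim n)
          have "w \<notin> ?P n"
          proof
            assume "w \<in> ?P n"
            then have "hitting b w \<le> ereal (?d n)" by (rule passed_imp_hitting_le)
            also have "\<dots> < ereal r" using elim by simp
            finally show False using r(2) by simp
          qed
          then show ?case using False by simp
        qed
      qed
    qed
  qed auto
  then show ?thesis by simp
qed

lemma hitting_distribution:
  assumes b: "0 \<le> b" and st: "0 < s" "s \<le> t"
  shows "prob {w \<in> space M. hitting b w \<le> ereal t} - prob {w \<in> space M. hitting b w \<le> ereal s}
     = integral {s..t} (kendall_density b)"
proof -
  let ?s = "\<lambda>n. real (dyadic_above s n) / 2 ^ n" and ?t = "\<lambda>n. real (dyadic_above t n) / 2 ^ n"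
  have le: "dyadic_above s n \<le> dyadic_above t n" for n
    using st by (auto simp: dyadic_above_def intro!: nat_mono floor_mono)
  have s: "s < ?s n" "?s n \<le> ?t n" for n
    using dyadic_above_bounds(1)[of s n] st le[of n] by (auto intro!: divide_right_mono)
  have int: "kendall_density b integrable_on {s..x}" for x
    using st by (intro integrable_continuous_interval continuous_on_kendall_density')
  let ?F = "\<lambda>x. integral {s..x} (kendall_density b)"
  have eq: "prob (passed (?t n) b) - prob (passed (?s n) b) = ?F (?t n) - ?F (?s n)" for n
  proof -
    have "prob (passed (?t n) b) - prob (passed (?s n) b) = integral {?s n..?t n} (\<lambda>u. b / u * K.time_density u b)"
      by (rule kendall_identity[OF _ le b]) (simp add: dyadic_above_def)
    also have "\<dots> = integral {?s n..?t n} (kendall_density b)"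
      by (rule Henstock_Kurzweil_Integration.integral_cong) (use s(1)[of n] st in \<open>auto simp: kendall_density_def\<close>)
    also have "\<dots> = ?F (?t n) - ?F (?s n)"
      using Henstock_Kurzweil_Integration.integral_combine[OF _ s(2) int, of n] s(1)[of n] by simp
    finally show ?thesis .
  qed
  have cont: "continuous_on {s..t + 1} ?F"
    by (rule indefinite_integral_continuous_1) (rule int)
  have lim: "(\<lambda>n. ?F (real (dyadic_above x n) / 2 ^ n)) \<longlonglongrightarrow> ?F x" if x: "s \<le> x" "x \<le> t" for x
  proof (rule continuous_on_tendsto_compose[OF cont dyadic_above_tendsto])
    show "0 \<le> x" "x \<in> {s..t + 1}" using st x by auto
    have "real (dyadic_above x n) / 2 ^ n \<in> {s..t + 1}" for n
    proof -
      have "(1 / 2 :: real) ^ n \<le> 1" by (rule power_le_one) auto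
      with dyadic_above_bounds[of x n] st x show ?thesis by auto
    qed
    then show "\<forall>\<^sub>F n in sequentially. real (dyadic_above x n) / 2 ^ n \<in> {s..t + 1}" by simp
  qed
  have "(\<lambda>n. prob (passed (?t n) b) - prob (passed (?s n) b)) \<longlonglongrightarrow> ?F t - ?F s"
    unfolding eq by (intro tendsto_diff lim) (use st in auto)
  moreover have "(\<lambda>n. prob (passed (?t n) b) - prob (passed (?s n) b)) \<longlonglongrightarrow>
      prob {w \<in> space M. hitting b w \<le> ereal t} - prob {w \<in> space M. hitting b w \<le> ereal s}"
    by (intro tendsto_diff passed_above_tendsto) (use st in auto)
  ultimately have "?F t - ?F s = prob {w \<in> space M. hitting b w \<le> ereal t} - prob {w \<in> space M. hitting b w \<le> ereal s}"
    by (rule LIMSEQ_unique)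
  then show ?thesis by simp
qed

lemma hitting_interval:
  assumes b: "0 \<le> b" and s: "0 < s"
  shows "emeasure M {w \<in> space M. ereal s < hitting b w \<and> hitting b w \<le> ereal t}
    = (\<integral>\<^sup>+u\<in>{s<..t}. ennreal (kendall_density b u) \<partial>lborel)"
proof (cases "s \<le> t")
  case True
  let ?A = "\<lambda>x. {w \<in> space M. hitting b w \<le> ereal x}"
  have "{w \<in> space M. ereal s < hitting b w \<and> hitting b w \<le> ereal t} = ?A t - ?A s" by auto
  moreover have "prob (?A t - ?A s) = prob (?A t) - prob (?A s)"
    using True by (intro finite_measure_Diff) (auto intro: order_trans)
  moreover have "(\<integral>\<^sup>+u\<in>{s<..t}. ennreal (kendall_density b u) \<partial>lborel) = ennreal (integral {s..t} (kendall_density b))"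
  proof -
    have "(\<integral>\<^sup>+u\<in>{s<..t}. ennreal (kendall_density b u) \<partial>lborel) = (\<integral>\<^sup>+u. ennreal (kendall_density b u) * indicator {s..t} u \<partial>lborel)"
    proof (rule nn_integral_cong_AE)
      show "AE u in lborel. ennreal (kendall_density b u) * indicator {s<..t} u = ennreal (kendall_density b u) * indicator {s..t} u"
        using AE_lborel_singleton[of s] by eventually_elim (auto split: split_indicator)
    qed
    also have "\<dots> = ennreal (integral {s..t} (kendall_density b))"
    proof (rule nn_integral_has_integral_lebesgue')
      show "(kendall_density b has_integral integral {s..t} (kendall_density b)) {s..t}"
        using s by (intro integrable_integral integrable_continuous_interval continuous_on_kendall_density')
    qed (rule kendall_density_nonneg[OF b])
    finally show ?thesis .
  qed
  ultimately show ?thesis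
    using hitting_distribution[OF b s True] by (simp add: emeasure_eq_measure)
next
  case False
  then have "{w \<in> space M. ereal s < hitting b w \<and> hitting b w \<le> ereal t} = {}"
    by (auto dest: less_le_trans)
  then have "emeasure M {w \<in> space M. ereal s < hitting b w \<and> hitting b w \<le> ereal t} = 0"
    by (simp only: emeasure_empty)
  with False show ?thesis by simp
qed

theorem hitting_has_density:
  assumes b: "0 \<le> b"
  shows "has_density_on_pos (distr M borel (hitting b)) (kendall_density b)"
proof -
  define N2 where "N2 = density lborel (\<lambda>u. ennreal (kendall_density b u))"
  define H where "H = {w \<in> space M. 0 < hitting b w \<and> hitting b w < \<infinity>}"
  have [measurable]: "H \<in> events" unfolding H_def by measurable
  define N1 where "N1 = distr (density M (indicator H)) borel (\<lambda>w. real_of_ereal (hitting b w))"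
  have N1: "emeasure N1 A = emeasure M {w \<in> H. real_of_ereal (hitting b w) \<in> A}" if [measurable]: "A \<in> sets borel" for A
  proof -
    have "emeasure N1 A = emeasure (density M (indicator H)) {w \<in> space M. real_of_ereal (hitting b w) \<in> A}"
      unfolding N1_def by (subst emeasure_distr) (auto intro!: arg_cong2[where f=emeasure])
    also have "\<dots> = (\<integral>\<^sup>+w. indicator H w * indicator {w \<in> space M. real_of_ereal (hitting b w) \<in> A} w \<partial>M)"
      by (rule emeasure_density) auto
    also have "\<dots> = (\<integral>\<^sup>+w. indicator {w \<in> H. real_of_ereal (hitting b w) \<in> A} w \<partial>M)"
      by (rule nn_integral_cong) (auto simp: H_def split: split_indicator)
    also have "\<dots> = emeasure M {w \<in> H. real_of_ereal (hitting b w) \<in> A}"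
      by (subst nn_integral_indicator) auto
    finally show ?thesis .
  qed
  have N2: "emeasure N2 A = (\<integral>\<^sup>+u\<in>A. ennreal (kendall_density b u) \<partial>lborel)" if [measurable]: "A \<in> sets borel" for A
    unfolding N2_def by (subst emeasure_density) auto
  have Hin: "{w \<in> H. real_of_ereal (hitting b w) \<in> ({s<..t}::real set)} = {w \<in> space M. ereal s < hitting b w \<and> hitting b w \<le> ereal t}"
    if "0 < s" for s t
  proof (intro set_eqI iffI)
    fix w assume "w \<in> {w \<in> H. real_of_ereal (hitting b w) \<in> ({s<..t}::real set)}"
    then show "w \<in> {w \<in> space M. ereal s < hitting b w \<and> hitting b w \<le> ereal t}"
      by (cases "hitting b w") (auto simp: H_def)
  next
    fix w assume "w \<in> {w \<in> space M. ereal s < hitting b w \<and> hitting b w \<le> ereal t}"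
    then show "w \<in> {w \<in> H. real_of_ereal (hitting b w) \<in> ({s<..t}::real set)}"
      using that by (cases "hitting b w") (auto simp: H_def)
  qed
  have eqI: "emeasure N1 {s<..t} = emeasure N2 {s<..t}" if "0 < s" for s t
    using hitting_interval[OF b that, of t] unfolding N1[OF greaterThanAtMost_borel] N2[OF greaterThanAtMost_borel] Hin[OF that] .
  have tail: "emeasure N1 {x<..} = emeasure N2 {x<..}" for x
  proof -
    let ?B = "\<lambda>n. {max x (1 / real (Suc n))<..real (Suc n)}"
    have U: "(\<Union>n. ?B n) = {max x 0<..}"
    proof (intro set_eqI iffI)
      fix y assume "y \<in> (\<Union>n. ?B n)"
      then obtain n where "max x (1 / real (Suc n)) < y" by auto
      moreover have "0 < 1 / real (Suc n)" by simp
      ultimately have "x < y" "0 < y" by linarith+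
      then show "y \<in> {max x 0<..}" by simp
    next
      fix y assume y: "y \<in> {max x 0<..}"
      then obtain n1 where n1: "inverse (real (Suc n1)) < y" using reals_Archimedean[of y] by auto
      obtain n2 :: nat where n2: "y \<le> real n2" using real_arch_simple by blast
      define n where "n = max n1 n2"
      have "1 / real (Suc n) \<le> 1 / real (Suc n1)" by (intro divide_left_mono) (auto simp: n_def)
      moreover have "real n2 \<le> real (Suc n)" by (simp add: n_def)
      ultimately have "y \<in> ?B n" using y n1 n2 by (auto simp: inverse_eq_divide simp del: of_nat_Suc)
      then show "y \<in> (\<Union>n. ?B n)" by blast
    qed
    have inc: "incseq ?B"
    proof (rule incseq_SucI)
      fix n
      have "1 / real (Suc (Suc n)) \<le> 1 / real (Suc n)" by (simp add: frac_le)
      moreover have "real (Suc n) \<le> real (Suc (Suc n))" by simp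
      ultimately show "?B n \<subseteq> ?B (Suc n)" by (auto simp del: of_nat_Suc)
    qed
    have "(SUP n. emeasure N1 (?B n)) = emeasure N1 (\<Union>n. ?B n)"
      by (rule SUP_emeasure_incseq[OF _ inc]) (auto simp: N1_def)
    moreover have "(SUP n. emeasure N2 (?B n)) = emeasure N2 (\<Union>n. ?B n)"
      by (rule SUP_emeasure_incseq[OF _ inc]) (auto simp: N2_def)
    moreover have "emeasure N1 (?B n) = emeasure N2 (?B n)" for n
      by (rule eqI) (simp add: less_max_iff_disj del: of_nat_Suc)
    ultimately have e: "emeasure N1 {max x 0<..} = emeasure N2 {max x 0<..}" unfolding U by simp
    have "{w \<in> H. real_of_ereal (hitting b w) \<in> {x<..}} = {w \<in> H. real_of_ereal (hitting b w) \<in> {max x 0<..}}"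
    proof (intro set_eqI iffI)
      fix w assume "w \<in> {w \<in> H. real_of_ereal (hitting b w) \<in> {x<..}}"
      then show "w \<in> {w \<in> H. real_of_ereal (hitting b w) \<in> {max x 0<..}}"
        by (cases "hitting b w") (auto simp: H_def)
    qed auto
    then have "emeasure N1 {x<..} = emeasure N1 {max x 0<..}" by (simp only: N1[OF greaterThan_borel])
    moreover have "emeasure N2 {x<..} = emeasure N2 {max x 0<..}"
      unfolding N2[OF greaterThan_borel] by (rule nn_integral_cong) (auto simp: kendall_density_def split: split_indicator)
    ultimately show ?thesis using e by simp
  qed
  have fin: "emeasure N1 A < \<infinity>" if "A \<in> sets borel" for A
    unfolding N1[OF that] by (simp add: emeasure_eq_measure)
  have eq: "N1 = N2"
  proof (rule measure_eqI_lessThan)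
    show "sets N1 = sets borel" "sets N2 = sets borel" by (simp_all add: N1_def N2_def)
    show "emeasure N1 {x<..} < \<infinity>" for x by (rule fin) simp
    show "emeasure N1 {x<..} = emeasure N2 {x<..}" for x by (rule tail)
  qed
  show ?thesis
    unfolding has_density_on_pos_def
  proof (intro conjI ballI allI impI)
    show "kendall_density b \<in> borel_measurable borel" by measurable
    show "0 \<le> kendall_density b t" for t by (rule kendall_density_nonneg[OF b])
    fix A :: "real set" assume A: "A \<in> sets borel" "A \<subseteq> {0<..}"
    have [measurable]: "A \<in> sets borel" by (rule A)
    have "ereal ` A = {y. \<bar>y\<bar> \<noteq> \<infinity> \<and> real_of_ereal y \<in> A}"
    proof (intro set_eqI iffI)
      fix y :: ereal assume "y \<in> {y. \<bar>y\<bar> \<noteq> \<infinity> \<and> real_of_ereal y \<in> A}"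
      then show "y \<in> ereal ` A" by (cases y) auto
    qed auto
    then have [measurable]: "ereal ` A \<in> sets borel" by simp
    have "emeasure (distr M borel (hitting b)) (ereal ` A) = emeasure M {w \<in> H. real_of_ereal (hitting b w) \<in> A}"
    proof (subst emeasure_distr)
      have "hitting b -` (ereal ` A) \<inter> space M = {w \<in> H. real_of_ereal (hitting b w) \<in> A}"
      proof (intro set_eqI iffI)
        fix w assume "w \<in> hitting b -` (ereal ` A) \<inter> space M"
        then show "w \<in> {w \<in> H. real_of_ereal (hitting b w) \<in> A}" using A(2) by (auto simp: H_def)
      next
        fix w assume "w \<in> {w \<in> H. real_of_ereal (hitting b w) \<in> A}"
        then show "w \<in> hitting b -` (ereal ` A) \<inter> space M"
          by (cases "hitting b w") (auto simp: H_def)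
      qed
      then show "emeasure M (hitting b -` (ereal ` A) \<inter> space M) = emeasure M {w \<in> H. real_of_ereal (hitting b w) \<in> A}"
        by (simp only:)
    qed auto
    also have "\<dots> = emeasure N2 A" unfolding N1[OF A(1), symmetric] eq ..
    finally show "emeasure (distr M borel (hitting b)) (ereal ` A) = (\<integral>\<^sup>+t\<in>A. ennreal (kendall_density b t) \<partial>lborel)"
      unfolding N2[OF A(1)] .
  qed
qed

lemma kendall_density_asymptotics:
  assumes "0 < b"
  shows "kendall_density b \<sim>[at_top] (\<lambda>t. b / sqrt (2 * pi * K.variance) * t powr (- 3 / 2))"
proof (rule asymp_equivI')
  let ?c = "1 / sqrt (2 * pi * K.variance)"
  let ?g = "\<lambda>t. b / sqrt (2 * pi * K.variance) * t powr (- 3 / 2)"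
  have v: "0 < 2 * pi * K.variance" using K.variance_pos by simp
  have "((\<lambda>t. (sqrt t * K.time_density t b) / ?c)
      \<longlongrightarrow> ?c / ?c) at_top"
    by (rule tendsto_divide[OF K.time_density_asymptotics tendsto_const]) (use K.variance_pos in simp)
  moreover have "?c / ?c = 1"
    by (rule divide_self) (use K.variance_pos in simp)
  ultimately have "((\<lambda>t. (sqrt t * K.time_density t b) / ?c) \<longlongrightarrow> 1) at_top"
    by (simp only:)
  moreover have "\<forall>\<^sub>F t in at_top. (sqrt t * K.time_density t b) / ?c
      = kendall_density b t / (?g t)"
  proof (rule eventually_at_top_linorderI[of 1])
    fix t :: real assume t: "1 \<le> t"
    have "t powr (- 3 / 2) = t powr (- 1 + - (1 / 2))" by simp
    also have "\<dots> = t powr (- 1) * t powr (- (1 / 2))" by (rule powr_add)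
    also have "\<dots> = 1 / (t * sqrt t)" using t by (simp add: powr_minus_divide powr_half_sqrt)
    finally have "t powr (- 3 / 2) = 1 / (t * sqrt t)" .
    then show "(sqrt t * K.time_density t b) / ?c
      = kendall_density b t / (?g t)"
      using t assms by (simp add: kendall_density_def)
  qed
  ultimately show "((\<lambda>t. kendall_density b t / (?g t)) \<longlongrightarrow> 1) at_top"
    by (rule Lim_transform_eventually)
qed

end

section \<open>Levy processes given by their characteristics\<close>

definition jump_variance :: "real measure \<Rightarrow> real measure" where
  "jump_variance \<nu> = density \<nu> (\<lambda>z. ennreal (z\<^sup>2 * indicator {..<0} z))"

definition canonical_measure :: "real \<Rightarrow> real measure \<Rightarrow> real measure" where
  "canonical_measure \<sigma> \<nu> = measure_of UNIV (sets borel)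
     (\<lambda>A. ennreal (\<sigma>\<^sup>2) * emeasure (return borel 0) A + emeasure (jump_variance \<nu>) A)"

locale levy_triplet =
  fixes \<sigma> :: real and \<nu> :: "real measure"
  assumes sets_nu [measurable_cong]: "sets \<nu> = sets borel"
    and second_moment: "(\<integral>\<^sup>+ z\<in>{..<0}. ennreal (z\<^sup>2) \<partial>\<nu>) < \<infinity>"
begin

abbreviation "D \<equiv> jump_variance \<nu>"
abbreviation "K \<equiv> canonical_measure \<sigma> \<nu>"

lemma space_nu: "space \<nu> = UNIV"
  using sets_eq_imp_space_eq[OF sets_nu] by simp

lemma sets_D [measurable_cong]: "sets D = sets borel" and space_D: "space D = UNIV"
  by (simp_all add: jump_variance_def sets_nu space_nu)

lemma sets_K [measurable_cong]: "sets K = sets borel"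
proof -
  have "sigma_sets UNIV (sets (borel :: real measure)) = sets borel"
    using sets.sigma_sets_eq[of "borel :: real measure"] by simp
  then show ?thesis unfolding canonical_measure_def by (subst sets_measure_of) auto
qed

lemma space_K: "space K = UNIV"
  using sets_eq_imp_space_eq[OF sets_K] by simp

lemma emeasure_D: "A \<in> sets borel \<Longrightarrow> emeasure D A = (\<integral>\<^sup>+ z\<in>A. ennreal (z\<^sup>2 * indicator {..<0} z) \<partial>\<nu>)"
  unfolding jump_variance_def by (subst emeasure_density) (auto simp: sets_nu)

lemma finite_D: "finite_measure D"
proof (rule finite_measureI)
  have "emeasure D (space D) = (\<integral>\<^sup>+ z\<in>{..<0}. ennreal (z\<^sup>2) \<partial>\<nu>)"
    unfolding space_D by (subst emeasure_D) (auto intro!: nn_integral_cong split: split_indicator)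
  with second_moment show "emeasure D (space D) \<noteq> \<infinity>" by simp
qed

lemma emeasure_K:
  assumes "A \<in> sets borel"
  shows "emeasure K A = ennreal (\<sigma>\<^sup>2) * indicator A 0 + emeasure D A"
proof -
  let ?\<mu> = "\<lambda>A. ennreal (\<sigma>\<^sup>2) * emeasure (return borel (0::real)) A + emeasure D A"
  have "emeasure K A = ?\<mu> A"
  proof (rule emeasure_measure_of[OF canonical_measure_def])
    show "positive (sets K) ?\<mu>" by (simp add: positive_def)
    show "countably_additive (sets K) ?\<mu>"
    proof (rule countably_additiveI)
      fix B :: "nat \<Rightarrow> real set"
      assume B: "range B \<subseteq> sets K" "disjoint_family B"
      have 1: "(\<Sum>i. emeasure (return borel (0::real)) (B i)) = emeasure (return borel 0) (\<Union>i. B i)"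
        by (rule suminf_emeasure) (use B sets_K in auto)
      have 2: "(\<Sum>i. emeasure D (B i)) = emeasure D (\<Union>i. B i)"
        by (rule suminf_emeasure) (use B sets_K sets_D in auto)
      show "(\<Sum>i. ?\<mu> (B i)) = ?\<mu> (\<Union>i. B i)"
        unfolding 1[symmetric] 2[symmetric] by (simp add: suminf_add[symmetric])
    qed
    show "A \<in> sets K" using assms by (simp add: sets_K)
  qed auto
  then show ?thesis using assms by simp
qed

lemma finite_K: "finite_measure K"
proof (rule finite_measureI)
  interpret D: finite_measure D by (rule finite_D)
  show "emeasure K (space K) \<noteq> \<infinity>"
    unfolding space_K using D.emeasure_finite[of UNIV] by (subst emeasure_K) (auto simp: ennreal_mult_eq_top_iff)
qed

lemma measure_K:
  assumes "A \<in> sets borel" shows "measure K A = \<sigma>\<^sup>2 * indicator A 0 + measure D A"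
proof -
  interpret D: finite_measure D by (rule finite_D)
  interpret K: finite_measure K by (rule finite_K)
  have "ennreal (measure K A) = ennreal (\<sigma>\<^sup>2 * indicator A 0 + measure D A)"
    using emeasure_K[OF assms] unfolding K.emeasure_eq_measure D.emeasure_eq_measure
    by (simp split: split_indicator)
  then show ?thesis by (subst (asm) ennreal_inj) auto
qed

lemma measure_D:
  assumes "A \<in> sets borel" "A \<subseteq> {..<0}" shows "measure D A = (LINT z:A|\<nu>. z\<^sup>2)"
proof -
  have [measurable]: "A \<in> sets borel" by fact
  have "(LINT z:A|\<nu>. z\<^sup>2) = enn2real (\<integral>\<^sup>+ z. ennreal (indicator A z *\<^sub>R z\<^sup>2) \<partial>\<nu>)"
    unfolding set_lebesgue_integral_def by (rule integral_eq_nn_integral) (auto simp: sets_nu)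
  also have "(\<integral>\<^sup>+ z. ennreal (indicator A z *\<^sub>R z\<^sup>2) \<partial>\<nu>) = emeasure D A"
    unfolding emeasure_D[OF assms(1)] using assms(2) by (intro nn_integral_cong) (auto split: split_indicator)
  finally show ?thesis by (simp add: measure_def)
qed

text \<open>
  The measure is split into its atom at \<open>0\<close> and the rest, which has a density with respect to \<open>\<nu>\<close>.
\<close>

lemma integral_K:
  fixes f :: "real \<Rightarrow> complex"
  assumes [measurable]: "f \<in> borel_measurable borel" and int: "integrable K f"
  shows "(CLINT z|K. f z) = of_real (\<sigma>\<^sup>2) * f 0 + (CLINT z:{..<0}|\<nu>. of_real (z\<^sup>2) * f z)"
proof -
  interpret K: finite_measure K by (rule finite_K)
  have z: "measure K {0} = \<sigma>\<^sup>2"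
  proof -
    have "emeasure D {0} = 0" by (subst emeasure_D) (auto intro!: nn_integral_zero' AE_I2 split: split_indicator)
    then show ?thesis by (subst measure_K) (auto simp: measure_def)
  qed
  have i0: "integrable K (\<lambda>z. indicator {0} z *\<^sub>R f z)" and i1: "integrable K (\<lambda>z. indicator (-{0}) z *\<^sub>R f z)"
    by (rule Bochner_Integration.integrable_bound[OF int]; auto split: split_indicator)+
  have "(CLINT z|K. f z) = (CLINT z|K. indicator {0} z *\<^sub>R f z + indicator (-{0}) z *\<^sub>R f z)"
    by (rule Bochner_Integration.integral_cong) (auto split: split_indicator)
  also have "\<dots> = (CLINT z|K. indicator {0} z *\<^sub>R f z) + (CLINT z|K. indicator (-{0}) z *\<^sub>R f z)"
    using i0 i1 by simp
  also have "(CLINT z|K. indicator {0} z *\<^sub>R f z) = (CLINT z|K. indicator {0} z *\<^sub>R f 0)"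
    by (rule Bochner_Integration.integral_cong) (auto split: split_indicator)
  also have "\<dots> = of_real (\<sigma>\<^sup>2) * f 0"
    using z by (simp add: scaleR_conv_of_real space_K K.emeasure_eq_measure sets_K)
  also have "(CLINT z|K. indicator (-{0}) z *\<^sub>R f z) = (CLINT z|density K (\<lambda>z. ennreal (indicator (-{0}) z)). f z)"
    by (rule integral_density[symmetric]) auto
  also have "density K (\<lambda>z. ennreal (indicator (-{0}) z)) = D"
  proof (rule measure_eqI)
    fix A assume "A \<in> sets (density K (\<lambda>z. ennreal (indicator (-{0}) z)))"
    then have A [measurable]: "A \<in> sets borel" by (simp add: sets_K)
    have "emeasure (density K (\<lambda>z. ennreal (indicator (-{0}) z))) A
        = (\<integral>\<^sup>+ z. ennreal (indicator (-{0}) z) * indicator A z \<partial>K)"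
      by (rule emeasure_density) (auto simp: sets_K)
    also have "\<dots> = (\<integral>\<^sup>+ z. indicator (A - {0}) z \<partial>K)"
      by (rule nn_integral_cong) (auto split: split_indicator)
    also have "\<dots> = emeasure K (A - {0})" by (rule nn_integral_indicator) (simp add: sets_K)
    also have "\<dots> = emeasure D (A - {0})" by (subst emeasure_K) auto
    also have "\<dots> = emeasure D A"
      unfolding emeasure_D[OF A] by (subst emeasure_D) (auto intro!: nn_integral_cong split: split_indicator)
    finally show "emeasure (density K (\<lambda>z. ennreal (indicator (-{0}) z))) A = emeasure D A" .
  qed (simp add: sets_K sets_D)
  also have "(CLINT z|D. f z) = (CLINT z|\<nu>. (z\<^sup>2 * indicator {..<0} z) *\<^sub>R f z)"
    unfolding jump_variance_def by (rule integral_density) (auto split: split_indicator)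
  also have "\<dots> = (CLINT z:{..<0}|\<nu>. of_real (z\<^sup>2) * f z)"
    unfolding set_lebesgue_integral_def
    by (rule Bochner_Integration.integral_cong) (auto simp: scaleR_conv_of_real split: split_indicator)
  finally show ?thesis .
qed

lemma kolmogorov_measure_K:
  assumes "\<sigma> \<noteq> 0 \<or> (\<exists>s::real. 0 < s \<and> s < 2 \<and>
        Liminf (at_right 0) (\<lambda>x::real. ereal (x powr (s - 2) * (LINT z:{-x<..<0}|\<nu>. z\<^sup>2))) > 0)"
  shows "kolmogorov_measure K"
proof -
  let ?V = "\<lambda>x. LINT z:{-x<..<0}|\<nu>. z\<^sup>2"
  interpret K: finite_measure K by (rule finite_K)
  interpret D: finite_measure D by (rule finite_D)
  have np: "emeasure K {0<..} = 0"
    by (subst emeasure_K, simp, subst emeasure_D) (auto intro!: nn_integral_zero' AE_I2 split: split_indicator)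
  have "\<exists>c>0. \<exists>x0>0. \<exists>r. 0 < r \<and> r < 2 \<and>
        (\<forall>x. 0 < x \<and> x \<le> x0 \<longrightarrow> c * x powr (2 - r) \<le> measure K {-x<..0})"
    using assms
  proof
    assume s: "\<sigma> \<noteq> 0"
    have "\<sigma>\<^sup>2 * x powr (2 - 1) \<le> measure K {-x<..0}" if x: "0 < x \<and> x \<le> 1" for x
    proof -
      have "\<sigma>\<^sup>2 * x powr (2 - 1) \<le> \<sigma>\<^sup>2 * 1" using x by (intro mult_left_mono) auto
      also have "\<dots> \<le> measure K {-x<..0}" using x by (subst measure_K) auto
      finally show ?thesis .
    qed
    then show ?thesis using s by (intro exI[of _ "\<sigma>\<^sup>2"] exI[of _ 1] conjI) auto
  next
    assume "\<exists>s::real. 0 < s \<and> s < 2 \<and>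
        Liminf (at_right 0) (\<lambda>x::real. ereal (x powr (s - 2) * ?V x)) > 0"
    then obtain r :: real where r: "0 < r" "r < 2"
      and L: "Liminf (at_right 0) (\<lambda>x::real. ereal (x powr (r - 2) * ?V x)) > 0"
      by blast
    obtain c :: real where c: "0 < c" and cL: "ereal c < Liminf (at_right 0) (\<lambda>x::real. ereal (x powr (r - 2) * ?V x))"
      using ereal_dense2[OF L] by auto
    have "\<forall>\<^sub>F x in at_right 0. ereal c < ereal (x powr (r - 2) * ?V x)"
      by (rule less_LiminfD[OF cL])
    then obtain x1 :: real where x1: "x1 > 0" and ev: "\<And>x. 0 < x \<Longrightarrow> x < x1 \<Longrightarrow> c < x powr (r - 2) * ?V x"
      unfolding eventually_at_right_field by auto
    have "c * x powr (2 - r) \<le> measure K {-x<..0}" if x: "0 < x \<and> x \<le> x1 / 2" for x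
    proof -
      have "c * x powr (2 - r) \<le> (x powr (r - 2) * ?V x) * x powr (2 - r)"
        using ev[of x] x x1 by (intro mult_right_mono) auto
      also have "\<dots> = ?V x * (x powr (r - 2) * x powr (2 - r))" by (simp only: mult_ac)
      also have "x powr (r - 2) * x powr (2 - r) = 1" using x by (simp flip: powr_add)
      also have "?V x * 1 = measure D {-x<..<0}" by (subst measure_D) auto
      also have "\<dots> \<le> measure D {-x<..0}" by (rule D.finite_measure_mono) (auto simp: sets_D)
      also have "\<dots> \<le> measure K {-x<..0}" by (subst measure_K) auto
      finally show ?thesis .
    qed
    then show ?thesis using c x1 r by (intro exI[of _ c] exI[of _ "x1 / 2"] exI[of _ r] conjI) auto
  qed
  then show ?thesis
    by (intro kolmogorov_measure.intro kolmogorov_measure_axioms.intro finite_K sets_K np)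
qed

lemma psi_K:
  assumes "kolmogorov_measure K"
  shows "kolmogorov_measure.psi K u = levy_exponent \<sigma> 0 \<nu> (\<i> * of_real u)"
proof -
  interpret K: kolmogorov_measure K by fact
  have "K.psi u = of_real (\<sigma>\<^sup>2) * levy_kernel u 0 + (CLINT z:{..<0}|\<nu>. of_real (z\<^sup>2) * levy_kernel u z)"
    unfolding K.psi_def by (rule integral_K) (use K.integrable_levy_kernel in auto)
  also have "of_real (\<sigma>\<^sup>2) * levy_kernel u 0 = of_real (\<sigma>\<^sup>2 / 2) * (\<i> * of_real u)\<^sup>2 + of_real 0 * (\<i> * of_real u)"
    by (simp add: levy_kernel_def power_mult_distrib)
  also have "(CLINT z:{..<0}|\<nu>. of_real (z\<^sup>2) * levy_kernel u z)
      = (CLINT z:{..<0}|\<nu>. exp ((\<i> * of_real u) * of_real z) - 1 - (\<i> * of_real u) * of_real z)"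
    unfolding set_lebesgue_integral_def
    by (rule Bochner_Integration.integral_cong) (auto simp: levy_kernel_def mult.assoc split: split_indicator)
  finally show ?thesis unfolding levy_exponent_def .
qed

lemma variance_K:
  assumes "kolmogorov_measure K"
  shows "kolmogorov_measure.variance K = \<sigma>\<^sup>2 + (LINT z:{..<0}|\<nu>. z\<^sup>2)"
proof -
  interpret K: kolmogorov_measure K by fact
  have "measure D UNIV = measure D {..<0}"
  proof -
    have "emeasure D UNIV = emeasure D {..<0}"
      by (subst (1 2) emeasure_D) (auto intro!: nn_integral_cong split: split_indicator)
    then show ?thesis by (simp add: measure_def)
  qed
  then show ?thesis unfolding K.variance_def space_K
    by (subst measure_K) (auto simp: measure_D)
qed

end

text \<open>
  The first passage time agrees with a measurable function only almost surely, which is enough once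
  the measure is completed.
\<close>

lemma measurable_completion_cong_AE:
  assumes AE: "AE x in M. f x = g x" and g: "g \<in> measurable M N" and f: "\<And>x. x \<in> space M \<Longrightarrow> f x \<in> space N"
  shows "f \<in> measurable (completion M) N" "distr (completion M) N f = distr M N g"
proof -
  show m: "f \<in> measurable (completion M) N"
  proof (rule measurableI)
    fix A assume A: "A \<in> sets N"
    have "f -` A \<inter> space M \<in> sets (completion M)"
    proof (rule completion.in_sets_AE)
      show "g -` A \<inter> space M \<in> sets (completion M)" using measurable_sets[OF g A] by simp
      show "AE x in completion M. (x \<in> g -` A \<inter> space M) = (x \<in> f -` A \<inter> space M)"
        by (rule AE_completion) (use AE in eventually_elim, auto)
    qed auto
    then show "f -` A \<inter> space (completion M) \<in> sets (completion M)" by simp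
  qed (use f in auto)
  have "distr (completion M) N f = distr (completion M) N g"
    by (rule distr_cong_AE) (use AE_completion[OF AE] m measurable_completion[OF g] in auto)
  also have "\<dots> = distr M N g" by (rule distr_completion[OF g])
  finally show "distr (completion M) N f = distr M N g" .
qed

text \<open>
  Passing to \<open>X\<^sub>t - X\<^sub>0\<close> makes the starting point \<open>0\<close> everywhere instead of almost surely, and changes
  neither the increments nor the law of \<open>X\<^sub>1\<close>.
\<close>

lemma levy_process_imp_spectrally_negative:
  fixes X :: "real \<Rightarrow> 'a \<Rightarrow> real"
  assumes X: "levy_process M X" and K: "kolmogorov_measure K"
    and char: "\<And>u. char (distr M borel (X 1)) u = exp (kolmogorov_measure.psi K u)"
  shows "spectrally_negative_process M K (\<lambda>t w. X t w - X 0 w)"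
proof -
  interpret prob_space M using X by (simp add: levy_process_def)
  interpret K: kolmogorov_measure K by fact
  have rv: "X t \<in> borel_measurable M" if "0 \<le> t" for t
    using X that by (simp add: levy_process_def)
  show ?thesis
  proof (intro spectrally_negative_process.intro spectrally_negative_process_axioms.intro prob_space_axioms K)
    show "(\<lambda>w. X t w - X 0 w) \<in> borel_measurable M" if "0 \<le> t" for t
      using rv that by simp
    fix N :: nat assume N: "0 < N"
    show "indep_vars (\<lambda>_. borel) (\<lambda>i w. X (real (Suc i) / real N) w - X 0 w - (X (real i / real N) w - X 0 w)) {..<n}" for n
    proof -
      have "\<forall>(n::nat) s. 0 \<le> s 0 \<and> (\<forall>i<n. s i < s (Suc i)) \<longrightarrow>
        indep_vars (\<lambda>_. borel) (\<lambda>i w. X (s (Suc i)) w - X (s i) w) {..<n}"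
        using X by (simp add: levy_process_def)
      then have "indep_vars (\<lambda>_. borel) (\<lambda>i w. X (real (Suc i) / real N) w - X (real i / real N) w) {..<n}"
        by (elim allE[of _ n] allE[of _ "\<lambda>i. real i / real N"]) (use N in \<open>auto simp: divide_strict_right_mono\<close>)
      then show ?thesis by (simp del: of_nat_Suc)
    qed
    show "distr M borel (\<lambda>w. X (real (Suc i) / real N) w - X 0 w - (X (real i / real N) w - X 0 w))
        = distr M borel (\<lambda>w. X (1 / real N) w - X 0 w)" for i
    proof -
      have "\<forall>s\<ge>0. \<forall>t\<ge>0. distr M borel (\<lambda>w. X (s + t) w - X s w) = distr M borel (\<lambda>w. X t w - X 0 w)"
        using X by (simp add: levy_process_def)
      from this[rule_format, of "real i / real N" "1 / real N"]
      have "distr M borel (\<lambda>w. X (real i / real N + 1 / real N) w - X (real i / real N) w) = distr M borel (\<lambda>w. X (1 / real N) w - X 0 w)"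
        by simp
      moreover have "real i / real N + 1 / real N = real (Suc i) / real N" by (simp add: add_divide_distrib)
      ultimately show ?thesis by (simp del: of_nat_Suc)
    qed
  next
    show "char (distr M borel (\<lambda>w. X 1 w - X 0 w)) u = exp (K.psi u)" for u
    proof -
      have "AE w in M. X 0 w = 0" using X by (simp add: levy_process_def)
      then have "distr M borel (\<lambda>w. X 1 w - X 0 w) = distr M borel (X 1)"
        by (intro distr_cong_AE) (use rv in auto)
      then show ?thesis using char by simp
    qed
  qed simp
qed

text \<open>
  By right-continuity, a path that is above \<open>b\<close> at time \<open>t\<close> is above \<open>b\<close> at dyadic times
  arbitrarily close to \<open>t\<close>.
\<close>

lemma (in spectrally_negative_process) first_passage_time_eq_hitting:
  assumes X': "\<And>t. Y t = X t w" and c: "cadlag_path Y" and b: "0 \<le> b"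
  shows "(INF t\<in>{t. 0 < t \<and> b < Y t}. ereal t) = hitting b w"
proof (rule antisym)
  let ?I = "INF t\<in>{t. 0 < t \<and> b < Y t}. ereal t"
  show "?I \<le> hitting b w"
    unfolding hitting_def
  proof (rule INF_greatest)
    fix kn :: "nat \<times> nat"
    obtain k n where kn: "kn = (k, n)" by (cases kn)
    have "?I \<le> ereal (real k / 2 ^ n)" if bx: "b < X (real k / 2 ^ n) w"
    proof (rule INF_lower)
      have "k \<noteq> 0" using bx b X_0 by (cases k) auto
      then show "real k / 2 ^ n \<in> {t. 0 < t \<and> b < Y t}" using bx by (simp add: X')
    qed
    then show "?I
        \<le> (case kn of (k, n) \<Rightarrow> if b < X (real k / 2 ^ n) w then ereal (real k / 2 ^ n) else \<infinity>)"
      by (simp add: kn)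
  qed
  show "hitting b w \<le> ?I"
  proof (rule INF_greatest)
    fix t assume "t \<in> {t. 0 < t \<and> b < Y t}"
    then have t: "0 < t" "b < Y t" by auto
    let ?d = "\<lambda>n. real (dyadic_above t n) / 2 ^ n"
    have d: "?d \<longlonglongrightarrow> t" "t < ?d n" for n
      using dyadic_above_tendsto[of t] dyadic_above_bounds(1)[of t n] t by auto
    have "filterlim ?d (at_right t) sequentially"
      by (rule tendsto_imp_filterlim_at_right[OF d(1)]) (simp add: d(2))
    moreover have "(Y \<longlongrightarrow> Y t) (at_right t)"
      using c t unfolding cadlag_path_def continuous_within by simp
    ultimately have "(\<lambda>n. Y (?d n)) \<longlonglongrightarrow> Y t" by (rule filterlim_compose[rotated])
    then have "\<forall>\<^sub>F n in sequentially. b < Y (?d n)" using t(2) by (rule order_tendstoD(1))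
    then have "\<forall>\<^sub>F n in sequentially. hitting b w \<le> ereal (?d n)"
    proof eventually_elim
      case (elim n)
      have "hitting b w \<le> (case (dyadic_above t n, n) of (k, n) \<Rightarrow> if b < X (real k / 2 ^ n) w then ereal (real k / 2 ^ n) else \<infinity>)"
        unfolding hitting_def by (rule INF_lower) simp
      then show ?case using elim by (simp add: X')
    qed
    moreover have "(\<lambda>n. ereal (?d n)) \<longlonglongrightarrow> ereal t" using d(1) by simp
    ultimately show "hitting b w \<le> ereal t"
      by (intro tendsto_lowerbound) auto
  qed
qed

theorem theorem2p2:
  fixes M :: "'a measure" and X :: "real \<Rightarrow> 'a \<Rightarrow> real"
    and \<sigma> m b :: real and \<nu> :: "real measure"
  assumes "b > 0"
    and "levy_process M X"
    and "\<sigma> \<ge> 0"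
    and "levy_measure \<nu>"
    and "\<And>u. char (distr M borel (X 1)) u = exp (levy_exponent \<sigma> m \<nu> (\<i> * of_real u))"
    and "m = 0"
    and "emeasure \<nu> {0<..} = 0"
    and "(\<integral>\<^sup>+ z\<in>{..<0}. ennreal (min (z\<^sup>2) \<bar>z\<bar>) \<partial>\<nu>) < \<infinity>"
    and "condition_B2 \<nu>"
    and "\<sigma> > 0 \<or>
      (\<exists>s::real. 0 < s \<and> s < 2 \<and>
        Liminf (at_right 0) (\<lambda>x::real. ereal (x powr (s - 2) * (LINT z:{-x<..<0}|\<nu>. z\<^sup>2))) > 0)"
  shows "first_passage_time X b \<in> borel_measurable (completion M) \<and>
    (\<exists>p. has_density_on_pos (first_passage_law M X b) p \<and>
      p \<sim>[at_top] (\<lambda>t. b / sqrt (2 * pi * (\<sigma>\<^sup>2 + (LINT z:{..<0}|\<nu>. z\<^sup>2))) * t powr (- 3 / 2)))"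
proof -
  have sets_nu [measurable_cong]: "sets \<nu> = sets borel" using assms(4) by (simp add: levy_measure_def)
  interpret L: levy_triplet \<sigma> \<nu>
  proof
    have "(\<integral>\<^sup>+ z\<in>{..<0}. ennreal (z\<^sup>2) \<partial>\<nu>)
        \<le> (\<integral>\<^sup>+ z. ennreal (min 1 (z\<^sup>2)) + ennreal (z\<^sup>2) * indicator {..<-1} z \<partial>\<nu>)"
    proof (rule nn_integral_mono)
      fix z :: real
      show "ennreal (z\<^sup>2) * indicator {..<0} z \<le> ennreal (min 1 (z\<^sup>2)) + ennreal (z\<^sup>2) * indicator {..<-1} z"
      proof (cases "z < -1")
        case False
        then have "z < 0 \<Longrightarrow> z\<^sup>2 \<le> 1" by (simp add: abs_square_le_1)
        with False show ?thesis by (auto simp: min_def split: split_indicator)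
      qed simp
    qed
    also have "\<dots> = (\<integral>\<^sup>+ z. ennreal (min 1 (z\<^sup>2)) \<partial>\<nu>) + (\<integral>\<^sup>+ z\<in>{..<-1}. ennreal (z\<^sup>2) \<partial>\<nu>)"
      by (rule nn_integral_add) auto
    also have "\<dots> < \<infinity>"
      using assms(4,9) by (simp add: levy_measure_def condition_B2_def)
    finally show "(\<integral>\<^sup>+ z\<in>{..<0}. ennreal (z\<^sup>2) \<partial>\<nu>) < \<infinity>" .
  qed (rule sets_nu)
  have K: "kolmogorov_measure L.K"
    by (rule L.kolmogorov_measure_K) (use assms(10) in auto)
  have char: "char (distr M borel (X 1)) u = exp (kolmogorov_measure.psi L.K u)" for u
    unfolding L.psi_K[OF K] using assms(5,6) by simp
  interpret Y: spectrally_negative_process M L.K "\<lambda>t w. X t w - X 0 w"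
    by (rule levy_process_imp_spectrally_negative[OF assms(2) K char])
  have AE: "AE w in M. first_passage_time X b w = Y.hitting b w"
  proof -
    have "AE w in M. X 0 w = 0" "AE w in M. cadlag_path (\<lambda>t. X t w)"
      using assms(2) by (simp_all add: levy_process_def)
    then show ?thesis
    proof eventually_elim
      case (elim w)
      then show ?case unfolding first_passage_time_def
        by (intro Y.first_passage_time_eq_hitting) (use assms(1) in auto)
    qed
  qed
  note comp = measurable_completion_cong_AE[OF AE Y.hitting_measurable]
  have meas: "first_passage_time X b \<in> borel_measurable (completion M)" by (rule comp(1)) simp
  have law: "first_passage_law M X b = distr M borel (Y.hitting b)"
    unfolding first_passage_law_def by (rule comp(2)) simp
  have "has_density_on_pos (first_passage_law M X b) (Y.kendall_density b)"
    unfolding law by (rule Y.hitting_has_density) (use assms(1) in simp)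
  moreover have "Y.kendall_density b \<sim>[at_top] (\<lambda>t. b / sqrt (2 * pi * (\<sigma>\<^sup>2 + (LINT z:{..<0}|\<nu>. z\<^sup>2))) * t powr (- 3 / 2))"
    using Y.kendall_density_asymptotics[OF assms(1)] unfolding L.variance_K[OF K] .
  ultimately show ?thesis using meas by blast
qed

end
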